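(* Let $X$ be a real random variable with $\mathbb{E}X=0$, $\mathrm{Var}(X)=1$ and $\mathbb{E}\,e^{b|X|}<\infty$ for some $b>0$, let $(X_k)_{k\ge 1}$ be independent copies of $X$, and let $Z_n=(X_1+\dots+X_n)/\sqrt n$. Assume that for some $n_0\ge 1$ the random variable $Z_{n_0}$ has a bounded density. For $n\ge 2n_0$ let $p_n$ be the continuous bounded density of $Z_n$. Then there is a constant $\tau_0>0$ such that, for all $n\ge 2n_0$ and all real $x$ such that $\tau=x/\sqrt n$ satisfies $|\tau|\le\tau_0$, $$\frac{p_n(x)}{\varphi(x)}=e^{n\tau^3\lambda(\tau)-\mu(\tau)}\Big(1+O\big(n^{-1}(\log n)^3\big)\Big),$$ where $\lambda$ and $\mu$ are the functions defined in the context, $\mu$ being analytic in $|\tau|\le\tau_0$ with $\mu(0)=0$. The constant in $O$ is uniform over all such $n$ and $x$ (it may depend on the distribution of $X$ and on $n_0$).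
   Context: $\varphi(x)=\frac{1}{\sqrt{2\pi}}e^{-x^2/2}$. Under the stated assumptions, every $Z_n$ with $n\ge 2n_0$ has a continuous bounded density. Definition of $\lambda$ and $\mu$: choose $\alpha>0$ with $\mathbb{E}\,e^{\alpha|X|}\le 2$ (such $\alpha$ exists because $\mathbb{E}\,e^{b|X|}<\infty$). The log-Laplace transform $K(z)=\log\mathbb{E}\,e^{zX}$ (principal branch) is analytic in the complex disc $|z|\le\alpha/2$. For complex $\tau$ with $|\tau|\le\alpha^3/32$, the saddle point $z_0(\tau)$ is the unique solution $z$ of $K'(z)=\tau$ in the disc $|z|\le\alpha^3/16$; it is an analytic function of $\tau$ with $z_0(0)=0$. Put $$\lambda(\tau)=\frac{1}{\tau^3}\Big(K(z_0(\tau))-\tau z_0(\tau)+\tfrac12\tau^2\Big),\qquad \mu(\tau)=\tfrac12\log K''(z_0(\tau)),$$ with $\lambda$ extended analytically to $\tau=0$ and with the principal value of the logarithm. The power series of $\lambda$ at $0$ is called Cramér's series. *)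

theory Defs
  imports "HOL-Probability.Probability" "HOL-Complex_Analysis.Complex_Analysis"
begin

definition norm_sum :: "(nat \<Rightarrow> 'a \<Rightarrow> real) \<Rightarrow> nat \<Rightarrow> 'a \<Rightarrow> real" where
  "norm_sum Xs n \<omega> = (\<Sum>k=1..n. Xs k \<omega>) / sqrt (real n)"

text \<open>Nonnegativity is required explicitly because \<^const>\<open>ennreal\<close> truncates negative
  values to 0; without it a continuous density would not be unique.\<close>
definition bounded_density :: "'a measure \<Rightarrow> ('a \<Rightarrow> real) \<Rightarrow> (real \<Rightarrow> real) \<Rightarrow> bool" where
  "bounded_density M Z f \<longleftrightarrow>
     (\<forall>x. 0 \<le> f x) \<and> bounded (range f) \<and> distributed M lborel Z (\<lambda>x. ennreal (f x))"

definition cont_density :: "'a measure \<Rightarrow> ('a \<Rightarrow> real) \<Rightarrow> real \<Rightarrow> real" where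
  "cont_density M Z = (THE f. bounded_density M Z f \<and> continuous_on UNIV f)"

definition exp_radius :: "'a measure \<Rightarrow> ('a \<Rightarrow> real) \<Rightarrow> real \<Rightarrow> bool" where
  "exp_radius M X \<alpha> \<longleftrightarrow> \<alpha> > 0 \<and> integrable M (\<lambda>\<omega>. exp (\<alpha> * \<bar>X \<omega>\<bar>)) \<and>
     prob_space.expectation M (\<lambda>\<omega>. exp (\<alpha> * \<bar>X \<omega>\<bar>)) \<le> 2"

definition log_laplace :: "'a measure \<Rightarrow> ('a \<Rightarrow> real) \<Rightarrow> complex \<Rightarrow> complex" where
  "log_laplace M X z = Ln (prob_space.expectation M (\<lambda>\<omega>. exp (z * complex_of_real (X \<omega>))))"

text \<open>The functions below are meaningful for \<open>exp_radius M X \<alpha>\<close> and \<open>norm \<tau> \<le> \<alpha>^3/32\<close>.\<close>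
definition saddle_point :: "'a measure \<Rightarrow> ('a \<Rightarrow> real) \<Rightarrow> real \<Rightarrow> complex \<Rightarrow> complex" where
  "saddle_point M X \<alpha> \<tau> = (THE z. norm z \<le> \<alpha>^3 / 16 \<and> deriv (log_laplace M X) z = \<tau>)"

definition cramer_quotient :: "'a measure \<Rightarrow> ('a \<Rightarrow> real) \<Rightarrow> real \<Rightarrow> complex \<Rightarrow> complex" where
  "cramer_quotient M X \<alpha> \<tau> =
     (log_laplace M X (saddle_point M X \<alpha> \<tau>) - \<tau> * saddle_point M X \<alpha> \<tau> + \<tau>^2 / 2) / \<tau>^3"

definition cramer_lambda :: "'a measure \<Rightarrow> ('a \<Rightarrow> real) \<Rightarrow> real \<Rightarrow> complex \<Rightarrow> complex" where
  "cramer_lambda M X \<alpha> \<tau> =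
     (if \<tau> = 0 then Lim (at 0) (cramer_quotient M X \<alpha>) else cramer_quotient M X \<alpha> \<tau>)"

definition cramer_mu :: "'a measure \<Rightarrow> ('a \<Rightarrow> real) \<Rightarrow> real \<Rightarrow> complex \<Rightarrow> complex" where
  "cramer_mu M X \<alpha> \<tau> = Ln (deriv (deriv (log_laplace M X)) (saddle_point M X \<alpha> \<tau>)) / 2"

lemma (in prob_space) exp_radius_exists:
  fixes X :: "'a \<Rightarrow> real" and b :: real
  assumes X: "X \<in> borel_measurable M" and b: "b > 0"
    and int: "integrable M (\<lambda>\<omega>. exp (b * \<bar>X \<omega>\<bar>))"
  shows "\<exists>\<alpha>. exp_radius M X \<alpha>"
proof -
  define a where "a n = b / real (Suc n)" for n
  have a: "a n > 0" "a n \<le> b" for n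
    using b by (auto simp: a_def field_simps)
  have a0: "a \<longlonglongrightarrow> 0"
    unfolding a_def using LIMSEQ_inverse_real_of_nat[THEN tendsto_mult_right_zero, of b]
    by (simp add: divide_inverse)
  have bound: "norm (exp (a n * \<bar>X \<omega>\<bar>)) \<le> exp (b * \<bar>X \<omega>\<bar>)" for n \<omega>
    using a(2)[of n] by (simp add: mult_right_mono)
  have lim: "(\<lambda>n. exp (a n * \<bar>X \<omega>\<bar>)) \<longlonglongrightarrow> 1" for \<omega>
    using tendsto_exp[OF tendsto_mult_left_zero[OF a0, of "\<bar>X \<omega>\<bar>"]] by simp
  have "(\<lambda>n. expectation (\<lambda>\<omega>. exp (a n * \<bar>X \<omega>\<bar>))) \<longlonglongrightarrow> expectation (\<lambda>\<omega>. 1)"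
    by (rule integral_dominated_convergence[where w = "\<lambda>\<omega>. exp (b * \<bar>X \<omega>\<bar>)"])
       (use X int bound lim in auto)
  then have "(\<lambda>n. expectation (\<lambda>\<omega>. exp (a n * \<bar>X \<omega>\<bar>))) \<longlonglongrightarrow> 1"
    by (simp add: prob_space)
  then have "eventually (\<lambda>n. expectation (\<lambda>\<omega>. exp (a n * \<bar>X \<omega>\<bar>)) < 2) sequentially"
    by (rule order_tendstoD) simp
  then obtain n where n: "expectation (\<lambda>\<omega>. exp (a n * \<bar>X \<omega>\<bar>)) < 2"
    by (auto simp: eventually_sequentially)
  have "integrable M (\<lambda>\<omega>. exp (a n * \<bar>X \<omega>\<bar>))"
    by (rule Bochner_Integration.integrable_bound[OF int]) (use X bound in auto)
  then show ?thesis
    using n a(1)[of n] by (auto simp: exp_radius_def intro!: exI[of _ "a n"])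
qed

end

theory Submission imports Defs begin

text \<open>
  Let \<open>L\<close> be the Laplace transform of \<open>X\<close>, \<open>K = Ln L\<close>, and let \<open>S\<^sub>n\<close> be the sum of \<open>n\<close> copies of
  \<open>X\<close>, so that \<open>Z\<^sub>n = S\<^sub>n / sqrt n\<close>. The proof is the saddle point method, in the probabilistic form
  of exponential tilting. For small real \<open>s\<close>, the law of \<open>Z\<^sub>n\<close> weighted by
  \<open>exp (s * S\<^sub>n) / L s ^ n\<close> is again a probability law, with characteristic function
  \<open>t \<mapsto> (L (s + \<i> * t / sqrt n) / L s) ^ n\<close>. If this function is integrable, Fourier inversion
  gives the continuous density of the tilted law, and thereby
  \<open>p\<^sub>n x = exp (- s * sqrt n * x) * L s ^ n * J / (2 * pi)\<close>, where \<open>J\<close> is the inversion integral.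
  For \<open>x = sqrt n * \<tau>\<close> the tilt \<open>s\<close> is chosen as the saddle point, \<open>K' s = \<tau>\<close>. Then the tilted
  law has mean \<open>x\<close>: near \<open>t = 0\<close> the integrand is \<open>exp (- K'' s * t\<^sup>2 / 2)\<close> up to terms of
  higher order, \<open>J\<close> is close to \<open>sqrt (2 * pi / K'' s)\<close>, and the exponential prefactor divided by
  the normal density is \<open>exp (n * \<tau> ^ 3 * \<lambda> \<tau>)\<close> by the definition of \<open>\<lambda>\<close>, while
  \<open>1 / sqrt (K'' s) = exp (- \<mu> \<tau>)\<close>.

  Three facts make this rigorous, uniformly in \<open>n\<close> and \<open>\<tau>\<close>.

  \<^item> The saddle point. The bound \<open>E (exp (\<alpha> * \<bar>X\<bar>)) \<le> 2\<close> forces \<open>norm (K'' z - 1) \<le> 2 / 3\<close> on the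
    disc \<open>norm z \<le> \<alpha> ^ 3 / 16\<close> (\<open>norm_K''_minus_one_le\<close>). So \<open>K'\<close> is injective there, its local
    inverse is the saddle point (\<open>saddle_point_local\<close>), and \<open>\<mu>\<close> is analytic.

  \<^item> High frequencies. A bounded density of \<open>Z\<close> with index \<open>n0\<close> makes the tilted density square
    integrable, so \<open>\<bar>L (s + \<i> * t)\<bar> ^ (2 * n0)\<close> is integrable in \<open>t\<close> by Plancherel
    (\<open>laplace_power_integrable\<close>); this is where \<open>n \<ge> 2 * n0\<close> comes from. Consequently the
    characteristic function of \<open>X\<close> tends to 0, and its modulus is bounded by some \<open>\<rho> < 1\<close> away
    from 0 (\<open>char_away_from_zero\<close>). This persists on nearby vertical lines
    (\<open>laplace_away_from_real_axis\<close>), and the contribution of these frequencies to \<open>J\<close> is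
    exponentially small.

  \<^item> Low frequencies. Since \<open>J\<close> is real, only the real part of the integrand matters. In the
    logarithm of the integrand the cubic Taylor term is imaginary, so it enters through a cosine,
    that is quadratically. The relative error is therefore of order \<open>1 / n\<close> and not
    \<open>1 / sqrt n\<close> (\<open>central_bound\<close>). An error \<open>1 / n\<close> is stronger than the stated
    \<open>(ln n) ^ 3 / n\<close>, as \<open>n \<ge> 2\<close>.
\<close>

section \<open>Fourier inversion for integrable characteristic functions\<close>

definition fourier_integral :: "(real \<Rightarrow> complex) \<Rightarrow> real \<Rightarrow> complex" where
  "fourier_integral \<phi> y = (CLBINT t. iexp (-(t * y)) * \<phi> t)"

text \<open>The real part is taken so that densities are real by definition; for the characteristic
  function of a law the imaginary part vanishes.\<close>

definition inverse_fourier_density :: "(real \<Rightarrow> complex) \<Rightarrow> real \<Rightarrow> real" where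
  "inverse_fourier_density \<phi> y = Re (fourier_integral \<phi> y) / (2 * pi)"

lemma norm_exp_neg_i_mult [simp]:
  "norm (exp (- (\<i> * (complex_of_real x * complex_of_real y)))) = 1"
  by (simp add: norm_exp_eq_Re)

lemma fourier_integrand_integrable:
  assumes "integrable lborel \<phi>"
  shows "integrable lborel (\<lambda>t. iexp (-(t * y)) * \<phi> t)"
  by (rule Bochner_Integration.integrable_bound[OF assms]) (use assms in \<open>auto simp: norm_mult\<close>)

lemma norm_fourier_integral_le:
  assumes "integrable lborel \<phi>"
  shows "norm (fourier_integral \<phi> y) \<le> (LBINT t. norm (\<phi> t))"
proof -
  have "norm (fourier_integral \<phi> y) \<le> (LBINT t. norm (iexp (-(t * y)) * \<phi> t))"
    unfolding fourier_integral_def by (rule integral_norm_bound)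
  then show ?thesis by (simp add: norm_mult)
qed

lemma continuous_fourier_integral:
  assumes "integrable lborel \<phi>"
  shows "continuous_on UNIV (fourier_integral \<phi>)"
proof -
  have [measurable]: "\<phi> \<in> borel_measurable borel"
    using borel_measurable_integrable[OF assms] by simp
  have "(\<lambda>n. fourier_integral \<phi> (u n)) \<longlonglongrightarrow> fourier_integral \<phi> y" if u: "u \<longlonglongrightarrow> y" for u y
    unfolding fourier_integral_def
    by (rule integral_dominated_convergence[where w = "\<lambda>t. norm (\<phi> t)"])
       (use assms in \<open>auto simp: norm_mult intro!: tendsto_intros u\<close>)
  then show ?thesis
    by (simp add: continuous_on_eq_continuous_at isCont_def tendsto_at_iff_sequentially o_def)
qed

lemma continuous_inverse_fourier_density:
  "integrable lborel \<phi> \<Longrightarrow> continuous_on UNIV (inverse_fourier_density \<phi>)"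
  unfolding inverse_fourier_density_def
  by (intro continuous_intros continuous_fourier_integral) auto

lemma bounded_inverse_fourier_density:
  assumes "integrable lborel \<phi>"
  shows "bounded (range (inverse_fourier_density \<phi>))"
proof -
  have "\<bar>inverse_fourier_density \<phi> y\<bar> \<le> (LBINT t. norm (\<phi> t)) / (2 * pi)" for y
  proof -
    have "\<bar>Re (fourier_integral \<phi> y)\<bar> \<le> (LBINT t. norm (\<phi> t))"
      using norm_fourier_integral_le[OF assms] abs_Re_le_cmod order_trans by blast
    then show ?thesis
      by (simp add: inverse_fourier_density_def divide_right_mono)
  qed
  then show ?thesis by (auto simp: bounded_iff)
qed

lemma integral_iexp_Icc:
  fixes a b t :: real
  assumes "a \<le> b" "t \<noteq> 0"
  shows "(CLBINT y. indicator {a..b} y *\<^sub>R iexp (-(t * y))) = (iexp (-(t * a)) - iexp (-(t * b))) / (\<i> * t)"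
proof -
  define F where "F y = \<i> * iexp (-(t * y)) / t" for y :: real
  have d: "(F has_vector_derivative iexp (-(t * y))) (at y within {a..b})" for y
  proof -
    have "((\<lambda>w. \<i> * exp (\<i> * (-(complex_of_real t * w))) / t) has_field_derivative
        exp (\<i> * (-(complex_of_real t * of_real y)))) (at (of_real y))"
      using assms by (auto intro!: derivative_eq_intros simp: field_simps)
    from has_vector_derivative_real_field[OF this]
    show ?thesis unfolding F_def by simp
  qed
  have "(CLBINT y. indicator {a..b} y *\<^sub>R iexp (-(t * y))) = F b - F a"
    by (rule integral_FTC_Icc[OF assms(1) d]) (auto intro!: continuous_intros)
  also have "\<dots> = (iexp (-(t * a)) - iexp (-(t * b))) / (\<i> * t)"
    using assms by (simp add: F_def field_simps)
  finally show ?thesis .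
qed

lemma integrable_indicator_Icc:
  fixes a b :: real
  shows "integrable lborel (indicat_real {a..b})"
  by (rule integrable_real_indicator) (cases "a \<le> b"; simp)+

text \<open>The kernel of Levy's inversion formula is the integral of \<open>y \<mapsto> iexp (-(t * y))\<close> over
  \<open>{a..b}\<close>. For an integrable \<open>\<phi>\<close>, Fubini's theorem therefore turns Levy's principal value
  into the integral of a function over the interval, which is how a density appears.\<close>

lemma inverse_fourier_density_Icc:
  fixes \<phi> :: "real \<Rightarrow> complex"
  assumes int: "integrable lborel \<phi>" and ab: "a \<le> b"
  shows "(CLBINT t. (iexp (-(t * a)) - iexp (-(t * b))) / (\<i> * t) * \<phi> t)
       = (CLBINT y. indicator {a..b} y *\<^sub>R fourier_integral \<phi> y)"
proof -
  have [measurable]: "\<phi> \<in> borel_measurable borel"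
    using borel_measurable_integrable[OF int] by simp
  have "integrable (lborel \<Otimes>\<^sub>M lborel) (\<lambda>(t, y). indicator {a..b} y *\<^sub>R \<phi> t)"
  proof (rule lborel_pair.Fubini_integrable)
    show "(\<lambda>(t, y). indicator {a..b} y *\<^sub>R \<phi> t) \<in> borel_measurable (lborel \<Otimes>\<^sub>M lborel)"
      by measurable
    have "(LBINT y. norm (indicator {a..b} y *\<^sub>R \<phi> t)) = (b - a) * norm (\<phi> t)" for t
      using ab by simp
    then show "integrable lborel (\<lambda>t. LBINT y. norm (case (t, y) of (t, y) \<Rightarrow> indicator {a..b} y *\<^sub>R \<phi> t))"
      using int by simp
    show "AE t in lborel. integrable lborel (\<lambda>y. case (t, y) of (t, y) \<Rightarrow> indicator {a..b} y *\<^sub>R \<phi> t)"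
      using integrable_indicator_Icc[of a b] by (auto intro!: integrable_scaleR_left)
  qed
  then have I: "integrable (lborel \<Otimes>\<^sub>M lborel) (\<lambda>(t, y). indicator {a..b} y *\<^sub>R (iexp (-(t * y)) * \<phi> t))"
    by (rule Bochner_Integration.integrable_bound) (auto simp: norm_mult)
  have "(CLBINT t. (iexp (-(t * a)) - iexp (-(t * b))) / (\<i> * t) * \<phi> t)
      = (CLBINT t. CLBINT y. indicator {a..b} y *\<^sub>R (iexp (-(t * y)) * \<phi> t))"
  proof (rule integral_cong_AE)
    have "AE t in lborel. t \<noteq> (0 :: real)"
      by (rule AE_lborel_singleton)
    then show "AE t in lborel. (iexp (-(t * a)) - iexp (-(t * b))) / (\<i> * t) * \<phi> t
        = (CLBINT y. indicator {a..b} y *\<^sub>R (iexp (-(t * y)) * \<phi> t))"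
    proof eventually_elim
      case (elim t)
      have "(CLBINT y. indicator {a..b} y *\<^sub>R (iexp (-(t * y)) * \<phi> t))
          = (CLBINT y. (indicator {a..b} y *\<^sub>R iexp (-(t * y))) * \<phi> t)"
        by simp
      also have "\<dots> = (CLBINT y. indicator {a..b} y *\<^sub>R iexp (-(t * y))) * \<phi> t"
        by (rule integral_mult_left_zero)
      finally show ?case using integral_iexp_Icc[OF ab elim] by simp
    qed
  qed measurable
  also have "\<dots> = (CLBINT y. CLBINT t. indicator {a..b} y *\<^sub>R (iexp (-(t * y)) * \<phi> t))"
    by (rule lborel_pair.Fubini_integral[OF I, symmetric])
  also have "\<dots> = (CLBINT y. indicator {a..b} y *\<^sub>R fourier_integral \<phi> y)"
    unfolding fourier_integral_def by simp
  finally show ?thesis .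
qed

lemma integrable_indicator_Icc_continuous:
  fixes f :: "real \<Rightarrow> 'a::euclidean_space"
  assumes "continuous_on UNIV f"
  shows "integrable lborel (\<lambda>y. indicator {a..b} y *\<^sub>R f y)"
  using borel_integrable_compact[of "{a..b}" f] assms continuous_on_subset
  by (metis compact_Icc indicator_scaleR_eq_if subset_UNIV)

context real_distribution
begin

text \<open>Levy's formula truncates to \<open>[-T, T]\<close>; integrability of the characteristic function lets
  dominated convergence remove the truncation. The formula applies to continuity points \<open>a\<close> and
  \<open>b\<close> only, a restriction that the next lemma lifts.\<close>

lemma measure_Ioc_no_atoms:
  assumes int: "integrable lborel (char M)" and ab: "a \<le> b"
    and atoms: "measure M {a} = 0" "measure M {b} = 0"
  shows "measure M {a<..b} = (LBINT y. indicator {a..b} y * inverse_fourier_density (char M) y)"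
proof -
  define G where "G t = (iexp (-(t * a)) - iexp (-(t * b))) / (\<i> * t) * char M t" for t
  have [measurable]: "G \<in> borel_measurable borel" unfolding G_def by measurable
  have bound: "norm (G t) \<le> (b - a) * norm (char M t)" for t
  proof (cases "t = 0")
    case True then show ?thesis using ab by (simp add: G_def)
  next
    case False
    have "norm ((iexp (-(t * a)) - iexp (-(t * b))) / (\<i> * t)) \<le> b - a"
      using Levy_Inversion_aux2[of "-b" "-a" t] ab False by simp
    then show ?thesis unfolding G_def norm_mult by (intro mult_right_mono) auto
  qed
  have eq: "(CLBINT t=-real T..real T. G t) = (CLBINT t. indicator {-real T<..<real T} t *\<^sub>R G t)" for T
    by (simp add: interval_lebesgue_integral_def set_lebesgue_integral_def)
  have "(\<lambda>T. CLBINT t. indicator {-real T<..<real T} t *\<^sub>R G t) \<longlonglongrightarrow> (CLBINT t. G t)"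
  proof (rule integral_dominated_convergence[where w = "\<lambda>t. (b - a) * norm (char M t)"])
    show "integrable lborel (\<lambda>t. (b - a) * norm (char M t))"
      using int by simp
    show "AE t in lborel. norm (indicator {-real T<..<real T} t *\<^sub>R G t) \<le> (b - a) * norm (char M t)" for T
      using bound ab by (auto split: split_indicator)
    show "AE t in lborel. (\<lambda>T. indicator {-real T<..<real T} t *\<^sub>R G t) \<longlonglongrightarrow> G t"
    proof (rule AE_I2, rule tendsto_eventually)
      fix t :: real
      obtain n where n: "\<bar>t\<bar> < real n" using reals_Archimedean2 by blast
      show "\<forall>\<^sub>F T in sequentially. indicator {-real T<..<real T} t *\<^sub>R G t = G t"
        using n by (auto simp: eventually_sequentially intro!: exI[of _ n] split: split_indicator)
    qed
  qed auto
  then have "(\<lambda>T. 1 / (2 * pi) * (CLBINT t=-real T..real T. G t)) \<longlonglongrightarrow> 1 / (2 * pi) * (CLBINT t. G t)"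
    unfolding eq by (intro tendsto_intros)
  moreover have "(\<lambda>T. 1 / (2 * pi) * (CLBINT t=-real T..real T. G t)) \<longlonglongrightarrow> complex_of_real (measure M {a<..b})"
    using Levy_Inversion[OF ab atoms, folded G_def] by simp
  ultimately have "1 / (2 * pi) * (CLBINT t. G t) = complex_of_real (measure M {a<..b})"
    by (rule LIMSEQ_unique)
  then have "complex_of_real (measure M {a<..b}) = 1 / (2 * pi) * (CLBINT t. G t)"
    by simp
  also have "(CLBINT t. G t) = (CLBINT y. indicator {a..b} y *\<^sub>R fourier_integral (char M) y)"
    unfolding G_def by (rule inverse_fourier_density_Icc[OF int ab])
  finally have "measure M {a<..b} = Re (CLBINT y. indicator {a..b} y *\<^sub>R fourier_integral (char M) y) / (2 * pi)"
    by (simp add: complex_eq_iff)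
  also have "Re (CLBINT y. indicator {a..b} y *\<^sub>R fourier_integral (char M) y)
      = (LBINT y. Re (indicator {a..b} y *\<^sub>R fourier_integral (char M) y))"
    by (rule integral_Re[symmetric])
       (rule integrable_indicator_Icc_continuous[OF continuous_fourier_integral[OF int]])
  finally show ?thesis
    by (simp add: inverse_fourier_density_def)
qed

text \<open>A law has countably many atoms, so every \<open>x\<close> lies in arbitrarily short intervals whose
  endpoints are not atoms. Such an interval has mass at most its length times a bound of the
  density.\<close>

lemma no_atoms_of_integrable_char:
  assumes int: "integrable lborel (char M)"
  shows "measure M {x} = 0"
proof (rule ccontr)
  assume "measure M {x} \<noteq> 0"
  then have pos: "measure M {x} > 0" by (simp add: measure_nonneg order_less_le)
  obtain C where C: "\<And>y. \<bar>inverse_fourier_density (char M) y\<bar> \<le> C" "C > 0"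
    using bounded_inverse_fourier_density[OF int] by (auto simp: bounded_pos)
  \<comment> \<open>An interval of length below \<open>2 * e\<close> has mass below \<open>2 / 3\<close> of the mass of the supposed atom.\<close>
  define e where "e = measure M {x} / (3 * C)"
  have e: "e > 0" using pos C by (simp add: e_def)
  have cnt: "countable {x. measure M {x} > 0}" by (rule countable_atoms)
  obtain u where u: "x - e < u" "u < x" "measure M {u} = 0"
    using open_minus_countable[OF cnt, of "{x - e<..<x}"] e by (auto simp: zero_less_measure_iff)
  obtain v where v: "x < v" "v < x + e" "measure M {v} = 0"
    using open_minus_countable[OF cnt, of "{x<..<x + e}"] e by (auto simp: zero_less_measure_iff)
  have "measure M {x} \<le> measure M {u<..v}"
    using u v by (intro finite_measure_mono) auto
  also have "\<dots> = (LBINT y. indicator {u..v} y * inverse_fourier_density (char M) y)"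
    using measure_Ioc_no_atoms[OF int] u v by simp
  also have "\<dots> \<le> (LBINT y. indicator {u..v} y * C)"
    using integrable_indicator_Icc_continuous[OF continuous_inverse_fourier_density[OF int], of u v]
      C(1)[THEN abs_le_D1] integrable_indicator_Icc[of u v]
    by (intro integral_mono) (auto split: split_indicator)
  also have "\<dots> = (v - u) * C" using u v by simp
  also have "\<dots> < (2 * e) * C" using u v C by (intro mult_strict_right_mono) auto
  also have "\<dots> \<le> measure M {x}" using C pos by (simp add: e_def)
  finally show False by simp
qed

lemma measure_Ioc:
  assumes "integrable lborel (char M)" and "a \<le> b"
  shows "measure M {a<..b} = (LBINT y. indicator {a..b} y * inverse_fourier_density (char M) y)"
  by (intro measure_Ioc_no_atoms no_atoms_of_integrable_char assms)

lemma inverse_fourier_density_nonneg: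
  assumes int: "integrable lborel (char M)"
  shows "inverse_fourier_density (char M) x \<ge> 0"
proof (rule ccontr)
  define f where "f = inverse_fourier_density (char M)"
  assume "\<not> ?thesis"
  then have neg: "f x < 0" unfolding f_def by (rule not_le_imp_less)
  have cont: "continuous_on UNIV f"
    unfolding f_def by (rule continuous_inverse_fourier_density[OF int])
  then have "isCont f x" by (simp add: continuous_on_eq_continuous_at)
  then have "\<forall>\<^sub>F y in nhds x. f y < f x / 2"
    using neg by (intro order_tendstoD(2)[of f "f x"]) (auto simp: isCont_def tendsto_at_iff_tendsto_nhds)
  then obtain d where d: "d > 0" "\<And>y. dist y x < d \<Longrightarrow> f y < f x / 2"
    by (auto simp: eventually_nhds_metric)
  have "0 \<le> measure M {x<..x + d/2}" by simp
  also have "\<dots> = (LBINT y. indicator {x..x + d/2} y * f y)"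
    using measure_Ioc[OF int] d by (simp add: f_def)
  also have "\<dots> \<le> (LBINT y. indicator {x..x + d/2} y * (f x / 2))"
    using integrable_indicator_Icc_continuous[OF cont, of x "x + d/2"] d integrable_indicator_Icc[of x "x + d/2"]
    by (intro integral_mono) (auto split: split_indicator simp: dist_real_def less_imp_le)
  also have "\<dots> = d/2 * (f x / 2)" using d by simp
  also have "\<dots> < 0" using d neg by (simp add: mult_pos_neg)
  finally show False by simp
qed

text \<open>Both measures agree on the half-open intervals, which generate the Borel sets and are
  stable under intersection.\<close>

theorem density_inverse_fourier:
  assumes int: "integrable lborel (char M)"
  shows "M = density lborel (\<lambda>x. ennreal (inverse_fourier_density (char M) x))"
proof (rule measure_eqI_generator_eq[where \<Omega> = UNIV and E = "range (\<lambda>(a, b). {a<..b::real})"])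
  define f where "f = inverse_fourier_density (char M)"
  have cont: "continuous_on UNIV f"
    unfolding f_def by (rule continuous_inverse_fourier_density[OF int])
  have [measurable]: "f \<in> borel_measurable borel"
    using cont by (rule borel_measurable_continuous_onI)
  have f0: "f y \<ge> 0" for y
    unfolding f_def by (rule inverse_fourier_density_nonneg[OF int])
  fix X assume "X \<in> range (\<lambda>(a, b). {a<..b::real})"
  then obtain a b where X: "X = {a<..b}" by auto
  have "emeasure M {a<..b} = emeasure (density lborel (\<lambda>x. ennreal (f x))) {a<..b}"
  proof (cases "a \<le> b")
    case True
    have "emeasure M {a<..b} = ennreal (LBINT y. indicator {a..b} y * f y)"
      using measure_Ioc[OF int True] by (simp add: emeasure_eq_measure f_def)
    also have "\<dots> = (\<integral>\<^sup>+y. ennreal (indicator {a..b} y * f y) \<partial>lborel)"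
      using integrable_indicator_Icc_continuous[OF cont, of a b] f0
      by (intro nn_integral_eq_integral[symmetric]) auto
    also have "\<dots> = (\<integral>\<^sup>+y. ennreal (f y) * indicator {a<..b} y \<partial>lborel)"
    proof (rule nn_integral_cong_AE)
      have "AE y in lborel. y \<noteq> a" by (rule AE_lborel_singleton)
      then show "AE y in lborel. ennreal (indicator {a..b} y * f y) = ennreal (f y) * indicator {a<..b} y"
        by eventually_elim (auto split: split_indicator)
    qed
    also have "\<dots> = emeasure (density lborel (\<lambda>x. ennreal (f x))) {a<..b}"
      by (subst emeasure_density) auto
    finally show ?thesis .
  qed simp
  then show "emeasure M X = emeasure (density lborel (\<lambda>x. ennreal (inverse_fourier_density (char M) x))) X"
    by (simp add: X f_def)
next
  show "(\<Union>i. {- real (i::nat)<..real i}) = UNIV"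
    by (rule UN_Ioc_eq_UNIV)
qed (auto simp: borel_sigma_sets_Ioc Int_stable_def)

end

text \<open>Two such densities agree almost everywhere, and the open set where they differ is then a
  null set, hence empty. This identifies \<^const>\<open>cont_density\<close>, and it turns an equality of
  tilted measures into a pointwise equality of tilted densities.\<close>

lemma continuous_density_unique:
  fixes f g :: "real \<Rightarrow> real"
  assumes f: "continuous_on UNIV f" "\<And>x. f x \<ge> 0"
    and g: "continuous_on UNIV g" "\<And>x. g x \<ge> 0"
    and eq: "density lborel (\<lambda>x. ennreal (f x)) = density lborel (\<lambda>x. ennreal (g x))"
  shows "f = g"
proof -
  have [measurable]: "f \<in> borel_measurable borel" "g \<in> borel_measurable borel"
    using f g borel_measurable_continuous_onI by auto
  have "AE x in lborel. ennreal (f x) = ennreal (g x)"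
    using eq by (intro sigma_finite_measure.density_unique[OF sigma_finite_lborel]) auto
  then have "AE x in lborel. x \<notin> {x. f x \<noteq> g x}"
    by eventually_elim (use f g in auto)
  moreover have o: "open {x. f x \<noteq> g x}"
    using f g by (intro open_Collect_neq)
  ultimately have "{x. f x \<noteq> g x} \<in> null_sets lborel"
    using AE_iff_null_sets[of "{x. f x \<noteq> g x}" lborel] by simp
  then have "negligible {x. f x \<noteq> g x}"
    by (simp add: negligible_iff_null_sets null_sets_completionI)
  then show ?thesis using open_not_negligible[OF o] by auto
qed

section \<open>A Plancherel inequality\<close>

lemma integrable_lborel_prod_mult:
  fixes f g :: "real \<Rightarrow> real"
  assumes f: "integrable lborel f" and g: "integrable lborel g"
  shows "integrable (lborel \<Otimes>\<^sub>M lborel) (\<lambda>(x, y). f x * g y)"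
proof (rule lborel_pair.Fubini_integrable)
  have [measurable]: "f \<in> borel_measurable borel" "g \<in> borel_measurable borel"
    using f g borel_measurable_integrable by auto
  show "(\<lambda>(x, y). f x * g y) \<in> borel_measurable (lborel \<Otimes>\<^sub>M lborel)"
    by measurable
  show "integrable lborel (\<lambda>x. LBINT y. norm (case (x, y) of (x, y) \<Rightarrow> f x * g y))"
    using f by (simp add: abs_mult)
  show "AE x in lborel. integrable lborel (\<lambda>y. case (x, y) of (x, y) \<Rightarrow> f x * g y)"
    using g by simp
qed

lemma gaussian_weight_eq:
  fixes \<sigma> :: real
  assumes "\<sigma> > 0"
  shows "exp (- (t / \<sigma>)\<^sup>2 / 2) = sqrt (2 * pi) * \<sigma> * normal_density 0 \<sigma> t"
  using assms by (simp add: normal_density_def real_sqrt_mult power_divide)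

lemma integrable_gaussian_weight:
  fixes \<sigma> :: real
  assumes "\<sigma> > 0"
  shows "integrable lborel (\<lambda>t. exp (- (t / \<sigma>)\<^sup>2 / 2))"
  unfolding gaussian_weight_eq[OF assms] using assms by simp

text \<open>The Gaussian weight of width \<open>\<sigma>\<close> is an approximate unit in the frequency variable; its
  Fourier transform is \<open>2 * pi\<close> times a probability density that concentrates at 0.\<close>

lemma fourier_gaussian_weight:
  fixes \<sigma> :: real
  assumes s: "\<sigma> > 0"
  shows "(CLBINT t. exp (- (t / \<sigma>)\<^sup>2 / 2) *\<^sub>R iexp (t * v)) = of_real (2 * pi * normal_density 0 (1 / \<sigma>) v)"
proof -
  define h where "h t = exp (- (t / \<sigma>)\<^sup>2 / 2) *\<^sub>R iexp (t * v)" for t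
  have "(CLBINT t. h t) = \<sigma> *\<^sub>R (CLBINT x. h (0 + \<sigma> * x))"
    using lborel_integral_real_affine[of \<sigma> h 0] s by simp
  also have "(\<lambda>x. h (0 + \<sigma> * x)) = (\<lambda>x. sqrt (2 * pi) *\<^sub>R (std_normal_density x *\<^sub>R iexp (\<sigma> * v * x)))"
    using s by (simp add: h_def std_normal_density_def fun_eq_iff scaleR_conv_of_real mult_ac)
  also have "(CLBINT x. sqrt (2 * pi) *\<^sub>R (std_normal_density x *\<^sub>R iexp (\<sigma> * v * x)))
      = sqrt (2 * pi) *\<^sub>R (CLBINT x. std_normal_density x *\<^sub>R iexp (\<sigma> * v * x))"
    by (rule integral_scaleR_right)
  also have "(CLBINT x. std_normal_density x *\<^sub>R iexp (\<sigma> * v * x)) = char std_normal_distribution (\<sigma> * v)"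
    unfolding char_def by (subst integral_density) auto
  also have "\<dots> = of_real (exp (- (\<sigma> * v)\<^sup>2 / 2))"
    by (simp add: char_std_normal_distribution)
  also have "\<sigma> *\<^sub>R (sqrt (2 * pi) *\<^sub>R of_real (exp (- (\<sigma> * v)\<^sup>2 / 2)))
      = complex_of_real (2 * pi * normal_density 0 (1 / \<sigma>) v)"
  proof -
    have "normal_density 0 (1 / \<sigma>) v = \<sigma> / sqrt (2 * pi) * exp (- (\<sigma> * v)\<^sup>2 / 2)"
      using s by (simp add: normal_density_def real_sqrt_divide power_mult_distrib power_divide mult_ac)
    then have "2 * pi * normal_density 0 (1 / \<sigma>) v = 2 * pi / sqrt (2 * pi) * (\<sigma> * exp (- (\<sigma> * v)\<^sup>2 / 2))"
      by simp
    also have "2 * pi / sqrt (2 * pi) = sqrt (2 * pi)"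
      by (rule real_div_sqrt) simp
    finally have "2 * pi * normal_density 0 (1 / \<sigma>) v = \<sigma> * (sqrt (2 * pi) * exp (- (\<sigma> * v)\<^sup>2 / 2))"
      by simp
    then show ?thesis by (simp add: scaleR_conv_of_real)
  qed
  finally show ?thesis by (simp add: h_def)
qed

context
  fixes q :: "real \<Rightarrow> real"
  assumes q0: "\<And>x. q x \<ge> 0" and q: "integrable lborel q" and q2: "integrable lborel (\<lambda>x. (q x)\<^sup>2)"
begin

lemma q_measurable: "q \<in> borel_measurable borel"
  using borel_measurable_integrable[OF q] by simp

text \<open>By \<open>q x * q y \<le> ((q x)\<^sup>2 + (q y)\<^sup>2) / 2\<close> and symmetry of the mollifier, whose total
  mass is 1 in either variable.\<close>

lemma mollified_self_convolution_le:
  assumes "\<sigma> > 0"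
  shows "(LBINT y. q y * (LBINT x. q x * normal_density 0 \<sigma> (x - y))) \<le> (LBINT x. (q x)\<^sup>2)"
proof -
  note [measurable] = q_measurable
  define N where "N = normal_density 0 \<sigma>"
  have [measurable]: "N \<in> borel_measurable borel" by (simp add: N_def)
  have N0: "N x \<ge> 0" for x by (simp add: N_def)
  have N1: "(\<integral>\<^sup>+x. ennreal (N (x - y)) \<partial>lborel) = 1" for y
  proof -
    have "(\<integral>\<^sup>+x. ennreal (N (x - y)) \<partial>lborel) = (\<integral>\<^sup>+x. ennreal (normal_density y \<sigma> x) \<partial>lborel)"
      by (simp add: N_def normal_density_def)
    also have "\<dots> = ennreal (LBINT x. normal_density y \<sigma> x)"
      using assms by (intro nn_integral_eq_integral) auto
    finally show ?thesis using assms by simp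
  qed
  have Nsym: "N (x - y) = N (y - x)" for x y
    by (simp add: N_def normal_density_def power2_commute)
  define S where "S = (\<integral>\<^sup>+x. ennreal ((q x)\<^sup>2) \<partial>lborel)"
  have S: "S = ennreal (LBINT x. (q x)\<^sup>2)"
    unfolding S_def by (rule nn_integral_eq_integral[OF q2]) simp
  have A: "ennreal (LBINT x. q x * N (x - y)) \<le> (\<integral>\<^sup>+x. ennreal (q x * N (x - y)) \<partial>lborel)" for y
  proof (cases "integrable lborel (\<lambda>x. q x * N (x - y))")
    case True
    then show ?thesis using q0 N0 by (subst nn_integral_eq_integral) auto
  qed (simp add: not_integrable_integral_eq)
  have "(\<integral>\<^sup>+y. ennreal (q y * (LBINT x. q x * N (x - y))) \<partial>lborel)
      \<le> (\<integral>\<^sup>+y. \<integral>\<^sup>+x. ennreal (q y * (q x * N (x - y))) \<partial>lborel \<partial>lborel)"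
  proof (rule nn_integral_mono)
    fix y
    have "ennreal (q y * (LBINT x. q x * N (x - y))) \<le> ennreal (q y) * (\<integral>\<^sup>+x. ennreal (q x * N (x - y)) \<partial>lborel)"
      using A[of y] q0 by (simp add: ennreal_mult' mult_left_mono)
    also have "\<dots> = (\<integral>\<^sup>+x. ennreal (q y * (q x * N (x - y))) \<partial>lborel)"
      using q0 N0 by (subst nn_integral_cmult[symmetric]) (auto simp: ennreal_mult')
    finally show "ennreal (q y * (LBINT x. q x * N (x - y))) \<le> \<dots>" .
  qed
  also have "\<dots> \<le> (\<integral>\<^sup>+y. \<integral>\<^sup>+x. ennreal ((q x)\<^sup>2 / 2) * ennreal (N (y - x)) + ennreal ((q y)\<^sup>2 / 2) * ennreal (N (x - y)) \<partial>lborel \<partial>lborel)"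
  proof (intro nn_integral_mono)
    fix x y
    have "q y * q x \<le> (q x)\<^sup>2 / 2 + (q y)\<^sup>2 / 2"
      using sum_squares_bound[of "q x" "q y"] by (simp add: field_simps)
    then have "q y * q x * N (x - y) \<le> ((q x)\<^sup>2 / 2 + (q y)\<^sup>2 / 2) * N (x - y)"
      by (rule mult_right_mono[OF _ N0])
    then have "ennreal (q y * (q x * N (x - y))) \<le> ennreal ((q x)\<^sup>2 / 2 * N (y - x) + (q y)\<^sup>2 / 2 * N (x - y))"
      by (intro ennreal_leI) (simp add: Nsym[of x y] algebra_simps)
    then show "ennreal (q y * (q x * N (x - y))) \<le> ennreal ((q x)\<^sup>2 / 2) * ennreal (N (y - x)) + ennreal ((q y)\<^sup>2 / 2) * ennreal (N (x - y))"
      using N0 by (subst (asm) ennreal_plus) (simp_all add: ennreal_mult[symmetric])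
  qed
  also have "\<dots> = (\<integral>\<^sup>+y. (\<integral>\<^sup>+x. ennreal ((q x)\<^sup>2 / 2) * ennreal (N (y - x)) \<partial>lborel)
      + (\<integral>\<^sup>+x. ennreal ((q y)\<^sup>2 / 2) * ennreal (N (x - y)) \<partial>lborel) \<partial>lborel)"
    by (intro nn_integral_cong nn_integral_add) measurable
  also have "\<dots> = (\<integral>\<^sup>+y. \<integral>\<^sup>+x. ennreal ((q x)\<^sup>2 / 2) * ennreal (N (y - x)) \<partial>lborel \<partial>lborel)
      + (\<integral>\<^sup>+y. \<integral>\<^sup>+x. ennreal ((q y)\<^sup>2 / 2) * ennreal (N (x - y)) \<partial>lborel \<partial>lborel)"
    by (intro nn_integral_add) measurable
  also have "(\<integral>\<^sup>+y. \<integral>\<^sup>+x. ennreal ((q y)\<^sup>2 / 2) * ennreal (N (x - y)) \<partial>lborel \<partial>lborel)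
      = (\<integral>\<^sup>+y. ennreal ((q y)\<^sup>2 / 2) \<partial>lborel)"
    by (intro nn_integral_cong) (simp add: nn_integral_cmult N1)
  also have "(\<integral>\<^sup>+y. \<integral>\<^sup>+x. ennreal ((q x)\<^sup>2 / 2) * ennreal (N (y - x)) \<partial>lborel \<partial>lborel)
      = (\<integral>\<^sup>+x. \<integral>\<^sup>+y. ennreal ((q x)\<^sup>2 / 2) * ennreal (N (y - x)) \<partial>lborel \<partial>lborel)"
    by (rule lborel_pair.Fubini') measurable
  also have "\<dots> = (\<integral>\<^sup>+x. ennreal ((q x)\<^sup>2 / 2) \<partial>lborel)"
    by (intro nn_integral_cong) (simp add: nn_integral_cmult N1)
  also have "(\<integral>\<^sup>+x. ennreal ((q x)\<^sup>2 / 2) \<partial>lborel) + (\<integral>\<^sup>+y. ennreal ((q y)\<^sup>2 / 2) \<partial>lborel) = S"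
  proof -
    have "ennreal ((q x)\<^sup>2 / 2) + ennreal ((q x)\<^sup>2 / 2) = ennreal ((q x)\<^sup>2)" for x
      by (subst ennreal_plus[symmetric]) auto
    then show ?thesis
      unfolding S_def by (subst nn_integral_add[symmetric]) auto
  qed
  finally have le: "(\<integral>\<^sup>+y. ennreal (q y * (LBINT x. q x * N (x - y))) \<partial>lborel) \<le> ennreal (LBINT x. (q x)\<^sup>2)"
    by (simp add: S)
  have "(LBINT y. q y * (LBINT x. q x * N (x - y))) = enn2real (\<integral>\<^sup>+y. ennreal (q y * (LBINT x. q x * N (x - y))) \<partial>lborel)"
    using q0 N0 by (intro integral_eq_nn_integral) auto
  also have "\<dots> \<le> (LBINT x. (q x)\<^sup>2)"
    using le by (intro enn2real_leI) auto
  finally show ?thesis by (simp add: N_def)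
qed

text \<open>Writing the square of the transform as a double integral over \<open>x\<close> and \<open>y\<close> and integrating
  over \<open>t\<close> first leaves the transform of the weight at \<open>x - y\<close>. The weight is what makes the
  triple integral absolutely convergent.\<close>

lemma gaussian_weighted_plancherel:
  assumes s: "\<sigma> > 0"
  defines "F \<equiv> \<lambda>t. CLBINT x. iexp (t * x) * q x"
  shows "(LBINT t. exp (- (t / \<sigma>)\<^sup>2 / 2) * (norm (F t))\<^sup>2)
    = 2 * pi * (LBINT y. q y * (LBINT x. q x * normal_density 0 (1 / \<sigma>) (x - y)))"
proof -
  note [measurable] = q_measurable
  define w where "w t = exp (- (t / \<sigma>)\<^sup>2 / 2)" for t
  define N where "N = normal_density 0 (1 / \<sigma>)"
  have w: "integrable lborel w"
    unfolding w_def by (rule integrable_gaussian_weight[OF s])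
  have [measurable]: "w \<in> borel_measurable borel" "N \<in> borel_measurable borel" "F \<in> borel_measurable borel"
    unfolding w_def N_def F_def by measurable
  have w0: "w t \<ge> 0" for t by (simp add: w_def)
  have Fle: "norm (F t) \<le> (LBINT x. q x)" for t
    unfolding F_def by (rule order_trans[OF integral_norm_bound]) (simp add: norm_mult q0)
  have cnjF: "cnj (F t) = (CLBINT y. iexp (-(t * y)) * q y)" for t
  proof -
    have "cnj (F t) = (CLBINT y. cnj (iexp (t * y) * q y))"
      unfolding F_def by (rule Bochner_Integration.integral_cnj[symmetric])
    then show ?thesis by (simp add: exp_cnj)
  qed
  have inner: "(CLBINT t. w t *\<^sub>R (F t * iexp (-(t * y)))) = of_real (2 * pi * (LBINT x. q x * N (x - y)))" for y
  proof -
    have I: "integrable (lborel \<Otimes>\<^sub>M lborel) (\<lambda>(t, x). w t *\<^sub>R (iexp (t * x) * q x * iexp (-(t * y))))"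
      by (rule Bochner_Integration.integrable_bound[OF integrable_lborel_prod_mult[OF w q]])
         (auto simp: norm_mult w0 q0)
    have "(CLBINT t. w t *\<^sub>R (F t * iexp (-(t * y)))) = (CLBINT t. CLBINT x. w t *\<^sub>R (iexp (t * x) * q x * iexp (-(t * y))))"
      unfolding F_def by simp
    also have "\<dots> = (CLBINT x. CLBINT t. w t *\<^sub>R (iexp (t * x) * q x * iexp (-(t * y))))"
      by (rule lborel_pair.Fubini_integral[OF I, symmetric])
    also have "\<dots> = (CLBINT x. of_real (2 * pi * (q x * N (x - y))))"
    proof (rule Bochner_Integration.integral_cong)
      fix x
      have "(CLBINT t. w t *\<^sub>R (iexp (t * x) * q x * iexp (-(t * y)))) = (CLBINT t. (w t *\<^sub>R iexp (t * (x - y))) * of_real (q x))"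
        by (rule Bochner_Integration.integral_cong)
           (auto simp: exp_diff exp_minus algebra_simps divide_inverse scaleR_conv_of_real)
      also have "\<dots> = of_real (2 * pi * N (x - y)) * of_real (q x)"
        unfolding integral_mult_left_zero w_def N_def fourier_gaussian_weight[OF s] ..
      finally show "(CLBINT t. w t *\<^sub>R (iexp (t * x) * q x * iexp (-(t * y)))) = of_real (2 * pi * (q x * N (x - y)))"
        by (simp add: mult_ac)
    qed simp
    also have "\<dots> = of_real (2 * pi * (LBINT x. q x * N (x - y)))"
      unfolding integral_complex_of_real by simp
    finally show ?thesis .
  qed
  have J: "integrable (lborel \<Otimes>\<^sub>M lborel) (\<lambda>(t, y). w t *\<^sub>R (F t * iexp (-(t * y)) * q y))"
  proof (rule Bochner_Integration.integrable_bound)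
    show "integrable (lborel \<Otimes>\<^sub>M lborel) (\<lambda>(t, y). w t * ((LBINT x. q x) * q y))"
      using integrable_lborel_prod_mult[OF w, of "\<lambda>y. (LBINT x. q x) * q y"] q by simp
    have "norm (w t *\<^sub>R (F t * iexp (-(t * y)) * q y)) \<le> norm (w t * ((LBINT x. q x) * q y))" for t y
      using Fle[of t] w0[of t] q0 order_trans[OF norm_ge_zero Fle[of t]]
      by (auto simp: norm_mult intro!: mult_left_mono mult_right_mono)
    then show "AE p in lborel \<Otimes>\<^sub>M lborel. norm (case p of (t, y) \<Rightarrow> w t *\<^sub>R (F t * iexp (-(t * y)) * q y))
        \<le> norm (case p of (t, y) \<Rightarrow> w t * ((LBINT x. q x) * q y))"
      by (auto simp: case_prod_beta)
  qed measurable
  have "of_real (LBINT t. w t * (norm (F t))\<^sup>2) = (CLBINT t. of_real (w t * (norm (F t))\<^sup>2))"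
    by (rule integral_complex_of_real[symmetric])
  also have "\<dots> = (CLBINT t. CLBINT y. w t *\<^sub>R (F t * iexp (-(t * y)) * q y))"
  proof (rule Bochner_Integration.integral_cong)
    fix t
    have "of_real (w t * (norm (F t))\<^sup>2) = w t *\<^sub>R (F t * cnj (F t))"
      by (simp only: scaleR_conv_of_real of_real_mult complex_norm_square)
    also have "\<dots> = (CLBINT y. w t *\<^sub>R (F t * iexp (-(t * y)) * q y))"
      unfolding cnjF by (simp add: mult.assoc)
    finally show "of_real (w t * (norm (F t))\<^sup>2) = (CLBINT y. w t *\<^sub>R (F t * iexp (-(t * y)) * q y))" .
  qed simp
  also have "\<dots> = (CLBINT y. CLBINT t. w t *\<^sub>R (F t * iexp (-(t * y)) * q y))"
    by (rule lborel_pair.Fubini_integral[OF J, symmetric])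
  also have "\<dots> = (CLBINT y. of_real (2 * pi * (q y * (LBINT x. q x * N (x - y)))))"
  proof (rule Bochner_Integration.integral_cong)
    fix y
    have "(CLBINT t. w t *\<^sub>R (F t * iexp (-(t * y)) * q y)) = (CLBINT t. (w t *\<^sub>R (F t * iexp (-(t * y)))) * of_real (q y))"
      by simp
    also have "\<dots> = of_real (2 * pi * (LBINT x. q x * N (x - y))) * of_real (q y)"
      unfolding integral_mult_left_zero inner ..
    finally show "(CLBINT t. w t *\<^sub>R (F t * iexp (-(t * y)) * q y)) = of_real (2 * pi * (q y * (LBINT x. q x * N (x - y))))"
      by (simp add: mult_ac)
  qed simp
  also have "\<dots> = of_real (2 * pi * (LBINT y. q y * (LBINT x. q x * N (x - y))))"
    unfolding integral_complex_of_real by simp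
  finally show ?thesis
    unfolding of_real_eq_iff w_def N_def .
qed

text \<open>Half of Plancherel's theorem, which is all that the tail estimate needs: the weights
  increase to 1 while the weighted integrals stay below the bound.\<close>

theorem plancherel_inequality:
  shows "integrable lborel (\<lambda>t. (norm (CLBINT x. iexp (t * x) * q x))\<^sup>2)"
    and "(LBINT t. (norm (CLBINT x. iexp (t * x) * q x))\<^sup>2) \<le> 2 * pi * (LBINT x. (q x)\<^sup>2)"
proof -
  note [measurable] = q_measurable
  define F where "F t = (CLBINT x. iexp (t * x) * q x)" for t
  define B where "B = 2 * pi * (LBINT x. (q x)\<^sup>2)"
  have [measurable]: "F \<in> borel_measurable borel" unfolding F_def by measurable
  define w where "w n t = exp (- (t / real (Suc n))\<^sup>2 / 2)" for n t
  have [measurable]: "w n \<in> borel_measurable borel" for n unfolding w_def by measurable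
  have wm: "w m t \<le> w n t" if "m \<le> n" for m n t
  proof -
    have "\<bar>t / real (Suc n)\<bar> \<le> \<bar>t / real (Suc m)\<bar>"
      using that by (auto intro!: divide_left_mono)
    then have "(t / real (Suc n))\<^sup>2 \<le> (t / real (Suc m))\<^sup>2"
      unfolding abs_le_square_iff .
    then show ?thesis by (simp add: w_def)
  qed
  have Fle: "norm (F t) \<le> (LBINT x. q x)" for t
    unfolding F_def by (rule order_trans[OF integral_norm_bound]) (simp add: norm_mult q0)
  have n_le: "(\<integral>\<^sup>+t. ennreal (w n t * (norm (F t))\<^sup>2) \<partial>lborel) \<le> ennreal B" for n
  proof -
    have "integrable lborel (\<lambda>t. w n t * (LBINT x. q x)\<^sup>2)"
      using integrable_gaussian_weight[of "real (Suc n)"] by (simp add: w_def)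
    then have "integrable lborel (\<lambda>t. w n t * (norm (F t))\<^sup>2)"
    proof (rule Bochner_Integration.integrable_bound)
      show "AE t in lborel. norm (w n t * (norm (F t))\<^sup>2) \<le> norm (w n t * (LBINT x. q x)\<^sup>2)"
        using Fle by (auto simp: w_def intro!: mult_left_mono power_mono)
    qed measurable
    then have "(\<integral>\<^sup>+t. ennreal (w n t * (norm (F t))\<^sup>2) \<partial>lborel) = ennreal (LBINT t. w n t * (norm (F t))\<^sup>2)"
      by (rule nn_integral_eq_integral) (simp add: w_def)
    also have "(LBINT t. w n t * (norm (F t))\<^sup>2) \<le> B"
      unfolding w_def F_def B_def
      by (subst gaussian_weighted_plancherel) (auto intro!: mollified_self_convolution_le)
    finally show ?thesis by (simp add: ennreal_leI)
  qed
  have "(\<lambda>n. \<integral>\<^sup>+t. ennreal (w n t * (norm (F t))\<^sup>2) \<partial>lborel) \<longlonglongrightarrow> (\<integral>\<^sup>+t. ennreal ((norm (F t))\<^sup>2) \<partial>lborel)"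
  proof (rule nn_integral_LIMSEQ)
    show "incseq (\<lambda>n t. ennreal (w n t * (norm (F t))\<^sup>2))"
      by (auto simp: incseq_def le_fun_def intro!: ennreal_leI mult_right_mono wm)
    show "(\<lambda>n. ennreal (w n t * (norm (F t))\<^sup>2)) \<longlonglongrightarrow> ennreal ((norm (F t))\<^sup>2)" for t
    proof -
      have "(\<lambda>n. t / real (Suc n)) \<longlonglongrightarrow> 0"
        using LIMSEQ_Suc[OF lim_const_over_n[of t]] by simp
      then have "(\<lambda>n. w n t * (norm (F t))\<^sup>2) \<longlonglongrightarrow> exp (- 0\<^sup>2 / 2) * (norm (F t))\<^sup>2"
        unfolding w_def by (intro tendsto_intros) auto
      then show ?thesis by (intro tendsto_ennrealI) simp
    qed
  qed measurable
  then have nn: "(\<integral>\<^sup>+t. ennreal ((norm (F t))\<^sup>2) \<partial>lborel) \<le> ennreal B"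
    by (rule LIMSEQ_le_const2) (intro exI allI impI n_le)
  show int: "integrable lborel (\<lambda>t. (norm (CLBINT x. iexp (t * x) * q x))\<^sup>2)"
    unfolding F_def[symmetric] using nn
    by (intro integrableI_bounded) (auto simp: le_less_trans)
  have "ennreal (LBINT t. (norm (F t))\<^sup>2) \<le> ennreal B"
    using nn int by (subst (asm) nn_integral_eq_integral) (auto simp: F_def)
  moreover have "B \<ge> 0" by (simp add: B_def)
  ultimately show "(LBINT t. (norm (CLBINT x. iexp (t * x) * q x))\<^sup>2) \<le> 2 * pi * (LBINT x. (q x)\<^sup>2)"
    by (simp add: F_def B_def)
qed

end

section \<open>Characteristic functions away from the origin\<close>

context real_distribution
begin

text \<open>After rotating the phase \<open>\<theta>\<close> of \<open>char M t\<close> away, its modulus is the expectation of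
  \<open>cos (t * x - \<theta>)\<close>. The identity \<open>cos (2 * u) = 2 * (cos u)\<^sup>2 - 1\<close> and the nonnegativity of
  the variance of that cosine give the estimate at \<open>2 * t\<close>.\<close>

lemma norm_char_double_angle: "2 * (norm (char M t))\<^sup>2 - 1 \<le> norm (char M (2 * t))"
proof -
  obtain \<theta> where \<theta>: "char M t = of_real (norm (char M t)) * iexp \<theta>"
    by (cases "char M t = 0") (use Arg_eq[of "char M t"] in auto)
  define c where "c x = cos (t * x - \<theta>)" for x
  have [measurable]: "c \<in> borel_measurable borel" unfolding c_def by measurable
  have bnd: "\<bar>c x\<bar> \<le> 1" for x by (simp add: c_def)
  have ic: "integrable M c" by (rule integrable_const_bound[where B = 1]) (use bnd in auto)
  have ic2: "integrable M (\<lambda>x. (c x)\<^sup>2)"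
    by (rule integrable_const_bound[where B = 1]) (use bnd in \<open>auto simp: abs_square_le_1\<close>)
  have rot: "Re (iexp (-\<phi>) * char M s) = expectation (\<lambda>x. cos (s * x - \<phi>))" for s \<phi>
  proof -
    have i: "complex_integrable M (\<lambda>x. iexp (-\<phi>) * iexp (s * x))"
      using integrable_iexp[of "\<lambda>x. complex_of_real (s * x)"] by simp
    have "iexp (-\<phi>) * char M s = (CLINT x|M. iexp (-\<phi>) * iexp (s * x))"
      unfolding char_def by simp
    also have "Re \<dots> = expectation (\<lambda>x. Re (iexp (-\<phi>) * iexp (s * x)))"
      by (rule integral_Re[OF i, symmetric])
    also have "(\<lambda>x. Re (iexp (-\<phi>) * iexp (s * x))) = (\<lambda>x. cos (s * x - \<phi>))"
      by (simp add: fun_eq_iff Re_exp Im_exp cos_diff)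
    finally show ?thesis .
  qed
  have "iexp (-\<theta>) * iexp \<theta> = 1" by (simp flip: exp_add)
  then have "iexp (-\<theta>) * char M t = of_real (norm (char M t))"
    using \<theta> by (metis mult.left_commute mult.right_neutral)
  then have "norm (char M t) = Re (iexp (-\<theta>) * char M t)" by simp
  also have "\<dots> = expectation c" unfolding rot c_def ..
  finally have mean: "norm (char M t) = expectation c" .
  have "0 \<le> expectation (\<lambda>x. (c x - expectation c)\<^sup>2)" by simp
  also have "\<dots> = expectation (\<lambda>x. (c x)\<^sup>2) - (expectation c)\<^sup>2"
    by (rule variance_eq[OF ic ic2])
  finally have "2 * (norm (char M t))\<^sup>2 - 1 \<le> 2 * expectation (\<lambda>x. (c x)\<^sup>2) - 1"
    by (simp add: mean)
  also have "\<dots> = expectation (\<lambda>x. 2 * (c x)\<^sup>2 - 1)"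
    using ic2 by (simp add: prob_space[unfolded space_eq_univ])
  also have "(\<lambda>x. 2 * (c x)\<^sup>2 - 1) = (\<lambda>x. cos ((2 * t) * x - 2 * \<theta>))"
    unfolding c_def cos_double_cos[symmetric] by (simp add: algebra_simps)
  also have "expectation \<dots> = Re (iexp (-(2 * \<theta>)) * char M (2 * t))" by (rule rot[symmetric])
  also have "\<dots> \<le> norm (iexp (-(2 * \<theta>)) * char M (2 * t))" by (rule complex_Re_le_cmod)
  also have "\<dots> = norm (char M (2 * t))" by (simp add: norm_mult norm_exp_eq_Re)
  finally show ?thesis .
qed

text \<open>If the modulus were close to 1 at \<open>t\<close>, it would stay close to 1 along \<open>t\<close>, \<open>2 * t\<close>,
  \<open>4 * t\<close> and so on, with a loss of at most a factor 4 in each step. This propagates decay at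
  infinity back to compact sets of frequencies, with an explicit constant.\<close>

lemma norm_char_power2_mult: "1 - norm (char M (2 ^ k * t)) \<le> 4 ^ k * (1 - norm (char M t))"
proof (induction k)
  case (Suc k)
  define u where "u = norm (char M (2 ^ k * t))"
  have u: "0 \<le> u" "u \<le> 1" by (auto simp: u_def cmod_char_le_1)
  have "1 - norm (char M (2 ^ Suc k * t)) \<le> 2 * (1 - u\<^sup>2)"
    using norm_char_double_angle[of "2 ^ k * t"] by (simp add: u_def mult.assoc)
  also have "\<dots> = 2 * (1 + u) * (1 - u)" by (simp add: power2_eq_square algebra_simps)
  also have "\<dots> \<le> 4 * (1 - u)" using u by (intro mult_right_mono) auto
  also have "\<dots> \<le> 4 * (4 ^ k * (1 - norm (char M t)))" using Suc.IH by (simp add: u_def)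
  finally show ?case by simp
qed simp

lemma char_lipschitz:
  assumes "integrable M (\<lambda>x. x)"
  shows "norm (char M t - char M s) \<le> expectation (\<lambda>x. \<bar>x\<bar>) * \<bar>t - s\<bar>"
proof -
  have i: "complex_integrable M (\<lambda>x. iexp (r * x))" for r
    using integrable_iexp[of "\<lambda>x. complex_of_real (r * x)"] by simp
  have "char M t - char M s = (CLINT x|M. iexp (t * x) - iexp (s * x))"
    unfolding char_def by (rule Bochner_Integration.integral_diff[OF i i, symmetric])
  also have "norm \<dots> \<le> expectation (\<lambda>x. norm (iexp (t * x) - iexp (s * x)))"
    by (rule integral_norm_bound)
  also have "\<dots> \<le> expectation (\<lambda>x. \<bar>t - s\<bar> * \<bar>x\<bar>)"
  proof (rule integral_mono)
    show "integrable M (\<lambda>x. norm (iexp (t * x) - iexp (s * x)))"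
      by (intro integrable_norm Bochner_Integration.integrable_diff i)
    show "integrable M (\<lambda>x. \<bar>t - s\<bar> * \<bar>x\<bar>)" using assms by simp
    fix x
    have "iexp (t * x) - iexp (s * x) = iexp (s * x) * (iexp ((t - s) * x) - 1)"
      by (simp add: algebra_simps exp_diff)
    also have "norm \<dots> = norm (iexp ((t - s) * x) - 1)" by (simp add: norm_mult)
    also have "\<dots> \<le> \<bar>t - s\<bar> * \<bar>x\<bar>"
      using iexp_approx1[of "(t - s) * x" 0] by (simp add: abs_mult)
    finally show "norm (iexp (t * x) - iexp (s * x)) \<le> \<bar>t - s\<bar> * \<bar>x\<bar>" .
  qed
  finally show ?thesis by (simp add: mult.commute)
qed

text \<open>A value above \<open>1 / 2\<close> at \<open>t\<close> forces values above \<open>1 / 4\<close> on an interval of fixed length,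
  by the Lipschitz bound; far out this contradicts the vanishing tails of a convergent
  integral.\<close>

lemma char_eventually_le_half:
  assumes X: "integrable M (\<lambda>x. x)" and int: "integrable lborel (\<lambda>t. norm (char M t) ^ m)"
  shows "\<exists>T>0. \<forall>t. T \<le> \<bar>t\<bar> \<longrightarrow> norm (char M t) \<le> 1 / 2"
proof -
  \<comment> \<open>Adding 1 makes the Lipschitz constant positive, so that it can be divided by.\<close>
  define K where "K = expectation (\<lambda>x. \<bar>x\<bar>) + 1"
  have K: "K > 0" unfolding K_def by (intro add_nonneg_pos Bochner_Integration.integral_nonneg) auto
  have lip: "norm (char M t - char M s) \<le> K * \<bar>t - s\<bar>" for t s
    by (rule order_trans[OF char_lipschitz[OF X]]) (auto simp: K_def intro!: mult_right_mono)
  \<comment> \<open>Over a distance \<open>h\<close> the modulus changes by at most \<open>1 / 4\<close>.\<close>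
  define h where "h = 1 / (4 * K)"
  have h: "h > 0" using K by (simp add: h_def)
  have "(\<lambda>n. LBINT t. indicator {t. real n \<le> \<bar>t\<bar>} t * norm (char M t) ^ m) \<longlonglongrightarrow> (LBINT t::real. (0 :: real))"
  proof (rule integral_dominated_convergence[where w = "\<lambda>t. norm (char M t) ^ m"])
    show "AE t in lborel. (\<lambda>n. indicator {t. real n \<le> \<bar>t\<bar>} t * norm (char M t) ^ m) \<longlonglongrightarrow> 0"
    proof (rule AE_I2, rule tendsto_eventually)
      fix t :: real
      obtain N where N: "\<bar>t\<bar> < real N" using reals_Archimedean2 by blast
      then have "\<not> real n \<le> \<bar>t\<bar>" if "N \<le> n" for n
        using that by linarith
      then show "\<forall>\<^sub>F n in sequentially. indicator {t. real n \<le> \<bar>t\<bar>} t * norm (char M t) ^ m = 0"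
        by (auto simp: eventually_sequentially intro!: exI[of _ N])
    qed
  qed (use int in \<open>auto split: split_indicator\<close>)
  then have "\<forall>\<^sub>F n in sequentially. (LBINT t. indicator {t. real n \<le> \<bar>t\<bar>} t * norm (char M t) ^ m) < h * (1/4) ^ m"
    using h by (intro order_tendstoD(2)) auto
  then obtain n where n: "(LBINT t. indicator {t. real n \<le> \<bar>t\<bar>} t * norm (char M t) ^ m) < h * (1/4) ^ m"
    by (auto simp: eventually_sequentially)
  have "norm (char M t) \<le> 1 / 2" if t: "real n + h + 1 \<le> \<bar>t\<bar>" for t
  proof (rule ccontr)
    assume *: "\<not> norm (char M t) \<le> 1 / 2"
    have low: "norm (char M s) \<ge> 1 / 4" if "s \<in> {t..t + h}" for s
    proof -
      have "norm (char M t) \<le> norm (char M s) + norm (char M t - char M s)"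
        by (rule norm_triangle_sub)
      also have "norm (char M t - char M s) \<le> K * h"
        using that K by (intro order_trans[OF lip] mult_left_mono) auto
      also have "K * h = 1 / 4" using K by (simp add: h_def)
      finally show ?thesis using * by simp
    qed
    have "h * (1/4) ^ m = (LBINT s. indicator {t..t + h} s * (1/4) ^ m)"
      using h by simp
    also have "\<dots> \<le> (LBINT t. indicator {t. real n \<le> \<bar>t\<bar>} t * norm (char M t) ^ m)"
    proof (rule integral_mono)
      show "integrable lborel (\<lambda>s. indicator {t..t + h} s * (1/4) ^ m :: real)"
        using h by (intro integrable_mult_left integrable_real_indicator) auto
      show "integrable lborel (\<lambda>t. indicator {t. real n \<le> \<bar>t\<bar>} t * norm (char M t) ^ m)"
        by (rule Bochner_Integration.integrable_bound[OF int]) (auto split: split_indicator)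
      fix s
      show "indicator {t..t + h} s * (1/4) ^ m \<le> indicator {t. real n \<le> \<bar>t\<bar>} s * norm (char M s) ^ m"
      proof (cases "s \<in> {t..t + h}")
        case True
        then have "real n \<le> \<bar>s\<bar>" using t h by auto
        then show ?thesis using True low[OF True] by (simp add: power_mono)
      qed simp
    qed
    finally show False using n by simp
  qed
  then show ?thesis using h by (intro exI[of _ "real n + h + 1"]) auto
qed

text \<open>Cramer's condition in uniform form. The exponent \<open>k\<close> is such that \<open>2 ^ k * t\<close> is in the range
  where the modulus is at most \<open>1 / 2\<close>, for every \<open>t\<close> outside \<open>(-\<delta>, \<delta>)\<close>.\<close>

theorem char_away_from_zero:
  assumes X: "integrable M (\<lambda>x. x)" and int: "integrable lborel (\<lambda>t. norm (char M t) ^ m)"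
    and \<delta>: "\<delta> > 0"
  shows "\<exists>\<rho><1. \<rho> > 0 \<and> (\<forall>t. \<delta> \<le> \<bar>t\<bar> \<longrightarrow> norm (char M t) \<le> \<rho>)"
proof -
  obtain T where T: "\<And>t. T \<le> \<bar>t\<bar> \<Longrightarrow> norm (char M t) \<le> 1 / 2"
    using char_eventually_le_half[OF X int] by blast
  obtain k where k: "T / \<delta> < 2 ^ k"
    using real_arch_pow[of 2 "T / \<delta>"] by auto
  have "norm (char M t) \<le> 1 - (1/4) ^ k / 2" if t: "\<delta> \<le> \<bar>t\<bar>" for t
  proof -
    have "T < 2 ^ k * \<delta>" using k \<delta> by (simp add: field_simps)
    also have "\<dots> \<le> \<bar>2 ^ k * t\<bar>" using t by (simp add: abs_mult)
    finally have "1 / 2 \<le> 1 - norm (char M (2 ^ k * t))" using T[of "2 ^ k * t"] by simp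
    also have "\<dots> \<le> 4 ^ k * (1 - norm (char M t))" by (rule norm_char_power2_mult)
    finally show ?thesis by (simp add: field_simps)
  qed
  moreover have "(1/4 :: real) ^ k \<le> 1" by (simp add: power_le_one)
  moreover have "(1/4 :: real) ^ k > 0" by simp
  ultimately show ?thesis
    by (intro exI[of _ "1 - (1/4) ^ k / 2"]) (auto simp del: power_one_over)
qed

end

section \<open>Exponential moments\<close>

lemma power_le_fact_exp:
  fixes x :: real
  assumes "x \<ge> 0"
  shows "x ^ k \<le> fact k * exp x"
proof -
  have "(\<Sum>n\<in>{k}. inverse (fact n) * x ^ n) \<le> (\<Sum>n. inverse (fact n) * x ^ n)"
    using assms summable_exp[of x] by (intro sum_le_suminf) auto
  then show ?thesis
    by (simp add: exp_def scaleR_conv_of_real field_simps)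
qed

text \<open>The second moment bound below needs a constant of at most 8 / 3. The constant comes from
  \<open>exp y \<ge> exp 1 * y \<ge> 5 / 2 * y\<close> at \<open>y = 7 * t / 24\<close>, cubed.\<close>

lemma cube_exp_le:
  fixes t :: real
  assumes "t \<ge> 0"
  shows "t ^ 3 * exp (t / 8) \<le> 13 / 5 * exp t"
proof -
  define y where "y = 7 * t / 24"
  have e: "exp (1 :: real) \<ge> 5 / 2"
    using exp_lower_Taylor_quadratic[of "1 :: real"] by simp
  have "5 / 2 * y \<le> exp 1 * exp (y - 1)"
    using assms e exp_ge_add_one_self[of "y - 1"] by (intro mult_mono) (auto simp: y_def)
  then have "5 / 2 * y \<le> exp y" by (simp flip: exp_add)
  then have "(5 / 2 * y) ^ 3 \<le> exp y ^ 3"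
    using assms by (intro power_mono) (auto simp: y_def)
  also have "exp y ^ 3 = exp (7 * t / 8)"
    unfolding exp_of_nat_mult[symmetric] by (simp add: y_def)
  finally have "t ^ 3 \<le> 110592 / 42875 * exp (7 * t / 8)"
    by (simp add: y_def power_mult_distrib power_divide)
  also have "\<dots> \<le> 13 / 5 * exp (7 * t / 8)" by simp
  finally have "t ^ 3 \<le> 13 / 5 * exp (7 * t / 8)" .
  then have "t ^ 3 * exp (t / 8) \<le> 13 / 5 * exp (7 * t / 8) * exp (t / 8)"
    by (intro mult_right_mono) auto
  also have "\<dots> = 13 / 5 * exp t" by (simp flip: exp_add)
  finally show ?thesis .
qed

lemma norm_exp_minus_one_le: "norm (exp w - 1) \<le> exp (norm w) - 1" for w :: complex
proof -
  have "(\<lambda>n. w ^ Suc n /\<^sub>R fact (Suc n)) sums (exp w - 1)"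
    using exp_converges[of w] by (subst sums_Suc_iff) simp
  then have 1: "exp w - 1 = (\<Sum>n. w ^ Suc n /\<^sub>R fact (Suc n))" by (simp add: sums_iff)
  have "(\<lambda>n. norm w ^ Suc n /\<^sub>R fact (Suc n)) sums (exp (norm w) - 1)"
    using exp_converges[of "norm w"] by (subst sums_Suc_iff) simp
  then have 2: "summable (\<lambda>n. norm w ^ Suc n /\<^sub>R fact (Suc n))"
    "exp (norm w) - 1 = (\<Sum>n. norm w ^ Suc n /\<^sub>R fact (Suc n))" by (simp_all add: sums_iff)
  have n: "norm (w ^ Suc n /\<^sub>R fact (Suc n)) = norm w ^ Suc n /\<^sub>R fact (Suc n)" for n
    by (simp add: norm_mult norm_power del: power_Suc)
  show ?thesis unfolding 1 2(2)
    using summable_norm[of "\<lambda>n. w ^ Suc n /\<^sub>R fact (Suc n)"] 2(1) by (simp only: n)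
qed

text \<open>Convexity of the exponential function along the segment from 0 to \<open>t\<close>.\<close>

lemma exp_mult_minus_one_le:
  fixes l t :: real
  assumes "0 \<le> l" "l \<le> 1"
  shows "exp (l * t) - 1 \<le> l * (exp t - 1)"
  using convex_onD[OF exp_convex, of l 0 t] assms by (simp add: algebra_simps)

lemma norm_exp_diff_le:
  fixes a b :: complex
  assumes "\<bar>Re a\<bar> \<le> R" "\<bar>Re b\<bar> \<le> R"
  shows "norm (exp a - exp b) \<le> exp R * norm (a - b)"
proof (rule field_differentiable_bound[where S = "{w. Re w \<le> R}" and f' = exp])
  show "convex {w. Re w \<le> R}" by (rule convex_halfspace_Re_le)
qed (use assms in \<open>auto intro!: derivative_eq_intros\<close>)

lemma abs_Re_mult_of_real_le: "\<bar>Re w\<bar> \<le> c \<Longrightarrow> \<bar>Re (w * of_real x)\<bar> \<le> c * \<bar>x\<bar>"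
  by (simp add: abs_mult mult_right_mono)

locale standardised_exp_moments = prob_space M for M :: "'a measure" +
  fixes X :: "'a \<Rightarrow> real" and \<alpha> :: real
  assumes X [measurable]: "X \<in> borel_measurable M"
    and exp_radius: "exp_radius M X \<alpha>"
    and mean_zero: "expectation X = 0"
    and var_one: "expectation (\<lambda>\<omega>. (X \<omega>)\<^sup>2) = 1"
begin

text \<open>The \<open>k\<close>-th derivative of the Laplace transform, written as an expectation; \<open>k = 0\<close> is
  the Laplace transform itself, and the values at 0 are the moments of \<open>X\<close>.\<close>

definition moment :: "nat \<Rightarrow> complex \<Rightarrow> complex" where
  "moment k z = (CLINT \<omega>|M. of_real (X \<omega>) ^ k * exp (z * of_real (X \<omega>)))"

lemma \<alpha>_pos: "\<alpha> > 0" and exp_integrable: "integrable M (\<lambda>\<omega>. exp (\<alpha> * \<bar>X \<omega>\<bar>))"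
  and exp_le_2: "expectation (\<lambda>\<omega>. exp (\<alpha> * \<bar>X \<omega>\<bar>)) \<le> 2"
  using exp_radius by (auto simp: exp_radius_def)

lemma power_exp_integrable:
  assumes "c < \<alpha>"
  shows "integrable M (\<lambda>\<omega>. \<bar>X \<omega>\<bar> ^ k * exp (c * \<bar>X \<omega>\<bar>))"
proof (rule Bochner_Integration.integrable_bound)
  define d where "d = \<alpha> - c"
  have d: "d > 0" using assms by (simp add: d_def)
  show "integrable M (\<lambda>\<omega>. fact k / d ^ k * exp (\<alpha> * \<bar>X \<omega>\<bar>))"
    using exp_integrable by simp
  have "\<bar>X \<omega>\<bar> ^ k * exp (c * \<bar>X \<omega>\<bar>) \<le> fact k / d ^ k * exp (\<alpha> * \<bar>X \<omega>\<bar>)" for \<omega>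
  proof -
    have "(d * \<bar>X \<omega>\<bar>) ^ k \<le> fact k * exp (d * \<bar>X \<omega>\<bar>)"
      using d by (intro power_le_fact_exp) auto
    then have "\<bar>X \<omega>\<bar> ^ k \<le> fact k / d ^ k * exp (d * \<bar>X \<omega>\<bar>)"
      using d by (simp add: power_mult_distrib field_simps)
    then have "\<bar>X \<omega>\<bar> ^ k * exp (c * \<bar>X \<omega>\<bar>) \<le> fact k / d ^ k * exp (d * \<bar>X \<omega>\<bar>) * exp (c * \<bar>X \<omega>\<bar>)"
      by (rule mult_right_mono) simp
    also have "\<dots> = fact k / d ^ k * exp (\<alpha> * \<bar>X \<omega>\<bar>)"
      by (simp add: mult.assoc d_def algebra_simps flip: exp_add)
    finally show ?thesis .
  qed
  then show "AE \<omega> in M. norm (\<bar>X \<omega>\<bar> ^ k * exp (c * \<bar>X \<omega>\<bar>)) \<le> norm (fact k / d ^ k * exp (\<alpha> * \<bar>X \<omega>\<bar>))"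
    using d by (auto simp: abs_mult)
qed measurable

lemma norm_exp_mult_le: "norm (exp (z * of_real (X \<omega>))) \<le> exp (\<bar>Re z\<bar> * \<bar>X \<omega>\<bar>)"
  using abs_ge_self[of "Re z * X \<omega>"] by (simp add: norm_exp_eq_Re abs_mult)

lemma moment_integrable:
  assumes "\<bar>Re z\<bar> < \<alpha>"
  shows "complex_integrable M (\<lambda>\<omega>. of_real (X \<omega>) ^ k * exp (z * of_real (X \<omega>)))"
  by (rule Bochner_Integration.integrable_bound[OF power_exp_integrable[OF assms, of k]])
     (auto simp: norm_mult norm_power abs_mult simp del: norm_exp_eq_Re intro!: mult_left_mono norm_exp_mult_le)

lemma Re_in_ball: "norm z < \<alpha> \<Longrightarrow> \<bar>Re z\<bar> < \<alpha>"
  using abs_Re_le_cmod[of z] by simp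

text \<open>Differentiation under the expectation. Difference quotients at points within half the
  distance from \<open>norm z\<close> to \<open>\<alpha>\<close> share the integrable majorant
  \<open>\<bar>X\<bar> ^ Suc k * exp (c * \<bar>X\<bar>)\<close>, so dominated convergence applies along sequences.\<close>

lemma moment_has_field_derivative:
  assumes z: "norm z < \<alpha>"
  shows "(moment k has_field_derivative moment (Suc k) z) (at z within A)"
proof -
  define r where "r = (\<alpha> - norm z) / 2"
  define c where "c = norm z + r"
  have r: "r > 0" and c: "c < \<alpha>" using z by (auto simp: r_def c_def field_simps)
  have "((\<lambda>y. (moment k y - moment k z) / (y - z)) \<longlongrightarrow> moment (Suc k) z) (at z within ball z r)"
    unfolding tendsto_at_iff_sequentially
  proof (intro allI impI)
    fix u :: "nat \<Rightarrow> complex"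
    assume u: "\<forall>i. u i \<in> ball z r - {z}" and lim: "u \<longlonglongrightarrow> z"
    have Rez: "\<bar>Re z\<bar> \<le> c" using abs_Re_le_cmod[of z] r by (simp add: c_def)
    have un: "norm (u i) \<le> c" for i
    proof -
      have "norm (u i) \<le> norm z + norm (u i - z)" by (rule norm_triangle_sub)
      moreover have "norm (u i - z) < r" using u by (auto simp: dist_norm norm_minus_commute)
      ultimately show ?thesis by (simp add: c_def)
    qed
    have Reu: "\<bar>Re (u i)\<bar> \<le> c" for i using abs_Re_le_cmod[of "u i"] un[of i] by simp
    define f where "f i \<omega> = of_real (X \<omega>) ^ k * ((exp (u i * of_real (X \<omega>)) - exp (z * of_real (X \<omega>))) / (u i - z))" for i \<omega>
    have [measurable]: "f i \<in> borel_measurable M" for i unfolding f_def by measurable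
    have eq: "(moment k (u i) - moment k z) / (u i - z) = (CLINT \<omega>|M. f i \<omega>)" for i
    proof -
      have "moment k (u i) - moment k z = (CLINT \<omega>|M. of_real (X \<omega>) ^ k * exp (u i * of_real (X \<omega>)) - of_real (X \<omega>) ^ k * exp (z * of_real (X \<omega>)))"
        unfolding moment_def
        by (rule Bochner_Integration.integral_diff[symmetric])
           (use Reu[of i] Rez c in \<open>auto intro!: moment_integrable\<close>)
      also have "\<dots> / (u i - z) = (CLINT \<omega>|M. (of_real (X \<omega>) ^ k * exp (u i * of_real (X \<omega>)) - of_real (X \<omega>) ^ k * exp (z * of_real (X \<omega>))) / (u i - z))"
        by simp
      finally show ?thesis by (simp add: f_def right_diff_distrib)
    qed
    have "(\<lambda>i. CLINT \<omega>|M. f i \<omega>) \<longlonglongrightarrow> (CLINT \<omega>|M. of_real (X \<omega>) ^ Suc k * exp (z * of_real (X \<omega>)))"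
    proof (rule integral_dominated_convergence[where w = "\<lambda>\<omega>. \<bar>X \<omega>\<bar> ^ Suc k * exp (c * \<bar>X \<omega>\<bar>)"])
      show "integrable M (\<lambda>\<omega>. \<bar>X \<omega>\<bar> ^ Suc k * exp (c * \<bar>X \<omega>\<bar>))"
        by (rule power_exp_integrable[OF c])
      show "AE \<omega> in M. norm (f i \<omega>) \<le> \<bar>X \<omega>\<bar> ^ Suc k * exp (c * \<bar>X \<omega>\<bar>)" for i
      proof (rule AE_I2)
        fix \<omega>
        have "norm (exp (u i * of_real (X \<omega>)) - exp (z * of_real (X \<omega>)))
            \<le> exp (c * \<bar>X \<omega>\<bar>) * norm (u i * of_real (X \<omega>) - z * of_real (X \<omega>))"
          by (intro norm_exp_diff_le abs_Re_mult_of_real_le Reu Rez)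
        also have "\<dots> = exp (c * \<bar>X \<omega>\<bar>) * \<bar>X \<omega>\<bar> * norm (u i - z)"
          by (simp add: norm_mult flip: left_diff_distrib)
        finally have "norm (exp (u i * of_real (X \<omega>)) - exp (z * of_real (X \<omega>))) / norm (u i - z) \<le> exp (c * \<bar>X \<omega>\<bar>) * \<bar>X \<omega>\<bar>"
          using u by (auto simp: divide_le_eq)
        then have "\<bar>X \<omega>\<bar> ^ k * (norm (exp (u i * of_real (X \<omega>)) - exp (z * of_real (X \<omega>))) / norm (u i - z))
            \<le> \<bar>X \<omega>\<bar> ^ k * (exp (c * \<bar>X \<omega>\<bar>) * \<bar>X \<omega>\<bar>)"
          by (rule mult_left_mono) simp
        then show "norm (f i \<omega>) \<le> \<bar>X \<omega>\<bar> ^ Suc k * exp (c * \<bar>X \<omega>\<bar>)"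
          by (simp add: f_def norm_mult norm_power norm_divide mult_ac)
      qed
      show "AE \<omega> in M. (\<lambda>i. f i \<omega>) \<longlonglongrightarrow> of_real (X \<omega>) ^ Suc k * exp (z * of_real (X \<omega>))"
      proof (rule AE_I2)
        fix \<omega>
        have "((\<lambda>y. exp (y * of_real (X \<omega>))) has_field_derivative (exp (z * of_real (X \<omega>)) * of_real (X \<omega>))) (at z)"
          by (auto intro!: derivative_eq_intros)
        then have "((\<lambda>y. (exp (y * of_real (X \<omega>)) - exp (z * of_real (X \<omega>))) / (y - z)) \<longlongrightarrow> exp (z * of_real (X \<omega>)) * of_real (X \<omega>)) (at z)"
          by (simp add: has_field_derivative_iff)
        then have "(\<lambda>i. (exp (u i * of_real (X \<omega>)) - exp (z * of_real (X \<omega>))) / (u i - z)) \<longlonglongrightarrow> exp (z * of_real (X \<omega>)) * of_real (X \<omega>)"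
          using u lim by (auto simp: tendsto_at_iff_sequentially o_def)
        then have "(\<lambda>i. f i \<omega>) \<longlonglongrightarrow> of_real (X \<omega>) ^ k * (exp (z * of_real (X \<omega>)) * of_real (X \<omega>))"
          unfolding f_def by (intro tendsto_intros)
        then show "(\<lambda>i. f i \<omega>) \<longlonglongrightarrow> of_real (X \<omega>) ^ Suc k * exp (z * of_real (X \<omega>))"
          by (simp add: mult_ac)
      qed
    qed measurable
    then show "((\<lambda>y. (moment k y - moment k z) / (y - z)) \<circ> u) \<longlonglongrightarrow> moment (Suc k) z"
      unfolding o_def eq moment_def[symmetric] .
  qed
  then have "(moment k has_field_derivative moment (Suc k) z) (at z within ball z r)"
    by (simp add: has_field_derivative_iff)
  then have "(moment k has_field_derivative moment (Suc k) z) (at z)"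
    using r by (simp add: at_within_open[of z "ball z r"])
  then show ?thesis by (rule has_field_derivative_at_within)
qed

lemma moment_cnj: "moment k (cnj z) = cnj (moment k z)"
  unfolding moment_def Bochner_Integration.integral_cnj[symmetric] by (simp add: exp_cnj)

lemma moment_of_real: "moment k (of_real s) = of_real (Re (moment k (of_real s)))"
  using moment_cnj[of k "of_real s"] by (simp add: complex_eq_iff)

lemma moment_0_0: "moment 0 0 = 1" and moment_1_0: "moment 1 0 = 0" and moment_2_0: "moment 2 0 = 1"
proof -
  show "moment 0 0 = 1" using prob_space by (simp add: moment_def)
  have "moment 1 0 = of_real (expectation X)" by (simp add: moment_def)
  then show "moment 1 0 = 0" by (simp add: mean_zero)
  have "moment 2 0 = of_real (expectation (\<lambda>\<omega>. (X \<omega>)\<^sup>2))"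
    unfolding integral_complex_of_real[symmetric] by (simp add: moment_def)
  then show "moment 2 0 = 1" by (simp add: var_one)
qed

text \<open>On the imaginary axis the factor \<open>exp (w * X)\<close> has modulus 1, so the difference is at most
  \<open>E (exp (norm z * \<bar>X\<bar>) - 1)\<close>, and convexity compares this with \<open>E (exp (\<alpha> * \<bar>X\<bar>) - 1) \<le> 1\<close>.
  The bound is uniform in \<open>w\<close>: it moves estimates from the imaginary axis to nearby vertical
  lines, and with \<open>w = 0\<close> it keeps the Laplace transform in the right half-plane, where the
  principal logarithm is analytic.\<close>

lemma norm_moment_shift_le:
  assumes "norm z \<le> \<alpha>" and "\<bar>Re w\<bar> < \<alpha>" "\<bar>Re (w + z)\<bar> < \<alpha>" "Re w = 0"
  shows "norm (moment 0 (w + z) - moment 0 w) \<le> norm z / \<alpha>"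
proof -
  have int: "complex_integrable M (\<lambda>\<omega>. exp ((w + z) * of_real (X \<omega>)))"
    "complex_integrable M (\<lambda>\<omega>. exp (w * of_real (X \<omega>)))"
    using moment_integrable[of "w + z" 0] moment_integrable[of w 0] assms by auto
  have "norm (moment 0 (w + z) - moment 0 w)
      = norm (CLINT \<omega>|M. exp ((w + z) * of_real (X \<omega>)) - exp (w * of_real (X \<omega>)))"
    using int by (simp add: moment_def)
  also have "\<dots> \<le> expectation (\<lambda>\<omega>. norm (exp ((w + z) * of_real (X \<omega>)) - exp (w * of_real (X \<omega>))))"
    by (rule integral_norm_bound)
  also have "\<dots> \<le> expectation (\<lambda>\<omega>. norm z / \<alpha> * (exp (\<alpha> * \<bar>X \<omega>\<bar>) - 1))"
  proof (rule integral_mono)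
    show "integrable M (\<lambda>\<omega>. norm (exp ((w + z) * of_real (X \<omega>)) - exp (w * of_real (X \<omega>))))"
      using int by simp
    show "integrable M (\<lambda>\<omega>. norm z / \<alpha> * (exp (\<alpha> * \<bar>X \<omega>\<bar>) - 1))"
      using exp_integrable by simp
    fix \<omega>
    have "exp ((w + z) * of_real (X \<omega>)) - exp (w * of_real (X \<omega>)) = exp (w * of_real (X \<omega>)) * (exp (z * of_real (X \<omega>)) - 1)"
      by (simp add: algebra_simps exp_add)
    also have "norm \<dots> = norm (exp (z * of_real (X \<omega>)) - 1)"
      using assms(4) by (simp add: norm_mult norm_exp_eq_Re)
    also have "\<dots> \<le> exp (norm z * \<bar>X \<omega>\<bar>) - 1"
      using norm_exp_minus_one_le[of "z * of_real (X \<omega>)"] by (simp add: norm_mult)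
    also have "\<dots> \<le> norm z / \<alpha> * (exp (\<alpha> * \<bar>X \<omega>\<bar>) - 1)"
      using exp_mult_minus_one_le[of "norm z / \<alpha>" "\<alpha> * \<bar>X \<omega>\<bar>"] \<alpha>_pos assms(1) by simp
    finally show "norm (exp ((w + z) * of_real (X \<omega>)) - exp (w * of_real (X \<omega>))) \<le> norm z / \<alpha> * (exp (\<alpha> * \<bar>X \<omega>\<bar>) - 1)" .
  qed
  also have "\<dots> = norm z / \<alpha> * (expectation (\<lambda>\<omega>. exp (\<alpha> * \<bar>X \<omega>\<bar>)) - 1)"
    using exp_integrable by (simp add: prob_space)
  also have "\<dots> \<le> norm z / \<alpha> * 1"
    using exp_le_2 \<alpha>_pos by (intro mult_left_mono) auto
  finally show ?thesis by simp
qed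

lemma norm_laplace_minus_one_le:
  assumes "norm z < \<alpha>"
  shows "norm (moment 0 z - 1) \<le> norm z / \<alpha>"
  using norm_moment_shift_le[of z 0] assms \<alpha>_pos Re_in_ball[OF assms] by (simp add: moment_0_0)

lemma Re_laplace_pos:
  assumes "norm z < \<alpha>"
  shows "Re (moment 0 z) > 0"
proof -
  have "norm (moment 0 z - 1) < 1"
    using norm_laplace_minus_one_le[OF assms] assms \<alpha>_pos by (simp add: less_le_trans le_less_trans)
  then show ?thesis
    using abs_Re_le_cmod[of "moment 0 z - 1"] by simp
qed

lemma integrable_X: "integrable M X"
  by (rule Bochner_Integration.integrable_bound[OF power_exp_integrable[of 0 1]]) (use \<alpha>_pos in auto)

lemma laplace_real_ge_1:
  assumes "\<bar>s\<bar> < \<alpha>"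
  shows "Re (moment 0 (of_real s)) \<ge> 1"
proof -
  have int: "complex_integrable M (\<lambda>\<omega>. exp (of_real s * of_real (X \<omega>)))"
    using moment_integrable[of "of_real s" 0] assms by simp
  have "1 = expectation (\<lambda>\<omega>. 1 + s * X \<omega>)"
    using integrable_X by (simp add: mean_zero prob_space)
  also have "\<dots> \<le> expectation (\<lambda>\<omega>. Re (exp (of_real s * of_real (X \<omega>))))"
  proof (rule integral_mono)
    show "1 + s * X \<omega> \<le> Re (exp (of_real s * of_real (X \<omega>)))" for \<omega>
      unfolding of_real_mult[symmetric] exp_of_real Re_complex_of_real by (rule exp_ge_add_one_self)
  qed (use integrable_X int in auto)
  also have "\<dots> = Re (moment 0 (of_real s))"
    using int by (simp add: moment_def)
  finally show ?thesis .
qed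

text \<open>The quadratic Taylor term of \<open>exp (\<alpha> * \<bar>X\<bar>)\<close> already has expectation \<open>\<alpha>\<^sup>2 / 2\<close>, since
  \<open>X\<close> has unit variance. So \<open>\<alpha>\<close> cannot be large, and the radius \<open>\<alpha> ^ 3 / 16\<close> of the saddle
  point disc is at most \<open>\<alpha> / 8\<close>.\<close>

lemma \<alpha>_squared_le_2: "\<alpha>\<^sup>2 \<le> 2"
proof -
  have "integrable M (\<lambda>\<omega>. \<bar>X \<omega>\<bar> ^ 2 * exp (0 * \<bar>X \<omega>\<bar>))"
    using \<alpha>_pos by (intro power_exp_integrable) auto
  then have i2: "integrable M (\<lambda>\<omega>. (X \<omega>)\<^sup>2)" by simp
  have "\<alpha>\<^sup>2 / 2 * expectation (\<lambda>\<omega>. (X \<omega>)\<^sup>2) = expectation (\<lambda>\<omega>. \<alpha>\<^sup>2 / 2 * (X \<omega>)\<^sup>2)"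
    by simp
  also have "\<dots> \<le> expectation (\<lambda>\<omega>. exp (\<alpha> * \<bar>X \<omega>\<bar>) - 1)"
  proof (rule integral_mono)
    fix \<omega>
    have "1 + \<alpha> * \<bar>X \<omega>\<bar> + (\<alpha> * \<bar>X \<omega>\<bar>)\<^sup>2 / 2 \<le> exp (\<alpha> * \<bar>X \<omega>\<bar>)"
      using \<alpha>_pos by (intro exp_lower_Taylor_quadratic) auto
    moreover have "\<alpha> * \<bar>X \<omega>\<bar> \<ge> 0" using \<alpha>_pos by simp
    ultimately show "\<alpha>\<^sup>2 / 2 * (X \<omega>)\<^sup>2 \<le> exp (\<alpha> * \<bar>X \<omega>\<bar>) - 1"
      by (simp add: power_mult_distrib)
  qed (use i2 exp_integrable in auto)
  also have "\<dots> \<le> 1" using exp_le_2 exp_integrable by (simp add: prob_space)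
  finally show ?thesis by (simp add: var_one)
qed

lemma \<alpha>_cubed_bounds: "\<alpha> ^ 3 / 16 \<le> \<alpha> / 8" "\<alpha> ^ 3 / 16 \<le> 3 / 16"
proof -
  have "\<alpha> * \<alpha>\<^sup>2 \<le> \<alpha> * 2" using \<alpha>_squared_le_2 \<alpha>_pos by (intro mult_left_mono) auto
  then have *: "\<alpha> ^ 3 \<le> \<alpha> * 2" by (simp add: power3_eq_cube power2_eq_square)
  then show "\<alpha> ^ 3 / 16 \<le> \<alpha> / 8" by simp
  have "\<alpha> \<le> 3 / 2"
  proof (rule power2_le_imp_le)
    have "(3 / 2 :: real)\<^sup>2 = 9 / 4" by (simp add: power2_eq_square)
    then show "\<alpha>\<^sup>2 \<le> (3 / 2)\<^sup>2" using \<alpha>_squared_le_2 by linarith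
  qed simp
  then show "\<alpha> ^ 3 / 16 \<le> 3 / 16" using * by simp
qed

text \<open>With \<open>t = \<alpha> * \<bar>X\<bar>\<close>, the integrand \<open>X\<^sup>2 * \<bar>exp (z * X) - 1\<bar>\<close> is at most
  \<open>t ^ 3 * exp (t / 8) / 16\<close> on the disc, where the cube of \<open>\<alpha>\<close> in the radius absorbs the cube
  of \<open>\<bar>X\<bar>\<close>. The expectation is then at most \<open>13 / 80 * 2 < 1 / 3\<close>.\<close>

lemma norm_moment_2_minus_one_le:
  assumes z: "norm z \<le> \<alpha> ^ 3 / 16"
  shows "norm (moment 2 z - 1) \<le> 1 / 3"
proof -
  have z8: "norm z \<le> \<alpha> / 8" using z \<alpha>_cubed_bounds(1) by simp
  have za: "norm z < \<alpha>" using z8 \<alpha>_pos by simp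
  have int: "complex_integrable M (\<lambda>\<omega>. of_real (X \<omega>) ^ 2 * exp (z * of_real (X \<omega>)))"
    "complex_integrable M (\<lambda>\<omega>. of_real (X \<omega>) ^ 2 * exp (0 * of_real (X \<omega>)))"
    using moment_integrable[OF Re_in_ball[OF za], of 2] moment_integrable[of 0 2] \<alpha>_pos by auto
  have "norm (moment 2 z - 1) = norm (moment 2 z - moment 2 0)" by (simp add: moment_2_0)
  also have "\<dots> = norm (CLINT \<omega>|M. of_real (X \<omega>) ^ 2 * exp (z * of_real (X \<omega>)) - of_real (X \<omega>) ^ 2 * exp (0 * of_real (X \<omega>)))"
    unfolding moment_def using int by simp
  also have "\<dots> \<le> expectation (\<lambda>\<omega>. norm (of_real (X \<omega>) ^ 2 * exp (z * of_real (X \<omega>)) - of_real (X \<omega>) ^ 2 * exp (0 * of_real (X \<omega>)) :: complex))"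
    by (rule integral_norm_bound)
  also have "\<dots> \<le> expectation (\<lambda>\<omega>. 13 / 80 * exp (\<alpha> * \<bar>X \<omega>\<bar>))"
  proof (rule integral_mono)
    show "integrable M (\<lambda>\<omega>. norm (of_real (X \<omega>) ^ 2 * exp (z * of_real (X \<omega>)) - of_real (X \<omega>) ^ 2 * exp (0 * of_real (X \<omega>)) :: complex))"
      using int by (intro integrable_norm Bochner_Integration.integrable_diff)
    show "integrable M (\<lambda>\<omega>. 13 / 80 * exp (\<alpha> * \<bar>X \<omega>\<bar>))" using exp_integrable by simp
    fix \<omega>
    define t where "t = \<alpha> * \<bar>X \<omega>\<bar>"
    have t: "t \<ge> 0" using \<alpha>_pos by (simp add: t_def)
    have "norm (exp (z * of_real (X \<omega>)) - exp 0) \<le> exp (\<alpha> / 8 * \<bar>X \<omega>\<bar>) * norm (z * of_real (X \<omega>) - 0)"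
      using abs_Re_le_cmod[of z] z8 \<alpha>_pos
      by (intro norm_exp_diff_le abs_Re_mult_of_real_le) auto
    also have "\<dots> \<le> exp (\<alpha> / 8 * \<bar>X \<omega>\<bar>) * (\<alpha> ^ 3 / 16 * \<bar>X \<omega>\<bar>)"
      using mult_right_mono[OF z, of "\<bar>X \<omega>\<bar>"] by (intro mult_left_mono) (simp_all add: norm_mult)
    finally have "\<bar>X \<omega>\<bar> ^ 2 * norm (exp (z * of_real (X \<omega>)) - 1) \<le> \<bar>X \<omega>\<bar> ^ 2 * (exp (\<alpha> / 8 * \<bar>X \<omega>\<bar>) * (\<alpha> ^ 3 / 16 * \<bar>X \<omega>\<bar>))"
      by (intro mult_left_mono) auto
    also have "\<dots> = 1 / 16 * (t ^ 3 * exp (t / 8))"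
      by (simp add: t_def power_mult_distrib power3_eq_cube power2_eq_square)
    also have "\<dots> \<le> 1 / 16 * (13 / 5 * exp t)" using cube_exp_le[OF t] by (intro mult_left_mono) auto
    finally have "\<bar>X \<omega>\<bar> ^ 2 * norm (exp (z * of_real (X \<omega>)) - 1) \<le> 13 / 80 * exp t" by simp
    moreover have "of_real (X \<omega>) ^ 2 * exp (z * of_real (X \<omega>)) - of_real (X \<omega>) ^ 2 * exp (0 * of_real (X \<omega>))
       = of_real (X \<omega>) ^ 2 * (exp (z * of_real (X \<omega>)) - 1)" by (simp add: algebra_simps)
    ultimately show "norm (of_real (X \<omega>) ^ 2 * exp (z * of_real (X \<omega>)) - of_real (X \<omega>) ^ 2 * exp (0 * of_real (X \<omega>)) :: complex) \<le> 13 / 80 * exp (\<alpha> * \<bar>X \<omega>\<bar>)"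
      by (simp add: norm_mult norm_power t_def)
  qed
  also have "\<dots> \<le> 1 / 3" using exp_le_2 by simp
  finally show ?thesis .
qed

text \<open>The first moment vanishes at 0 and its derivative, the second moment, is at most
  \<open>1 + 1 / 3\<close> in modulus on the disc.\<close>

lemma norm_moment_1_le:
  assumes z: "norm z \<le> \<alpha> ^ 3 / 16"
  shows "norm (moment 1 z) \<le> 1 / 4"
proof -
  have "norm (moment 1 z - moment 1 0) \<le> 4 / 3 * norm (z - 0)"
  proof (rule field_differentiable_bound[where S = "cball (0 :: complex) (\<alpha> ^ 3 / 16)" and f' = "moment 2"])
    fix w :: complex assume "w \<in> cball 0 (\<alpha> ^ 3 / 16)"
    then have w: "norm w \<le> \<alpha> ^ 3 / 16" by simp
    then have "norm w < \<alpha>" using \<alpha>_cubed_bounds(1) \<alpha>_pos by simp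
    from moment_has_field_derivative[OF this, of 1]
    show "(moment 1 has_field_derivative moment 2 w) (at w within cball 0 (\<alpha> ^ 3 / 16))"
      by (simp add: numeral_2_eq_2)
    show "norm (moment 2 w) \<le> 4 / 3"
      using norm_triangle_sub[of "moment 2 w" 1] norm_moment_2_minus_one_le[OF w] by simp
  qed (use z \<alpha>_pos in auto)
  also have "\<dots> \<le> 4 / 3 * (3 / 16)" using z \<alpha>_cubed_bounds(2) by simp
  finally show ?thesis unfolding moment_1_0 by simp
qed

end

section \<open>The log-Laplace transform and its saddle point\<close>

text \<open>Taylor's formula on vertical lines, with constants that are uniform in the base point \<open>s\<close>.
  The second bound is for the even part in \<open>t\<close>, in which the cubic term cancels: for a function
  that is real on the real axis the even part is the real part, so its error is of order 4 even
  though the error of the quadratic approximation is only of order 3.\<close>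

lemma vertical_taylor_bounds:
  fixes f :: "complex \<Rightarrow> complex" and \<alpha> :: real
  assumes hol: "f holomorphic_on ball 0 \<alpha>" and \<alpha>: "\<alpha> > 0"
  obtains C where "C > 0"
    "\<And>s t. \<bar>s\<bar> \<le> \<alpha> / 4 \<Longrightarrow> \<bar>t\<bar> \<le> \<alpha> / 4 \<Longrightarrow>
      norm (f (of_real s + \<i> * of_real t) - f (of_real s) - \<i> * of_real t * deriv f (of_real s)
        + of_real (t\<^sup>2 / 2) * deriv (deriv f) (of_real s)) \<le> C * \<bar>t\<bar> ^ 3"
    "\<And>s t. \<bar>s\<bar> \<le> \<alpha> / 4 \<Longrightarrow> \<bar>t\<bar> \<le> \<alpha> / 4 \<Longrightarrow>
      norm (f (of_real s + \<i> * of_real t) + f (of_real s - \<i> * of_real t) - 2 * f (of_real s)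
        + of_real (t\<^sup>2) * deriv (deriv f) (of_real s)) \<le> C * t ^ 4"
proof -
  define F where "F i = (deriv ^^ i) f" for i
  define S where "S = cball (0 :: complex) (\<alpha> / 2)"
  have SS: "S \<subseteq> ball 0 \<alpha>" using \<alpha> by (auto simp: S_def)
  have hF: "F i holomorphic_on ball 0 \<alpha>" for i
    unfolding F_def by (rule holomorphic_higher_deriv[OF hol]) auto
  have dF: "(F i has_field_derivative F (Suc i) z) (at z within S)" if "z \<in> S" for i z
    using holomorphic_derivI[OF hF[of i], of z S] that SS by (auto simp: F_def)
  have "\<exists>B>0. \<forall>z\<in>S. norm (F i z) \<le> B" for i
  proof -
    have "compact (F i ` S)"
      by (rule compact_continuous_image[OF continuous_on_subset[OF holomorphic_on_imp_continuous_on[OF hF] SS]])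
         (simp add: S_def)
    then have "bounded (F i ` S)" by (rule compact_imp_bounded)
    then show ?thesis by (auto simp: bounded_pos)
  qed
  then obtain B3 B4 where B: "B3 > 0" "\<And>z. z \<in> S \<Longrightarrow> norm (F 3 z) \<le> B3"
    "B4 > 0" "\<And>z. z \<in> S \<Longrightarrow> norm (F 4 z) \<le> B4"
    by metis
  have cS: "convex S" by (simp add: S_def)
  have inS: "of_real s + \<i> * of_real t \<in> S" if "\<bar>s\<bar> \<le> \<alpha> / 4" "\<bar>t\<bar> \<le> \<alpha> / 4" for s t
    using norm_triangle_ineq[of "complex_of_real s" "\<i> * of_real t"] that by (simp add: S_def norm_mult)
  have T3: "norm (f (of_real s + \<i> * of_real t) - f (of_real s) - \<i> * of_real t * deriv f (of_real s)
        + of_real (t\<^sup>2 / 2) * deriv (deriv f) (of_real s)) \<le> B3 * \<bar>t\<bar> ^ 3"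
    if st: "\<bar>s\<bar> \<le> \<alpha> / 4" "\<bar>t\<bar> \<le> \<alpha> / 4" for s t
  proof -
    define z where "z = of_real s + \<i> * of_real t"
    have "norm (F 0 z - (\<Sum>i\<le>2. F i (of_real s) * (z - of_real s) ^ i / fact i))
        \<le> B3 * norm (z - of_real s) ^ Suc 2 / fact 2"
      by (rule complex_Taylor[OF cS]) (use dF B inS[of s t] inS[of s 0] st in \<open>auto simp: z_def\<close>)
    also have "\<dots> \<le> B3 * \<bar>t\<bar> ^ 3"
      using B by (simp add: z_def norm_mult)
    finally show ?thesis
      by (simp add: z_def F_def numeral_2_eq_2 power_mult_distrib algebra_simps)
  qed
  have T4: "norm (F 0 (of_real s + \<i> * of_real t) - (\<Sum>i\<le>3. F i (of_real s) * (\<i> * of_real t) ^ i / fact i)) \<le> B4 * t ^ 4"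
    if st: "\<bar>s\<bar> \<le> \<alpha> / 4" "\<bar>t\<bar> \<le> \<alpha> / 4" for s t
  proof -
    define z where "z = of_real s + \<i> * of_real t"
    have "norm (F 0 z - (\<Sum>i\<le>3. F i (of_real s) * (z - of_real s) ^ i / fact i))
        \<le> B4 * norm (z - of_real s) ^ Suc 3 / fact 3"
      by (rule complex_Taylor[OF cS]) (use dF B inS[of s t] inS[of s 0] st in \<open>auto simp: z_def\<close>)
    also have "\<dots> \<le> B4 * t ^ 4"
      using B by (simp add: z_def norm_mult fact_numeral)
    finally show ?thesis by (simp add: z_def)
  qed
  have T4': "norm (f (of_real s + \<i> * of_real t) + f (of_real s - \<i> * of_real t) - 2 * f (of_real s)
        + of_real (t\<^sup>2) * deriv (deriv f) (of_real s)) \<le> 2 * B4 * t ^ 4"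
    if st: "\<bar>s\<bar> \<le> \<alpha> / 4" "\<bar>t\<bar> \<le> \<alpha> / 4" for s t
  proof -
    define P where "P t = (\<Sum>i\<le>3. F i (of_real s) * (\<i> * of_real t) ^ i / fact i)" for t
    have "P t + P (-t) = 2 * f (of_real s) - of_real (t\<^sup>2) * deriv (deriv f) (of_real s)"
      by (simp add: P_def F_def numeral_3_eq_3 numeral_2_eq_2 power_mult_distrib algebra_simps)
    then have "f (of_real s + \<i> * of_real t) + f (of_real s - \<i> * of_real t) - 2 * f (of_real s)
        + of_real (t\<^sup>2) * deriv (deriv f) (of_real s)
      = (F 0 (of_real s + \<i> * of_real t) - P t) + (F 0 (of_real s + \<i> * of_real (-t)) - P (-t))"
      by (simp add: F_def algebra_simps)
    also have "norm \<dots> \<le> norm (F 0 (of_real s + \<i> * of_real t) - P t) + norm (F 0 (of_real s + \<i> * of_real (-t)) - P (-t))"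
      by (rule norm_triangle_ineq)
    also have "\<dots> \<le> B4 * t ^ 4 + B4 * (-t) ^ 4"
      unfolding P_def using st by (intro add_mono T4) auto
    finally show ?thesis by simp
  qed
  show ?thesis
  proof (rule that[of "B3 + 2 * B4"])
    show "B3 + 2 * B4 > 0" using B by simp
  next
    fix s t :: real assume st: "\<bar>s\<bar> \<le> \<alpha> / 4" "\<bar>t\<bar> \<le> \<alpha> / 4"
    have "B3 * \<bar>t\<bar> ^ 3 \<le> (B3 + 2 * B4) * \<bar>t\<bar> ^ 3" using B by (intro mult_right_mono) auto
    with T3[OF st] show "norm (f (of_real s + \<i> * of_real t) - f (of_real s) - \<i> * of_real t * deriv f (of_real s)
        + of_real (t\<^sup>2 / 2) * deriv (deriv f) (of_real s)) \<le> (B3 + 2 * B4) * \<bar>t\<bar> ^ 3"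
      by (rule order_trans)
    have "2 * B4 * t ^ 4 \<le> (B3 + 2 * B4) * t ^ 4" using B by (intro mult_right_mono) auto
    with T4'[OF st] show "norm (f (of_real s + \<i> * of_real t) + f (of_real s - \<i> * of_real t) - 2 * f (of_real s)
        + of_real (t\<^sup>2) * deriv (deriv f) (of_real s)) \<le> (B3 + 2 * B4) * t ^ 4"
      by (rule order_trans)
  qed
qed

context standardised_exp_moments
begin

abbreviation K :: "complex \<Rightarrow> complex" where "K \<equiv> log_laplace M X"

definition K' :: "complex \<Rightarrow> complex" where "K' z = moment 1 z / moment 0 z"

definition K'' :: "complex \<Rightarrow> complex" where
  "K'' z = moment 2 z / moment 0 z - (moment 1 z / moment 0 z)\<^sup>2"

lemma K_eq: "K z = Ln (moment 0 z)"
  by (simp add: log_laplace_def moment_def)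

lemma moment_0_nonzero: "norm z < \<alpha> \<Longrightarrow> moment 0 z \<noteq> 0"
  using Re_laplace_pos[of z] by auto

lemma exp_K: "norm z < \<alpha> \<Longrightarrow> exp (K z) = moment 0 z"
  by (simp add: K_eq moment_0_nonzero)

lemma K_has_field_derivative:
  assumes "norm z < \<alpha>"
  shows "(K has_field_derivative K' z) (at z)"
proof -
  have "moment 0 z \<notin> \<real>\<^sub>\<le>\<^sub>0"
    using Re_laplace_pos[OF assms] by (auto simp: complex_nonpos_Reals_iff)
  then have "((\<lambda>z. Ln (moment 0 z)) has_field_derivative inverse (moment 0 z) * moment 1 z) (at z)"
    using moment_has_field_derivative[OF assms, of 0] by (intro derivative_eq_intros) auto
  then show ?thesis
    by (simp add: K_eq[abs_def] K'_def field_simps)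
qed

lemma K'_has_field_derivative:
  assumes "norm z < \<alpha>"
  shows "(K' has_field_derivative K'' z) (at z within A)"
proof -
  have "((\<lambda>z. moment 1 z / moment 0 z) has_field_derivative K'' z) (at z within A)"
    using moment_has_field_derivative[OF assms, of 0] moment_has_field_derivative[OF assms, of 1]
      moment_0_nonzero[OF assms]
    by (auto intro!: derivative_eq_intros simp: K''_def numeral_2_eq_2 field_simps power2_eq_square)
  then show ?thesis by (simp add: K'_def[abs_def])
qed

lemma deriv_K: "norm z < \<alpha> \<Longrightarrow> deriv K z = K' z"
  by (rule DERIV_imp_deriv[OF K_has_field_derivative])

lemma deriv_deriv_K:
  assumes "norm z < \<alpha>"
  shows "deriv (deriv K) z = K'' z"
proof (rule DERIV_imp_deriv)
  show "(deriv K has_field_derivative K'' z) (at z)"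
    by (rule has_field_derivative_transform_within_open[OF K'_has_field_derivative[OF assms], where S = "ball 0 \<alpha>"])
       (use assms deriv_K in auto)
qed

lemma K_holomorphic: "K holomorphic_on ball 0 \<alpha>"
  by (auto simp: holomorphic_on_open intro!: exI[of _ "K' _"] K_has_field_derivative)

lemma K'_holomorphic: "K' holomorphic_on ball 0 \<alpha>"
  by (auto simp: holomorphic_on_open intro!: exI[of _ "K'' _"] K'_has_field_derivative)

lemma K''_holomorphic: "K'' holomorphic_on ball 0 \<alpha>"
proof -
  have "moment k holomorphic_on ball 0 \<alpha>" for k
    by (auto simp: holomorphic_on_open intro!: exI[of _ "moment (Suc k) _"] moment_has_field_derivative)
  then show ?thesis
    unfolding K''_def by (intro holomorphic_intros) (auto simp: moment_0_nonzero)
qed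

lemma K_cnj:
  assumes "norm z < \<alpha>"
  shows "K (cnj z) = cnj (K z)"
proof -
  have "moment 0 z \<notin> \<real>\<^sub>\<le>\<^sub>0"
    using Re_laplace_pos[OF assms] by (auto simp: complex_nonpos_Reals_iff)
  then show ?thesis by (simp add: K_eq moment_cnj cnj_Ln)
qed

lemma K'_cnj: "K' (cnj z) = cnj (K' z)"
  by (simp add: K'_def moment_cnj)

lemma K''_cnj: "K'' (cnj z) = cnj (K'' z)"
  by (simp add: K''_def moment_cnj)

lemma K''_of_real: "K'' (of_real s) = of_real (Re (K'' (of_real s)))"
  using K''_cnj[of "of_real s"] by (simp add: complex_eq_iff)

lemma K_of_real: "\<bar>s\<bar> < \<alpha> \<Longrightarrow> K (of_real s) = of_real (Re (K (of_real s)))"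
  using K_cnj[of "of_real s"] by (simp add: complex_eq_iff)

lemma K_0: "K 0 = 0" and K'_0: "K' 0 = 0" and K''_0: "K'' 0 = 1"
  using moment_0_0 moment_1_0 moment_2_0 by (simp_all add: K_eq K'_def K''_def)

lemma radius_less: "norm z \<le> \<alpha> ^ 3 / 16 \<Longrightarrow> norm z < \<alpha>" for z :: complex
  using \<alpha>_cubed_bounds(1) \<alpha>_pos by simp

text \<open>On the disc, \<open>K'' = m\<^sub>2 / L - (m\<^sub>1 / L)\<^sup>2\<close> with \<open>L\<close> and \<open>m\<^sub>2\<close> close to 1 and \<open>m\<^sub>1\<close> close
  to 0. This is the estimate that gives the disc of radius \<open>\<alpha> ^ 3 / 16\<close> its meaning: it makes
  \<open>K'\<close> injective there, and it keeps \<open>K''\<close> in the right half-plane.\<close>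

lemma norm_K''_minus_one_le:
  assumes z: "norm z \<le> \<alpha> ^ 3 / 16"
  shows "norm (K'' z - 1) \<le> 2 / 3"
proof -
  define L m1 m2 where "L = moment 0 z" and "m1 = moment 1 z" and "m2 = moment 2 z"
  have "norm (L - 1) \<le> norm z / \<alpha>"
    unfolding L_def by (rule norm_laplace_minus_one_le[OF radius_less[OF z]])
  also have "\<dots> \<le> 1 / 8" using z \<alpha>_cubed_bounds(1) \<alpha>_pos by (simp add: field_simps)
  finally have L1: "norm (L - 1) \<le> 1 / 8" .
  then have L: "norm L \<ge> 7 / 8"
    using norm_triangle_ineq2[of 1 "1 - L"] by (simp add: norm_minus_commute)
  then have L0: "L \<noteq> 0" by auto
  have "norm (m2 - L) \<le> norm (m2 - 1) + norm (L - 1)"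
    using norm_triangle_ineq4[of "m2 - 1" "L - 1"] by simp
  also have "\<dots> \<le> 1 / 3 + 1 / 8"
    using norm_moment_2_minus_one_le[OF z] L1 by (intro add_mono) (simp_all add: m2_def)
  finally have "norm (m2 - L) / norm L \<le> (1 / 3 + 1 / 8) / (7 / 8)"
    using L by (intro frac_le) auto
  moreover have "norm m1 / norm L \<le> (1 / 4) / (7 / 8)"
    using norm_moment_1_le[OF z] L by (intro frac_le) (auto simp: m1_def)
  then have "(norm m1 / norm L)\<^sup>2 \<le> ((1 / 4) / (7 / 8))\<^sup>2" by (intro power_mono) auto
  moreover have "norm (K'' z - 1) \<le> norm (m2 - L) / norm L + (norm m1 / norm L)\<^sup>2"
  proof -
    have "K'' z - 1 = (m2 - L) / L - (m1 / L)\<^sup>2"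
      using L0 by (simp add: K''_def L_def m1_def m2_def diff_divide_distrib)
    then show ?thesis
      using norm_triangle_ineq4[of "(m2 - L) / L" "(m1 / L)\<^sup>2"] by (simp add: norm_divide norm_power)
  qed
  ultimately show ?thesis by (simp add: power2_eq_square)
qed

lemma Re_K''_bounds:
  assumes "norm z \<le> \<alpha> ^ 3 / 16"
  shows "1 / 3 \<le> Re (K'' z)" "Re (K'' z) \<le> 5 / 3"
  using norm_K''_minus_one_le[OF assms] abs_Re_le_cmod[of "K'' z - 1"] by auto

text \<open>\<open>K'\<close> differs from the identity by a contraction.\<close>

lemma inj_on_K': "inj_on K' (cball 0 (\<alpha> ^ 3 / 16))"
proof (rule inj_onI)
  define S where "S = cball (0 :: complex) (\<alpha> ^ 3 / 16)"
  fix z w assume zw: "z \<in> cball 0 (\<alpha> ^ 3 / 16)" "w \<in> cball 0 (\<alpha> ^ 3 / 16)" and eq: "K' z = K' w"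
  have "norm ((K' z - z) - (K' w - w)) \<le> 2 / 3 * norm (z - w)"
  proof (rule field_differentiable_bound[where S = S and f' = "\<lambda>z. K'' z - 1"])
    fix u assume "u \<in> S"
    then have u: "norm u \<le> \<alpha> ^ 3 / 16" by (simp add: S_def)
    show "((\<lambda>z. K' z - z) has_field_derivative K'' u - 1) (at u within S)"
      by (intro derivative_intros K'_has_field_derivative radius_less u)
    show "norm (K'' u - 1) \<le> 2 / 3" by (rule norm_K''_minus_one_le[OF u])
  qed (use zw in \<open>auto simp: S_def\<close>)
  then have "norm (z - w) \<le> 2 / 3 * norm (z - w)" by (simp add: eq norm_minus_commute)
  then show "z = w" by simp
qed

lemma saddle_point_eqI:
  assumes "norm z \<le> \<alpha> ^ 3 / 16" "K' z = \<tau>"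
  shows "saddle_point M X \<alpha> \<tau> = z"
  unfolding saddle_point_def
proof (rule the_equality)
  show "norm z \<le> \<alpha> ^ 3 / 16 \<and> deriv K z = \<tau>"
    using assms radius_less deriv_K by simp
  fix w assume "norm w \<le> \<alpha> ^ 3 / 16 \<and> deriv K w = \<tau>"
  then show "w = z"
    using assms radius_less[of w] deriv_K[of w] inj_on_K' by (auto simp: inj_on_def)
qed

lemma saddle_point_0: "saddle_point M X \<alpha> 0 = 0"
  by (rule saddle_point_eqI) (use \<alpha>_pos K'_0 in auto)

text \<open>Near 0 the saddle point is the analytic inverse of \<open>K'\<close>. The injectivity on the larger closed
  disc ensures that this local inverse is the unique solution that the definition refers to.\<close>

lemma saddle_point_local:
  assumes r: "0 < r" "r \<le> \<alpha> ^ 3 / 16"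
  obtains d where "d > 0" "saddle_point M X \<alpha> holomorphic_on ball 0 d"
    "\<And>\<tau>. norm \<tau> < d \<Longrightarrow> norm (saddle_point M X \<alpha> \<tau>) < r"
    "\<And>\<tau>. norm \<tau> < d \<Longrightarrow> K' (saddle_point M X \<alpha> \<tau>) = \<tau>"
proof -
  define S where "S = ball (0 :: complex) r"
  have S: "S \<subseteq> cball 0 (\<alpha> ^ 3 / 16)" "S \<subseteq> ball 0 \<alpha>"
    using r radius_less by (auto simp: S_def)
  have hol: "K' holomorphic_on S" by (rule holomorphic_on_subset[OF K'_holomorphic S(2)])
  have inj: "inj_on K' S" by (rule inj_on_subset[OF inj_on_K' S(1)])
  have "open S" by (simp add: S_def)
  from holomorphic_has_inverse[OF hol this inj] obtain g
    where g: "g holomorphic_on (K' ` S)" "\<And>z. z \<in> S \<Longrightarrow> g (K' z) = z" by metis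
  have "open (K' ` S)" by (rule open_mapping_thm3[OF hol \<open>open S\<close> inj])
  moreover have "0 \<in> K' ` S" using K'_0 r by (force simp: S_def image_iff)
  ultimately obtain d where d: "d > 0" "ball 0 d \<subseteq> K' ` S"
    by (auto simp: open_contains_ball)
  have sp: "saddle_point M X \<alpha> \<tau> = g \<tau>" "g \<tau> \<in> S" "K' (g \<tau>) = \<tau>" if "norm \<tau> < d" for \<tau>
  proof -
    have "\<tau> \<in> K' ` S" using that d by auto
    then obtain z where z: "z \<in> S" "\<tau> = K' z" by auto
    then have gz: "g \<tau> = z" using g by simp
    show "saddle_point M X \<alpha> \<tau> = g \<tau>"
      unfolding gz by (rule saddle_point_eqI) (use z S in auto)
    show "g \<tau> \<in> S" "K' (g \<tau>) = \<tau>" using gz z by auto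
  qed
  show ?thesis
  proof (rule that[OF d(1)])
    have "g holomorphic_on ball 0 d" by (rule holomorphic_on_subset[OF g(1) d(2)])
    then show "saddle_point M X \<alpha> holomorphic_on ball 0 d"
      by (rule holomorphic_transform) (simp add: sp)
    show "norm (saddle_point M X \<alpha> \<tau>) < r" "K' (saddle_point M X \<alpha> \<tau>) = \<tau>" if "norm \<tau> < d" for \<tau>
      using sp[OF that] by (auto simp: S_def)
  qed
qed

text \<open>The conjugate of the saddle point solves the same equation when the right-hand side is real.\<close>

lemma saddle_point_real:
  assumes "norm (saddle_point M X \<alpha> (of_real t)) \<le> \<alpha> ^ 3 / 16"
    and "K' (saddle_point M X \<alpha> (of_real t)) = of_real t"
  obtains s where "saddle_point M X \<alpha> (of_real t) = of_real s"
proof -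
  define z where "z = saddle_point M X \<alpha> (of_real t)"
  have "saddle_point M X \<alpha> (of_real t) = cnj z"
    using assms by (intro saddle_point_eqI) (simp_all add: z_def[symmetric] K'_cnj)
  then have "z = of_real (Re z)" by (simp add: z_def[symmetric] complex_eq_iff)
  then show ?thesis using that z_def by metis
qed

lemma cramer_mu_holomorphic:
  assumes "saddle_point M X \<alpha> holomorphic_on ball 0 d"
    and "\<And>\<tau>. norm \<tau> < d \<Longrightarrow> norm (saddle_point M X \<alpha> \<tau>) \<le> \<alpha> ^ 3 / 16"
  shows "cramer_mu M X \<alpha> holomorphic_on ball 0 d"
proof -
  have "(K'' \<circ> saddle_point M X \<alpha>) holomorphic_on ball 0 d"
    by (rule holomorphic_on_compose_gen[OF assms(1) K''_holomorphic]) (use assms(2) radius_less in auto)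
  then have "(\<lambda>\<tau>. Ln (K'' (saddle_point M X \<alpha> \<tau>)) / 2) holomorphic_on ball 0 d"
    using Re_K''_bounds(1)[OF assms(2)]
    by (intro holomorphic_intros) (force simp: o_def complex_nonpos_Reals_iff)+
  then show ?thesis
    by (rule holomorphic_transform) (use assms(2) radius_less in \<open>auto simp: cramer_mu_def deriv_deriv_K\<close>)
qed

lemma cramer_mu_0: "cramer_mu M X \<alpha> 0 = 0"
  using \<alpha>_pos by (simp add: cramer_mu_def saddle_point_0 deriv_deriv_K K''_0)

lemma exp_minus_cramer_mu:
  assumes sp: "saddle_point M X \<alpha> \<tau> = of_real s" and s: "\<bar>s\<bar> \<le> \<alpha> ^ 3 / 16"
  shows "exp (- cramer_mu M X \<alpha> \<tau>) = of_real (1 / sqrt (Re (K'' (of_real s))))"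
proof -
  define v where "v = Re (K'' (of_real s))"
  have v: "v > 0" using Re_K''_bounds(1)[of "of_real s"] s by (simp add: v_def)
  have "cramer_mu M X \<alpha> \<tau> = Ln (of_real v) / 2"
    unfolding cramer_mu_def sp using s radius_less[of "of_real s"] K''_of_real[of s]
    by (simp add: deriv_deriv_K v_def)
  also have "\<dots> = of_real (ln (sqrt v))"
    using v by (simp add: Ln_of_real ln_sqrt)
  finally show ?thesis using v unfolding v_def[symmetric] by (simp add: exp_minus exp_of_real inverse_eq_divide)
qed

text \<open>For \<open>\<tau> \<noteq> 0\<close> the power of \<open>\<tau>\<close> cancels the denominator in the definition of
  \<^const>\<open>cramer_lambda\<close>. At \<open>\<tau> = 0\<close> the saddle point is 0, and both sides vanish since \<open>K 0 = 0\<close>.\<close>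

lemma exp_cramer_lambda:
  assumes sp: "saddle_point M X \<alpha> \<tau> = z" and z: "norm z < \<alpha>"
  shows "\<tau> ^ 3 * cramer_lambda M X \<alpha> \<tau> = K z - \<tau> * z + \<tau>\<^sup>2 / 2"
proof (cases "\<tau> = 0")
  case True
  then have "z = 0" using sp saddle_point_0 by simp
  then show ?thesis using True K_0 by simp
next
  case False
  then show ?thesis by (simp add: cramer_lambda_def cramer_quotient_def sp)
qed

end

section \<open>Tilted laws of normalised sums\<close>

context standardised_exp_moments
begin

lemma norm_moment_0_le_real:
  assumes "\<bar>s\<bar> < \<alpha>"
  shows "norm (moment 0 (of_real s + \<i> * of_real t)) \<le> Re (moment 0 (of_real s))"
proof -
  have int: "complex_integrable M (\<lambda>\<omega>. exp (of_real s * of_real (X \<omega>)))"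
    using moment_integrable[of "of_real s" 0] assms by simp
  have "norm (moment 0 (of_real s + \<i> * of_real t)) \<le> expectation (\<lambda>\<omega>. norm (exp ((of_real s + \<i> * of_real t) * of_real (X \<omega>))))"
    unfolding moment_def power_0 mult_1_left by (rule integral_norm_bound)
  also have "\<dots> = expectation (\<lambda>\<omega>. Re (exp (of_real s * of_real (X \<omega>))))"
    by (simp add: norm_exp_eq_Re Re_exp)
  also have "\<dots> = Re (moment 0 (of_real s))"
    using int by (simp add: moment_def)
  finally show ?thesis .
qed

lemma real_distribution_distr: "real_distribution (distr M borel X)"
  using prob_space_distr[OF X] by (simp add: real_distribution_def real_distribution_axioms_def)

lemma char_distr_eq_moment: "char (distr M borel X) t = moment 0 (\<i> * of_real t)"
  unfolding char_def moment_def by (subst integral_distr) (auto simp: mult_ac)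

end

locale iid_sums = standardised_exp_moments M X \<alpha> + N: prob_space N
  for M :: "'a measure" and X :: "'a \<Rightarrow> real" and \<alpha> :: real and N :: "'b measure" +
  fixes Xs :: "nat \<Rightarrow> 'b \<Rightarrow> real"
  assumes indep: "N.indep_vars (\<lambda>_. borel) Xs {1..}"
    and same_law: "\<And>k. k \<ge> 1 \<Longrightarrow> distr N borel (Xs k) = distr M borel X"
begin

lemma Xs_measurable: "k \<ge> 1 \<Longrightarrow> Xs k \<in> borel_measurable N"
  using indep by (simp add: N.indep_vars_def)

lemma norm_sum_measurable [measurable]: "norm_sum Xs n \<in> borel_measurable N"
  unfolding norm_sum_def[abs_def] using Xs_measurable by (intro borel_measurable_divide borel_measurable_sum) auto

lemma sqrt_mult_norm_sum: "n \<ge> 1 \<Longrightarrow> sqrt (real n) * norm_sum Xs n \<omega> = (\<Sum>k=1..n. Xs k \<omega>)"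
  by (simp add: norm_sum_def)

text \<open>Independence, in the form that covers real tilts and frequencies at once.\<close>

lemma laplace_norm_sum:
  assumes z: "\<bar>Re z\<bar> < \<alpha>" and n: "n \<ge> 1"
  shows "complex_integrable N (\<lambda>\<omega>. exp (z * of_real (sqrt (real n) * norm_sum Xs n \<omega>)))"
    and "(CLINT \<omega>|N. exp (z * of_real (sqrt (real n) * norm_sum Xs n \<omega>))) = moment 0 z ^ n"
proof -
  have int: "complex_integrable N (\<lambda>\<omega>. exp (z * of_real (Xs k \<omega>)))"
    and eq: "(CLINT \<omega>|N. exp (z * of_real (Xs k \<omega>))) = moment 0 z" if k: "k \<in> {1..n}" for k
  proof -
    have [measurable]: "Xs k \<in> borel_measurable N" using k by (intro Xs_measurable) auto
    have law: "distr N borel (Xs k) = distr M borel X" using k by (intro same_law) auto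
    have "complex_integrable (distr M borel X) (\<lambda>x. exp (z * of_real x))"
      using moment_integrable[OF z, of 0] by (subst integrable_distr_eq) auto
    then show "complex_integrable N (\<lambda>\<omega>. exp (z * of_real (Xs k \<omega>)))"
      unfolding law[symmetric] by (subst (asm) integrable_distr_eq) auto
    have "(CLINT \<omega>|N. exp (z * of_real (Xs k \<omega>))) = (CLINT x|distr N borel (Xs k). exp (z * of_real x))"
      by (subst integral_distr) auto
    also have "\<dots> = moment 0 z"
      unfolding law by (subst integral_distr) (auto simp: moment_def)
    finally show "(CLINT \<omega>|N. exp (z * of_real (Xs k \<omega>))) = moment 0 z" .
  qed
  have "N.indep_vars (\<lambda>_. borel) Xs {1..n}"
    by (rule N.indep_vars_subset[OF indep]) auto
  then have ind: "N.indep_vars (\<lambda>_. borel) (\<lambda>k \<omega>. exp (z * of_real (Xs k \<omega>))) {1..n}"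
    by (rule N.indep_vars_compose2) auto
  have prod: "exp (z * of_real (sqrt (real n) * norm_sum Xs n \<omega>)) = (\<Prod>k\<in>{1..n}. exp (z * of_real (Xs k \<omega>)))" for \<omega>
    unfolding sqrt_mult_norm_sum[OF n] by (simp add: sum_distrib_left exp_sum)
  show "complex_integrable N (\<lambda>\<omega>. exp (z * of_real (sqrt (real n) * norm_sum Xs n \<omega>)))"
    unfolding prod by (rule N.indep_vars_integrable[OF _ ind]) (auto intro: int)
  have "(CLINT \<omega>|N. exp (z * of_real (sqrt (real n) * norm_sum Xs n \<omega>))) = (\<Prod>k\<in>{1..n}. CLINT \<omega>|N. exp (z * of_real (Xs k \<omega>)))"
    unfolding prod by (rule N.indep_vars_lebesgue_integral[OF _ ind]) (auto intro: int)
  also have "\<dots> = moment 0 z ^ n" using eq by simp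
  finally show "(CLINT \<omega>|N. exp (z * of_real (sqrt (real n) * norm_sum Xs n \<omega>))) = moment 0 z ^ n" .
qed

text \<open>The density of the Esscher transform with parameter \<open>s\<close> of the law of the sum, expressed as a
  function of the normalised sum.\<close>

definition tilt_weight :: "nat \<Rightarrow> real \<Rightarrow> real \<Rightarrow> real" where
  "tilt_weight n s y = exp (s * sqrt (real n) * y) / Re (moment 0 (of_real s)) ^ n"

definition tilted_law :: "nat \<Rightarrow> real \<Rightarrow> real measure" where
  "tilted_law n s = density (distr N borel (norm_sum Xs n)) (\<lambda>y. ennreal (tilt_weight n s y))"

definition tilted_char :: "nat \<Rightarrow> real \<Rightarrow> real \<Rightarrow> complex" where
  "tilted_char n s t = (moment 0 (of_real s + \<i> * of_real (t / sqrt (real n))) / moment 0 (of_real s)) ^ n"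

lemma tilt_weight_measurable [measurable]: "tilt_weight n s \<in> borel_measurable borel"
  unfolding tilt_weight_def by measurable

lemma tilt_weight_pos:
  assumes "\<bar>s\<bar> < \<alpha>"
  shows "tilt_weight n s y > 0"
  using laplace_real_ge_1[OF assms] by (simp add: tilt_weight_def)

lemma integral_tilt_weight_iexp:
  assumes s: "\<bar>s\<bar> < \<alpha>" and n: "n \<ge> 1"
  shows "complex_integrable N (\<lambda>\<omega>. tilt_weight n s (norm_sum Xs n \<omega>) *\<^sub>R iexp (t * norm_sum Xs n \<omega>))"
    and "(CLINT \<omega>|N. tilt_weight n s (norm_sum Xs n \<omega>) *\<^sub>R iexp (t * norm_sum Xs n \<omega>)) = tilted_char n s t"
proof -
  define l where "l = moment 0 (of_real s)"
  have l: "l = of_real (Re l)" unfolding l_def by (rule moment_of_real)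
  define z where "z = of_real s + \<i> * of_real (t / sqrt (real n))"
  have z: "\<bar>Re z\<bar> < \<alpha>" using s by (simp add: z_def)
  have eq: "tilt_weight n s y *\<^sub>R iexp (t * y) = exp (z * of_real (sqrt (real n) * y)) / l ^ n" for y
  proof -
    have "z * of_real (sqrt (real n) * y) = of_real (s * sqrt (real n) * y) + \<i> * of_real (t * y)"
      using n by (simp add: z_def algebra_simps)
    then have "exp (z * of_real (sqrt (real n) * y)) = of_real (exp (s * sqrt (real n) * y)) * iexp (t * y)"
      by (simp only: exp_add exp_of_real)
    then show ?thesis
      by (subst l) (simp only: tilt_weight_def l_def[symmetric] scaleR_conv_of_real of_real_divide of_real_power times_divide_eq_left)
  qed
  show "complex_integrable N (\<lambda>\<omega>. tilt_weight n s (norm_sum Xs n \<omega>) *\<^sub>R iexp (t * norm_sum Xs n \<omega>))"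
    unfolding eq using laplace_norm_sum(1)[OF z n] by simp
  have "(CLINT \<omega>|N. tilt_weight n s (norm_sum Xs n \<omega>) *\<^sub>R iexp (t * norm_sum Xs n \<omega>))
      = (CLINT \<omega>|N. exp (z * of_real (sqrt (real n) * norm_sum Xs n \<omega>))) / l ^ n"
    unfolding eq by simp
  also have "\<dots> = tilted_char n s t"
    unfolding laplace_norm_sum(2)[OF z n] by (simp add: tilted_char_def z_def l_def power_divide)
  finally show "(CLINT \<omega>|N. tilt_weight n s (norm_sum Xs n \<omega>) *\<^sub>R iexp (t * norm_sum Xs n \<omega>)) = tilted_char n s t" .
qed

lemma real_distribution_tilted_law:
  assumes s: "\<bar>s\<bar> < \<alpha>" and n: "n \<ge> 1"
  shows "real_distribution (tilted_law n s)"
proof -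
  have l: "moment 0 (of_real s) \<noteq> 0"
    using moment_0_nonzero[of "of_real s"] s by simp
  have int: "complex_integrable N (\<lambda>\<omega>. of_real (tilt_weight n s (norm_sum Xs n \<omega>)))"
    using integral_tilt_weight_iexp(1)[OF s n, of 0] by (simp add: scaleR_conv_of_real)
  have int': "integrable N (\<lambda>\<omega>. tilt_weight n s (norm_sum Xs n \<omega>))"
    using integrable_Re[OF int] by simp
  have "complex_of_real (LINT \<omega>|N. tilt_weight n s (norm_sum Xs n \<omega>)) = (CLINT \<omega>|N. of_real (tilt_weight n s (norm_sum Xs n \<omega>)))"
    by (rule integral_complex_of_real[symmetric])
  also have "\<dots> = 1"
    using integral_tilt_weight_iexp(2)[OF s n, of 0] l by (simp add: scaleR_conv_of_real tilted_char_def)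
  finally have one: "(LINT \<omega>|N. tilt_weight n s (norm_sum Xs n \<omega>)) = 1" by simp
  have "emeasure (tilted_law n s) (space (tilted_law n s)) = (\<integral>\<^sup>+y. ennreal (tilt_weight n s y) \<partial>distr N borel (norm_sum Xs n))"
    unfolding tilted_law_def by (simp add: emeasure_density)
  also have "\<dots> = (\<integral>\<^sup>+\<omega>. ennreal (tilt_weight n s (norm_sum Xs n \<omega>)) \<partial>N)"
    by (rule nn_integral_distr) measurable
  also have "\<dots> = ennreal (LINT \<omega>|N. tilt_weight n s (norm_sum Xs n \<omega>))"
    using tilt_weight_pos[OF s] by (intro nn_integral_eq_integral[OF int']) (simp add: less_imp_le)
  finally have "prob_space (tilted_law n s)"
    using one by (intro prob_spaceI) simp
  then show ?thesis
    by (simp add: real_distribution_def real_distribution_axioms_def tilted_law_def)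
qed

lemma char_tilted_law:
  assumes s: "\<bar>s\<bar> < \<alpha>" and n: "n \<ge> 1"
  shows "char (tilted_law n s) = tilted_char n s"
proof
  fix t
  have "char (tilted_law n s) t = (CLINT y|distr N borel (norm_sum Xs n). tilt_weight n s y *\<^sub>R iexp (t * y))"
    unfolding char_def tilted_law_def
    using tilt_weight_pos[OF s] by (intro integral_density) (auto simp: less_imp_le)
  also have "\<dots> = (CLINT \<omega>|N. tilt_weight n s (norm_sum Xs n \<omega>) *\<^sub>R iexp (t * norm_sum Xs n \<omega>))"
    by (rule integral_distr) measurable
  finally show "char (tilted_law n s) t = tilted_char n s t"
    using integral_tilt_weight_iexp(2)[OF s n] by simp
qed

lemma tilted_law_0: "tilted_law n 0 = distr N borel (norm_sum Xs n)"
  unfolding tilted_law_def by (simp add: tilt_weight_def moment_0_0 density_1)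

context
  fixes n :: nat
  assumes n: "n \<ge> 1"
begin

lemma cont_density_eq:
  assumes int: "integrable lborel (tilted_char n 0)"
  shows "cont_density N (norm_sum Xs n) = inverse_fourier_density (tilted_char n 0)"
    and "bounded_density N (norm_sum Xs n) (inverse_fourier_density (tilted_char n 0))"
proof -
  define f where "f = inverse_fourier_density (tilted_char n 0)"
  have z: "\<bar>0 :: real\<bar> < \<alpha>" using \<alpha>_pos by simp
  note ch = char_tilted_law[OF z n]
  interpret P: real_distribution "tilted_law n 0" by (rule real_distribution_tilted_law[OF z n])
  have dens: "distr N lborel (norm_sum Xs n) = density lborel (\<lambda>x. ennreal (f x))"
  proof -
    have "tilted_law n 0 = density lborel (\<lambda>x. ennreal (f x))"
      unfolding f_def by (rule P.density_inverse_fourier[unfolded ch, OF int])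
    then show ?thesis
      unfolding tilted_law_0 by (simp cong: distr_cong)
  qed
  have cont: "continuous_on UNIV f"
    unfolding f_def by (rule continuous_inverse_fourier_density[OF int])
  have nonneg: "f x \<ge> 0" for x
    using P.inverse_fourier_density_nonneg int unfolding ch f_def by simp
  have [measurable]: "f \<in> borel_measurable borel" using cont by (rule borel_measurable_continuous_onI)
  show bd: "bounded_density N (norm_sum Xs n) (inverse_fourier_density (tilted_char n 0))"
    unfolding f_def[symmetric] bounded_density_def distributed_def
    using nonneg dens bounded_inverse_fourier_density[OF int, folded f_def] by auto
  show "cont_density N (norm_sum Xs n) = inverse_fourier_density (tilted_char n 0)"
    unfolding cont_density_def f_def[symmetric]
  proof (rule the_equality)
    show "bounded_density N (norm_sum Xs n) f \<and> continuous_on UNIV f"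
      using bd cont by (simp add: f_def)
    fix g assume g: "bounded_density N (norm_sum Xs n) g \<and> continuous_on UNIV g"
    then have "density lborel (\<lambda>x. ennreal (g x)) = density lborel (\<lambda>x. ennreal (f x))"
      using dens by (simp add: bounded_density_def distributed_def)
    then show "g = f"
      using g cont nonneg by (intro continuous_density_unique) (auto simp: bounded_density_def)
  qed
qed

text \<open>Tilting replaces the shift of the inversion contour to the line with real part \<open>s\<close>: the tilted
  law has the weighted density, and Fourier inversion applied to the tilted law gives a second
  continuous density of it.\<close>

lemma cont_density_tilt:
  assumes s: "\<bar>s\<bar> < \<alpha>"
    and int0: "integrable lborel (tilted_char n 0)" and ints: "integrable lborel (tilted_char n s)"
  shows "tilt_weight n s x * cont_density N (norm_sum Xs n) x = inverse_fourier_density (tilted_char n s) x"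
proof -
  define f where "f = inverse_fourier_density (tilted_char n 0)"
  define g where "g = inverse_fourier_density (tilted_char n s)"
  have z: "\<bar>0 :: real\<bar> < \<alpha>" using \<alpha>_pos by simp
  interpret P: real_distribution "tilted_law n 0" by (rule real_distribution_tilted_law[OF z n])
  interpret S: real_distribution "tilted_law n s" by (rule real_distribution_tilted_law[OF s n])
  have f: "continuous_on UNIV f" "\<And>x. f x \<ge> 0" "tilted_law n 0 = density lborel (\<lambda>x. ennreal (f x))"
    using P.density_inverse_fourier P.inverse_fourier_density_nonneg continuous_inverse_fourier_density int0
    unfolding char_tilted_law[OF z n] f_def by auto
  have g: "continuous_on UNIV g" "\<And>x. g x \<ge> 0" "tilted_law n s = density lborel (\<lambda>x. ennreal (g x))"
    using S.density_inverse_fourier S.inverse_fourier_density_nonneg continuous_inverse_fourier_density ints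
    unfolding char_tilted_law[OF s n] g_def by auto
  have [measurable]: "f \<in> borel_measurable borel" using f(1) by (rule borel_measurable_continuous_onI)
  have "tilted_law n s = density (density lborel (\<lambda>x. ennreal (f x))) (\<lambda>y. ennreal (tilt_weight n s y))"
    unfolding f(3)[symmetric] tilted_law_0 by (simp add: tilted_law_def)
  also have "\<dots> = density lborel (\<lambda>x. ennreal (tilt_weight n s x * f x))"
    using f(2) by (subst density_density_eq) (auto simp: ennreal_mult[symmetric] less_imp_le tilt_weight_pos[OF s] mult.commute)
  finally have "density lborel (\<lambda>x. ennreal (tilt_weight n s x * f x)) = density lborel (\<lambda>x. ennreal (g x))"
    using g(3) by simp
  moreover have "continuous_on UNIV (\<lambda>x. tilt_weight n s x * f x)"
    unfolding tilt_weight_def using laplace_real_ge_1[OF s] by (intro continuous_intros f) auto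
  moreover have "tilt_weight n s x * f x \<ge> 0" for x
    using f(2) tilt_weight_pos[OF s, of n x] by simp
  ultimately have "(\<lambda>x. tilt_weight n s x * f x) = g"
    using g by (intro continuous_density_unique) auto
  then show ?thesis
    unfolding cont_density_eq(1)[OF int0] f_def[symmetric] g_def[symmetric] by (rule fun_cong)
qed

end

text \<open>Plancherel's inequality for the density of the tilted sum of \<open>n0\<close> terms. Its square is at most
  the bound of the given density times a density tilted by \<open>2 * s\<close>, whose total mass is controlled
  since \<open>2 * \<bar>s\<bar> < \<alpha>\<close>. The parameter \<open>c\<close> scales the frequency; it will be \<open>sqrt n\<close>.\<close>

lemma laplace_power_integrable:
  assumes dens: "bounded_density N (norm_sum Xs n0) f" and n0: "n0 \<ge> 1"
  obtains C where "C > 0"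
    "\<And>s c. \<bar>s\<bar> \<le> \<alpha> / 4 \<Longrightarrow> c > 0 \<Longrightarrow>
        integrable lborel (\<lambda>t. norm (moment 0 (of_real s + \<i> * of_real (t / c))) ^ (2 * n0))"
    "\<And>s c. \<bar>s\<bar> \<le> \<alpha> / 4 \<Longrightarrow> c > 0 \<Longrightarrow>
        (LBINT t. norm (moment 0 (of_real s + \<i> * of_real (t / c))) ^ (2 * n0)) \<le> C * c"
proof -
  have f0: "\<And>x. f x \<ge> 0" and f: "distr N lborel (norm_sum Xs n0) = density lborel (\<lambda>x. ennreal (f x))"
    and fe: "(\<lambda>x. ennreal (f x)) \<in> borel_measurable borel" and bdd: "bounded (range f)"
    using dens by (auto simp: bounded_density_def distributed_def)
  have [measurable]: "f \<in> borel_measurable borel"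
  proof -
    have "(\<lambda>x. enn2real (ennreal (f x))) \<in> borel_measurable borel" using fe by measurable
    then show ?thesis using f0 by simp
  qed
  obtain B where B: "B > 0" "\<And>x. f x \<le> B"
    using bdd by (auto simp: bounded_pos) (meson abs_le_D1)
  define r where "r = sqrt (real n0)"
  have r: "r > 0" using n0 by (simp add: r_def)
  have tr: "complex_integrable lborel (\<lambda>y. f y *\<^sub>R exp (z * of_real (r * y)))"
    "(CLBINT y. f y *\<^sub>R exp (z * of_real (r * y))) = moment 0 z ^ n0" if z: "\<bar>Re z\<bar> < \<alpha>" for z
  proof -
    have "complex_integrable (distr N lborel (norm_sum Xs n0)) (\<lambda>y. exp (z * of_real (r * y)))"
      using laplace_norm_sum(1)[OF z n0] unfolding r_def by (subst integrable_distr_eq) auto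
    then show "complex_integrable lborel (\<lambda>y. f y *\<^sub>R exp (z * of_real (r * y)))"
      unfolding f using f0 by (subst (asm) integrable_density) auto
    have "(CLBINT y. f y *\<^sub>R exp (z * of_real (r * y))) = (CLINT y|distr N lborel (norm_sum Xs n0). exp (z * of_real (r * y)))"
      unfolding f using f0 by (subst integral_density) auto
    also have "\<dots> = (CLINT \<omega>|N. exp (z * of_real (r * norm_sum Xs n0 \<omega>)))"
      by (rule integral_distr) auto
    finally show "(CLBINT y. f y *\<^sub>R exp (z * of_real (r * y))) = moment 0 z ^ n0"
      using laplace_norm_sum(2)[OF z n0] unfolding r_def by simp
  qed
  have tr_real: "integrable lborel (\<lambda>y. f y * exp (s * r * y))"
    "(LBINT y. f y * exp (s * r * y)) = Re (moment 0 (of_real s)) ^ n0" if s: "\<bar>s\<bar> < \<alpha>" for s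
  proof -
    have z: "\<bar>Re (of_real s)\<bar> < \<alpha>" using s by simp
    have eq: "f y *\<^sub>R exp (of_real s * of_real (r * y)) = complex_of_real (f y * exp (s * r * y))" for y
      by (simp add: scaleR_conv_of_real mult.assoc exp_of_real[symmetric])
    show "integrable lborel (\<lambda>y. f y * exp (s * r * y))"
      using integrable_Re[OF tr(1)[OF z]] unfolding eq by simp
    have "complex_of_real (LBINT y. f y * exp (s * r * y)) = moment 0 (of_real s) ^ n0"
      using tr(2)[OF z] unfolding eq integral_complex_of_real .
    also have "\<dots> = of_real (Re (moment 0 (of_real s)) ^ n0)"
      unfolding of_real_power moment_of_real[symmetric] ..
    finally show "(LBINT y. f y * exp (s * r * y)) = Re (moment 0 (of_real s)) ^ n0"
      unfolding of_real_eq_iff .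
  qed
  have main: "integrable lborel (\<lambda>t. norm (moment 0 (of_real s + \<i> * of_real (t / r))) ^ (2 * n0))"
    "(LBINT t. norm (moment 0 (of_real s + \<i> * of_real (t / r))) ^ (2 * n0)) \<le> 2 * pi * (B * 2 ^ n0)"
    if s: "\<bar>s\<bar> \<le> \<alpha> / 4" for s
  proof -
    have s1: "\<bar>s\<bar> < \<alpha>" "\<bar>2 * s\<bar> < \<alpha>" using s \<alpha>_pos by auto
    define q where "q y = f y * exp (s * r * y)" for y
    have q0: "q y \<ge> 0" for y using f0 by (simp add: q_def)
    have iq: "integrable lborel q" unfolding q_def by (rule tr_real(1)[OF s1(1)])
    have q2le: "(q y)\<^sup>2 \<le> B * (f y * exp (2 * s * r * y))" for y
    proof -
      have "(q y)\<^sup>2 = f y * (f y * exp (2 * s * r * y))"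
        by (simp add: q_def power2_eq_square mult_ac flip: exp_add)
      also have "\<dots> \<le> B * (f y * exp (2 * s * r * y))"
        using B f0 by (intro mult_right_mono) auto
      finally show ?thesis .
    qed
    have iB: "integrable lborel (\<lambda>y. B * (f y * exp (2 * s * r * y)))"
      using tr_real(1)[OF s1(2)] by simp
    have iq2: "integrable lborel (\<lambda>y. (q y)\<^sup>2)"
      by (rule Bochner_Integration.integrable_bound[OF iB])
         (use q2le iq in \<open>auto simp: q_def intro: order_trans[OF _ abs_ge_self]\<close>)
    have "(LBINT y. (q y)\<^sup>2) \<le> (LBINT y. B * (f y * exp (2 * s * r * y)))"
      by (rule integral_mono[OF iq2 iB q2le])
    also have "\<dots> = B * Re (moment 0 (of_real (2 * s))) ^ n0"
      using tr_real(2)[OF s1(2)] by simp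
    also have "\<dots> \<le> B * 2 ^ n0"
    proof -
      have "norm (moment 0 (of_real (2 * s)) - 1) \<le> norm (complex_of_real (2 * s)) / \<alpha>"
        by (rule norm_laplace_minus_one_le) (use s1 in simp)
      also have "\<dots> \<le> 1" using s1 \<alpha>_pos by simp
      finally have "Re (moment 0 (of_real (2 * s))) \<le> 2"
        using complex_Re_le_cmod[of "moment 0 (of_real (2 * s)) - 1"] by simp
      then show ?thesis
        using B laplace_real_ge_1[OF s1(2)] by (intro mult_left_mono power_mono) auto
    qed
    finally have q2: "(LBINT y. (q y)\<^sup>2) \<le> B * 2 ^ n0" .
    have F: "norm (CLBINT y. iexp (t * y) * q y) ^ 2 = norm (moment 0 (of_real s + \<i> * of_real (t / r))) ^ (2 * n0)" for t
    proof -
      have "(CLBINT y. iexp (t * y) * q y) = (CLBINT y. f y *\<^sub>R exp ((of_real s + \<i> * of_real (t / r)) * of_real (r * y)))"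
      proof (rule Bochner_Integration.integral_cong)
        fix y
        have "(of_real s + \<i> * of_real (t / r)) * of_real (r * y) = of_real (s * r * y) + \<i> * of_real (t * y)"
          using r by (simp add: algebra_simps)
        then have "exp ((of_real s + \<i> * of_real (t / r)) * of_real (r * y)) = of_real (exp (s * r * y)) * iexp (t * y)"
          by (simp only: exp_add exp_of_real)
        then show "iexp (t * y) * q y = f y *\<^sub>R exp ((of_real s + \<i> * of_real (t / r)) * of_real (r * y))"
          by (simp only: q_def scaleR_conv_of_real of_real_mult mult_ac)
      qed simp
      also have "\<dots> = moment 0 (of_real s + \<i> * of_real (t / r)) ^ n0"
        using s1 by (intro tr(2)) simp
      finally show ?thesis by (simp add: norm_power power_mult[symmetric] mult.commute)
    qed
    show "integrable lborel (\<lambda>t. norm (moment 0 (of_real s + \<i> * of_real (t / r))) ^ (2 * n0))"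
      using plancherel_inequality(1)[OF q0 iq iq2] unfolding F .
    have "(LBINT t. norm (moment 0 (of_real s + \<i> * of_real (t / r))) ^ (2 * n0)) \<le> 2 * pi * (LBINT y. (q y)\<^sup>2)"
      using plancherel_inequality(2)[OF q0 iq iq2] unfolding F .
    also have "\<dots> \<le> 2 * pi * (B * 2 ^ n0)" using q2 by (intro mult_left_mono) auto
    finally show "(LBINT t. norm (moment 0 (of_real s + \<i> * of_real (t / r))) ^ (2 * n0)) \<le> 2 * pi * (B * 2 ^ n0)" .
  qed
  show ?thesis
  proof (rule that[of "2 * pi * (B * 2 ^ n0) / r"])
    show "2 * pi * (B * 2 ^ n0) / r > 0" using B r by simp
  next
    fix s c :: real assume s: "\<bar>s\<bar> \<le> \<alpha> / 4" and c: "c > 0"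
    define g where "g t = norm (moment 0 (of_real s + \<i> * of_real (t / r))) ^ (2 * n0)" for t
    have eq: "(\<lambda>t. norm (moment 0 (of_real s + \<i> * of_real (t / c))) ^ (2 * n0)) = (\<lambda>t. g (0 + (r / c) * t))"
      using r by (simp add: g_def fun_eq_iff)
    have ig: "integrable lborel g" unfolding g_def by (rule main(1)[OF s])
    show "integrable lborel (\<lambda>t. norm (moment 0 (of_real s + \<i> * of_real (t / c))) ^ (2 * n0))"
      unfolding eq using r c by (intro lborel_integrable_real_affine[OF ig]) simp
    have "(LBINT t. g t) = (r / c) * (LBINT t. g (0 + (r / c) * t))"
      using lborel_integral_real_affine[of "r / c" g 0] r c by simp
    then have "(LBINT t. g (0 + (r / c) * t)) = (LBINT t. g t) * c / r"
      using r c by (simp add: field_simps)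
    also have "\<dots> \<le> (2 * pi * (B * 2 ^ n0)) * c / r"
      using main(2)[OF s] r c unfolding g_def by (intro divide_right_mono mult_right_mono) auto
    finally show "(LBINT t. norm (moment 0 (of_real s + \<i> * of_real (t / c))) ^ (2 * n0)) \<le> 2 * pi * (B * 2 ^ n0) / r * c"
      unfolding eq by simp
  qed
qed

text \<open>On the imaginary axis this is Cramer's condition; on vertical lines close to it, the Laplace
  transform differs by a small amount uniformly in the frequency.\<close>

lemma laplace_away_from_real_axis:
  assumes int: "integrable lborel (\<lambda>t. norm (moment 0 (\<i> * of_real t)) ^ m)" and \<delta>: "\<delta> > 0"
  obtains s0 \<rho> where "0 < s0" "0 < \<rho>" "\<rho> < 1"
    "\<And>s t. \<bar>s\<bar> \<le> s0 \<Longrightarrow> \<delta> \<le> \<bar>t\<bar> \<Longrightarrow> norm (moment 0 (of_real s + \<i> * of_real t)) \<le> \<rho>"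
proof -
  interpret P: real_distribution "distr M borel X" by (rule real_distribution_distr)
  have "integrable (distr M borel X) (\<lambda>x. x)"
    using integrable_X by (subst integrable_distr_eq) auto
  moreover have "integrable lborel (\<lambda>t. norm (char (distr M borel X) t) ^ m)"
    unfolding char_distr_eq_moment by (rule int)
  ultimately obtain \<rho> where \<rho>: "\<rho> < 1" "\<rho> > 0" "\<And>t. \<delta> \<le> \<bar>t\<bar> \<Longrightarrow> norm (moment 0 (\<i> * of_real t)) \<le> \<rho>"
    using P.char_away_from_zero[OF _ _ \<delta>, of m] unfolding char_distr_eq_moment by blast
  \<comment> \<open>Moving by \<open>s0\<close> off the imaginary axis uses up half of the gap between \<open>\<rho>\<close> and 1.\<close>
  define s0 where "s0 = \<alpha> * (1 - \<rho>) / 2"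
  have s0: "s0 > 0" "s0 < \<alpha>" using \<rho> \<alpha>_pos by (auto simp: s0_def field_simps intro: add_pos_pos mult_pos_pos)
  show ?thesis
  proof (rule that[of s0 "(1 + \<rho>) / 2"])
    fix s t :: real assume s: "\<bar>s\<bar> \<le> s0" and t: "\<delta> \<le> \<bar>t\<bar>"
    have "norm (moment 0 (\<i> * of_real t + of_real s) - moment 0 (\<i> * of_real t)) \<le> norm (complex_of_real s) / \<alpha>"
      by (rule norm_moment_shift_le) (use s s0 \<alpha>_pos in auto)
    also have "\<dots> \<le> s0 / \<alpha>" using s \<alpha>_pos by (simp add: divide_right_mono)
    also have "\<dots> = (1 - \<rho>) / 2" using \<alpha>_pos by (simp add: s0_def)
    finally have "norm (moment 0 (\<i> * of_real t + of_real s)) \<le> \<rho> + (1 - \<rho>) / 2"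
      using \<rho>(3)[OF t] norm_triangle_sub[of "moment 0 (\<i> * of_real t + of_real s)" "moment 0 (\<i> * of_real t)"] by linarith
    then show "norm (moment 0 (of_real s + \<i> * of_real t)) \<le> (1 + \<rho>) / 2"
      by (simp add: add.commute field_simps)
  qed (use s0 \<rho> in auto)
qed

end

section \<open>Laplace asymptotics on the saddle line\<close>

lemma one_minus_cos_le: "1 - cos b \<le> b\<^sup>2 / 2" for b :: real
proof -
  have "1 - cos b = 2 * (sin (b / 2))\<^sup>2"
    using cos_double_sin[of "b / 2"] by simp
  also have "\<dots> \<le> 2 * (b / 2)\<^sup>2"
    using abs_sin_x_le_abs_x[of "b / 2"] unfolding abs_le_square_iff by simp
  finally show ?thesis by (simp add: power_divide)
qed

lemma exp_diff_le:
  fixes a g c :: real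
  assumes "a \<le> -c" "g \<le> -c"
  shows "\<bar>exp a - exp g\<bar> \<le> exp (-c) * \<bar>a - g\<bar>"
proof -
  have *: "exp x - exp y \<le> exp (-c) * \<bar>x - y\<bar>" if "x \<le> -c" for x y :: real
  proof -
    have "exp x * (1 + (y - x)) \<le> exp x * exp (y - x)"
      by (intro mult_left_mono exp_ge_add_one_self) auto
    then have "exp x - exp y \<le> exp x * (x - y)" by (simp add: algebra_simps flip: exp_add)
    also have "\<dots> \<le> exp x * \<bar>x - y\<bar>" by (intro mult_left_mono) auto
    also have "\<dots> \<le> exp (-c) * \<bar>x - y\<bar>" using that by (intro mult_right_mono) auto
    finally show ?thesis .
  qed
  show ?thesis
    using *[OF assms(1), of g] *[OF assms(2), of a] by (simp add: abs_le_iff abs_minus_commute)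
qed

text \<open>Here \<open>exp a * cos b\<close> is the real part of \<open>exp (a + \<i> * b)\<close>. The phase \<open>b\<close> enters only
  quadratically, which turns a phase of order \<open>1 / sqrt n\<close> into an error of order \<open>1 / n\<close>.\<close>

lemma exp_cos_gaussian_diff_le:
  fixes a b c g :: real
  assumes "a \<le> -c" "g \<le> -c"
  shows "\<bar>exp a * cos b - exp g\<bar> \<le> exp (-c) * (b\<^sup>2 / 2 + \<bar>a - g\<bar>)"
proof -
  have "exp a * (1 - cos b) \<ge> 0" by simp
  then have "\<bar>exp a * cos b - exp a\<bar> = exp a * (1 - cos b)"
    by (simp add: right_diff_distrib)
  also have "\<dots> \<le> exp (-c) * (b\<^sup>2 / 2)"
    using assms one_minus_cos_le[of b] by (intro mult_mono) auto
  finally have "\<bar>exp a * cos b - exp a\<bar> \<le> exp (-c) * (b\<^sup>2 / 2)" .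
  then have "\<bar>exp a * cos b - exp a\<bar> + \<bar>exp a - exp g\<bar> \<le> exp (-c) * (b\<^sup>2 / 2) + exp (-c) * \<bar>a - g\<bar>"
    by (intro add_mono exp_diff_le assms)
  moreover have "\<bar>exp a * cos b - exp g\<bar> \<le> \<bar>exp a * cos b - exp a\<bar> + \<bar>exp a - exp g\<bar>"
    by linarith
  ultimately show ?thesis unfolding distrib_left by linarith
qed

lemma gaussian_eq_normal_density:
  assumes "v > 0"
  shows "exp (- (v * t\<^sup>2 / 2)) = sqrt (2 * pi / v) * normal_density 0 (1 / sqrt v) t"
  using assms by (simp add: normal_density_def power_divide real_sqrt_divide mult_ac)

lemma integral_gaussian:
  fixes v :: real
  assumes "v > 0"
  shows "integrable lborel (\<lambda>t. exp (- (v * t\<^sup>2 / 2)))"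
    and "(LBINT t. exp (- (v * t\<^sup>2 / 2))) = sqrt (2 * pi / v)"
  unfolding gaussian_eq_normal_density[OF assms] using assms by simp_all

lemma integrable_gaussian_power:
  fixes v :: real
  assumes "v > 0"
  shows "integrable lborel (\<lambda>t. exp (- (v * t\<^sup>2 / 2)) * t ^ k)"
proof -
  have "integrable lborel (\<lambda>t. sqrt (2 * pi / v) * (normal_density 0 (1 / sqrt v) t * (t - 0) ^ k))"
    using assms by (intro integrable_mult_right integrable_normal_moment) simp
  then show ?thesis
    unfolding gaussian_eq_normal_density[OF assms] by (simp add: mult.assoc)
qed

text \<open>\<open>(real n)\<^sup>2 * \<rho> ^ n\<close> is the square of \<open>n * sqrt \<rho> ^ n\<close>, which tends to 0.\<close>

lemma square_mult_power_bounded: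
  fixes \<rho> :: real
  assumes "0 < \<rho>" "\<rho> < 1"
  obtains D where "D > 0" "\<And>n. (real n)\<^sup>2 * \<rho> ^ n \<le> D"
proof -
  have "(\<lambda>n. real n * sqrt \<rho> ^ n) \<longlonglongrightarrow> 0"
    using assms by (intro powser_times_n_limit_0) auto
  then have "Bseq (\<lambda>n. real n * sqrt \<rho> ^ n)" by (intro convergent_imp_Bseq) (auto simp: convergent_def)
  then obtain B where B: "B > 0" "\<And>n. \<bar>real n * sqrt \<rho> ^ n\<bar> \<le> B"
    by (auto simp: Bseq_def)
  have "(real n)\<^sup>2 * \<rho> ^ n \<le> B\<^sup>2" for n
  proof -
    have "(real n)\<^sup>2 * \<rho> ^ n = (real n * sqrt \<rho> ^ n)\<^sup>2"
      using assms by (simp add: power_mult_distrib flip: real_sqrt_power)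
    also have "\<dots> \<le> B\<^sup>2" using power_mono[OF B(2)[of n], of 2] by simp
    finally show ?thesis .
  qed
  then show ?thesis using that[of "B\<^sup>2"] B by simp
qed

context iid_sums
begin

lemma norm_laplace_ratio_le:
  assumes s: "\<bar>s\<bar> < \<alpha>"
  shows "norm (moment 0 (of_real s + \<i> * of_real v) / moment 0 (of_real s)) \<le> 1"
    and "norm (moment 0 (of_real s + \<i> * of_real v) / moment 0 (of_real s)) \<le> norm (moment 0 (of_real s + \<i> * of_real v))"
proof -
  define l where "l = Re (moment 0 (of_real s))"
  have l: "l \<ge> 1" unfolding l_def by (rule laplace_real_ge_1[OF s])
  have nl: "norm (moment 0 (of_real s)) = l"
    using l by (subst moment_of_real) (simp add: l_def)
  show "norm (moment 0 (of_real s + \<i> * of_real v) / moment 0 (of_real s)) \<le> 1"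
    using norm_moment_0_le_real[OF s, of v] l unfolding l_def[symmetric] norm_divide nl by simp
  show "norm (moment 0 (of_real s + \<i> * of_real v) / moment 0 (of_real s)) \<le> norm (moment 0 (of_real s + \<i> * of_real v))"
    using l unfolding norm_divide nl
    by (intro divide_le_eq[THEN iffD2]) (auto simp: mult_left_le mult_le_cancel_left1)
qed

text \<open>The surplus over \<open>2 * n0\<close> of the power of a ratio of modulus at most 1 can be dropped.\<close>

lemma tilted_char_integrable:
  assumes s: "\<bar>s\<bar> < \<alpha>" and n: "n \<ge> 2 * n0" "n \<ge> 1"
    and int: "integrable lborel (\<lambda>t. norm (moment 0 (of_real s + \<i> * of_real (t / sqrt (real n)))) ^ (2 * n0))"
  shows "integrable lborel (tilted_char n s)"
proof (rule Bochner_Integration.integrable_bound[OF int])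
  interpret P: real_distribution "tilted_law n s" by (rule real_distribution_tilted_law[OF s n(2)])
  show "tilted_char n s \<in> borel_measurable lborel"
    using P.char_measurable unfolding char_tilted_law[OF s n(2)] by simp
  have "norm (tilted_char n s t) \<le> norm (moment 0 (of_real s + \<i> * of_real (t / sqrt (real n)))) ^ (2 * n0)" for t
  proof -
    define a where "a = norm (moment 0 (of_real s + \<i> * of_real (t / sqrt (real n))) / moment 0 (of_real s))"
    have "norm (tilted_char n s t) = a ^ n" by (simp only: tilted_char_def norm_power a_def)
    also have "\<dots> \<le> a ^ (2 * n0)"
      using n norm_laplace_ratio_le(1)[OF s] by (intro power_decreasing) (auto simp only: a_def norm_ge_zero)
    also have "\<dots> \<le> norm (moment 0 (of_real s + \<i> * of_real (t / sqrt (real n)))) ^ (2 * n0)"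
      using norm_laplace_ratio_le(2)[OF s] by (intro power_mono) (auto simp only: a_def norm_ge_zero)
    finally show ?thesis .
  qed
  then show "AE t in lborel. norm (tilted_char n s t) \<le> norm (norm (moment 0 (of_real s + \<i> * of_real (t / sqrt (real n)))) ^ (2 * n0))"
    by simp
qed

lemma tilted_char_eq_exp:
  fixes n :: nat and s \<tau> t :: real
  defines "v \<equiv> t / sqrt (real n)"
  assumes n: "n \<ge> 1" and sv: "norm (of_real s + \<i> * of_real v :: complex) < \<alpha>" and s: "\<bar>s\<bar> < \<alpha>"
  shows "iexp (-(t * (sqrt (real n) * \<tau>))) * tilted_char n s t
    = exp (of_nat n * (K (of_real s + \<i> * of_real v) - K (of_real s) - \<i> * of_real v * of_real \<tau>))"
proof -
  have "tilted_char n s t = exp (K (of_real s + \<i> * of_real v) - K (of_real s)) ^ n"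
    unfolding tilted_char_def v_def[symmetric] exp_diff using exp_K[OF sv] exp_K[of "of_real s"] s by simp
  also have "\<dots> = exp (of_nat n * (K (of_real s + \<i> * of_real v) - K (of_real s)))"
    by (simp add: exp_of_nat_mult)
  finally have tc: "tilted_char n s t = exp (of_nat n * (K (of_real s + \<i> * of_real v) - K (of_real s)))" .
  have "real n * (v * \<tau>) = (sqrt (real n) * sqrt (real n)) * (v * \<tau>)" by simp
  also have "\<dots> = (sqrt (real n) * v) * (sqrt (real n) * \<tau>)" by (simp only: mult_ac)
  also have "sqrt (real n) * v = t" using n by (simp add: v_def)
  finally have e: "t * (sqrt (real n) * \<tau>) = real n * (v * \<tau>)" by (rule sym)
  show ?thesis
    unfolding tc e exp_add[symmetric] by (simp add: algebra_simps)
qed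

text \<open>The exponent \<open>n * W\<close> has real part \<open>- \<sigma>2 * t\<^sup>2 / 2\<close> up to order \<open>t ^ 4 / n\<close>, because \<open>W\<close> at
  \<open>-v\<close> is the conjugate of \<open>W\<close> at \<open>v\<close> and the cubic term is purely imaginary, and an imaginary
  part of order \<open>\<bar>t\<bar> ^ 3 / sqrt n\<close>. The condition \<open>C * v\<^sup>2 \<le> 1 / 6\<close> keeps the real part below
  \<open>- t\<^sup>2 / 12\<close>, which provides an integrable factor.\<close>

lemma central_bound:
  fixes n :: nat and s \<tau> t C :: real
  defines "v \<equiv> t / sqrt (real n)" and "\<sigma>2 \<equiv> Re (K'' (of_real s))"
  assumes C: "C > 0"
    and T3: "norm (K (of_real s + \<i> * of_real v) - K (of_real s) - \<i> * of_real v * K' (of_real s)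
        + of_real (v\<^sup>2 / 2) * K'' (of_real s)) \<le> C * \<bar>v\<bar> ^ 3"
    and T4: "norm (K (of_real s + \<i> * of_real v) + K (of_real s - \<i> * of_real v) - 2 * K (of_real s)
        + of_real (v\<^sup>2) * K'' (of_real s)) \<le> C * v ^ 4"
    and n: "n \<ge> 1" and s: "\<bar>s\<bar> < \<alpha>" and sv: "norm (of_real s + \<i> * of_real v :: complex) < \<alpha>"
    and \<tau>: "K' (of_real s) = of_real \<tau>" and v: "C * v\<^sup>2 \<le> 1 / 6" and \<sigma>2: "\<sigma>2 \<ge> 1 / 3"
  shows "\<bar>Re (iexp (-(t * (sqrt (real n) * \<tau>))) * tilted_char n s t) - exp (- (\<sigma>2 * t\<^sup>2 / 2))\<bar>
    \<le> exp (- (t\<^sup>2 / 12)) * (C\<^sup>2 * t ^ 6 / 2 + C * t ^ 4 / 2) / real n"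
proof -
  define W where "W = K (of_real s + \<i> * of_real v) - K (of_real s) - \<i> * of_real v * of_real \<tau>"
  have K''s: "K'' (of_real s) = of_real \<sigma>2" unfolding \<sigma>2_def by (rule K''_of_real)
  have vn: "real n * v\<^sup>2 = t\<^sup>2" using n by (simp add: v_def power_divide)
  have "norm (W + of_real (v\<^sup>2 / 2 * \<sigma>2)) \<le> C * \<bar>v\<bar> ^ 3"
    using T3 unfolding \<tau> K''s W_def by simp
  moreover have "\<bar>Im (W + of_real (v\<^sup>2 / 2 * \<sigma>2))\<bar> \<le> norm (W + of_real (v\<^sup>2 / 2 * \<sigma>2))"
    by (rule abs_Im_le_cmod)
  ultimately have Im: "\<bar>Im W\<bar> \<le> C * \<bar>v\<bar> ^ 3" by simp
  have "K (of_real s - \<i> * of_real v) = cnj (K (of_real s + \<i> * of_real v))"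
    using K_cnj[OF sv] by simp
  moreover have "K (of_real s) = cnj (K (of_real s))"
    using K_cnj[of "of_real s"] s by simp
  ultimately have "K (of_real s + \<i> * of_real v) + K (of_real s - \<i> * of_real v) - 2 * K (of_real s) = of_real (2 * Re W)"
    by (simp add: W_def complex_eq_iff)
  then have "norm (complex_of_real (2 * Re W + v\<^sup>2 * \<sigma>2)) \<le> C * v ^ 4"
    using T4 unfolding K''s by simp
  then have Re: "\<bar>2 * Re W + v\<^sup>2 * \<sigma>2\<bar> \<le> C * v ^ 4" unfolding norm_of_real .
  have "C * v ^ 4 = C * v\<^sup>2 * v\<^sup>2" by (simp add: power4_eq_xxxx power2_eq_square)
  also have "\<dots> \<le> 1 / 6 * v\<^sup>2" using v by (rule mult_right_mono) simp
  finally have "C * v ^ 4 \<le> v\<^sup>2 / 6" by simp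
  moreover have "1 / 3 * v\<^sup>2 \<le> \<sigma>2 * v\<^sup>2" using \<sigma>2 by (rule mult_right_mono) simp
  ultimately have "Re W \<le> - (v\<^sup>2 / 12)" using Re by (simp add: mult.commute abs_le_iff)
  then have "real n * Re W \<le> real n * - (v\<^sup>2 / 12)" by (rule mult_left_mono) simp
  then have a: "real n * Re W \<le> - (t\<^sup>2 / 12)" using vn by simp
  have "1 / 3 * t\<^sup>2 \<le> \<sigma>2 * t\<^sup>2" using \<sigma>2 by (rule mult_right_mono) simp
  then have g: "- (\<sigma>2 * t\<^sup>2 / 2) \<le> - (t\<^sup>2 / 12)" using zero_le_power2[of t] by linarith
  have "iexp (-(t * (sqrt (real n) * \<tau>))) * tilted_char n s t = exp (of_nat n * W)"
    unfolding W_def v_def by (rule tilted_char_eq_exp[OF n sv[unfolded v_def] s])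
  then have "Re (iexp (-(t * (sqrt (real n) * \<tau>))) * tilted_char n s t) = exp (real n * Re W) * cos (real n * Im W)"
    by (simp only: Re_exp) simp
  then have "\<bar>Re (iexp (-(t * (sqrt (real n) * \<tau>))) * tilted_char n s t) - exp (- (\<sigma>2 * t\<^sup>2 / 2))\<bar>
      \<le> exp (- (t\<^sup>2 / 12)) * ((real n * Im W)\<^sup>2 / 2 + \<bar>real n * Re W - - (\<sigma>2 * t\<^sup>2 / 2)\<bar>)"
    using exp_cos_gaussian_diff_le[OF a g] by (simp only:)
  also have "\<dots> \<le> exp (- (t\<^sup>2 / 12)) * (C\<^sup>2 * t ^ 6 / 2 / real n + C * t ^ 4 / 2 / real n)"
  proof (intro mult_left_mono add_mono)
    have "(real n * Im W)\<^sup>2 \<le> (real n * (C * \<bar>v\<bar> ^ 3))\<^sup>2"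
      using Im by (intro power2_le_iff_abs_le[THEN iffD2]) (auto simp: abs_mult intro!: mult_left_mono)
    also have "\<dots> = C\<^sup>2 * (real n * v\<^sup>2) ^ 3 / real n"
      using n by (simp add: power_mult_distrib power2_eq_square power3_eq_cube flip: abs_mult)
    also have "\<dots> = C\<^sup>2 * t ^ 6 / real n" unfolding vn by (simp flip: power_mult)
    finally show "(real n * Im W)\<^sup>2 / 2 \<le> C\<^sup>2 * t ^ 6 / 2 / real n" by simp
    have "real n * Re W - - (\<sigma>2 * t\<^sup>2 / 2) = real n / 2 * (2 * Re W + v\<^sup>2 * \<sigma>2)"
      unfolding vn[symmetric] by (simp add: algebra_simps)
    then have "\<bar>real n * Re W - - (\<sigma>2 * t\<^sup>2 / 2)\<bar> = real n / 2 * \<bar>2 * Re W + v\<^sup>2 * \<sigma>2\<bar>"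
      by (simp only: abs_mult abs_divide abs_of_nat abs_numeral)
    also have "\<dots> \<le> real n / 2 * (C * v ^ 4)" using Re by (rule mult_left_mono) simp
    also have "\<dots> = C * (real n * v\<^sup>2)\<^sup>2 / 2 / real n"
      using n by (simp add: power2_eq_square power4_eq_xxxx)
    also have "\<dots> = C * t ^ 4 / 2 / real n" unfolding vn by (simp flip: power_mult)
    finally show "\<bar>real n * Re W - - (\<sigma>2 * t\<^sup>2 / 2)\<bar> \<le> C * t ^ 4 / 2 / real n" .
  qed simp
  also have "\<dots> = exp (- (t\<^sup>2 / 12)) * (C\<^sup>2 * t ^ 6 / 2 + C * t ^ 4 / 2) / real n"
    by (simp only: add_divide_distrib[symmetric] times_divide_eq_right)
  finally show ?thesis .
qed

text \<open>Away from the real axis the integrand itself is exponentially small, with \<open>2 * n0\<close> factors kept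
  for integrability. The Gaussian is compared with \<open>1 / n\<close> through
  \<open>1 \<le> t\<^sup>2 / (\<delta>\<^sup>2 * n)\<close>.\<close>

lemma tail_bound:
  fixes n n0 :: nat and s \<tau> t \<delta> \<rho> :: real
  defines "v \<equiv> t / sqrt (real n)" and "\<sigma>2 \<equiv> Re (K'' (of_real s))"
  assumes \<delta>: "\<delta> > 0" and v: "\<delta> \<le> \<bar>v\<bar>" and \<rho>: "norm (moment 0 (of_real s + \<i> * of_real v)) \<le> \<rho>"
    and n: "n \<ge> 1" "n \<ge> 2 * n0" and s: "\<bar>s\<bar> < \<alpha>" and \<sigma>2: "\<sigma>2 \<ge> 1 / 3"
  shows "\<bar>Re (iexp (-(t * (sqrt (real n) * \<tau>))) * tilted_char n s t) - exp (- (\<sigma>2 * t\<^sup>2 / 2))\<bar>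
    \<le> exp (- (t\<^sup>2 / 12)) * (t\<^sup>2 / \<delta>\<^sup>2) / real n
      + \<rho> ^ (n - 2 * n0) * norm (moment 0 (of_real s + \<i> * of_real v)) ^ (2 * n0)"
proof -
  define a where "a = norm (moment 0 (of_real s + \<i> * of_real v) / moment 0 (of_real s))"
  have a: "0 \<le> a" "a \<le> \<rho>" "a \<le> norm (moment 0 (of_real s + \<i> * of_real v))"
    using norm_laplace_ratio_le(2)[OF s, of v] \<rho> unfolding a_def by auto
  have "\<bar>Re (iexp (-(t * (sqrt (real n) * \<tau>))) * tilted_char n s t)\<bar> \<le> norm (tilted_char n s t)"
    by (rule order_trans[OF abs_Re_le_cmod]) (simp add: norm_mult norm_exp_eq_Re)
  also have "\<dots> = a ^ (n - 2 * n0) * a ^ (2 * n0)"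
    unfolding power_add[symmetric] using n by (simp add: tilted_char_def norm_power a_def v_def norm_divide)
  also have "\<dots> \<le> \<rho> ^ (n - 2 * n0) * norm (moment 0 (of_real s + \<i> * of_real v)) ^ (2 * n0)"
    using a by (intro mult_mono power_mono) auto
  finally have 1: "\<bar>Re (iexp (-(t * (sqrt (real n) * \<tau>))) * tilted_char n s t)\<bar>
      \<le> \<rho> ^ (n - 2 * n0) * norm (moment 0 (of_real s + \<i> * of_real v)) ^ (2 * n0)" .
  have "1 / 3 * t\<^sup>2 \<le> \<sigma>2 * t\<^sup>2" using \<sigma>2 by (rule mult_right_mono) simp
  then have "- (\<sigma>2 * t\<^sup>2 / 2) \<le> - (t\<^sup>2 / 12)" using zero_le_power2[of t] by linarith
  then have "exp (- (\<sigma>2 * t\<^sup>2 / 2)) \<le> exp (- (t\<^sup>2 / 12)) * 1" by simp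
  also have "\<dots> \<le> exp (- (t\<^sup>2 / 12)) * (t\<^sup>2 / \<delta>\<^sup>2 / real n)"
  proof (rule mult_left_mono)
    have "\<delta>\<^sup>2 \<le> v\<^sup>2" using v \<delta> by (simp add: abs_le_square_iff[symmetric])
    also have "v\<^sup>2 = t\<^sup>2 / real n" by (simp add: v_def power_divide)
    finally show "1 \<le> t\<^sup>2 / \<delta>\<^sup>2 / real n" using n \<delta> by (simp add: field_simps)
  qed simp
  finally have 2: "exp (- (\<sigma>2 * t\<^sup>2 / 2)) \<le> exp (- (t\<^sup>2 / 12)) * (t\<^sup>2 / \<delta>\<^sup>2) / real n" by simp
  show ?thesis
    using 1 2 abs_triangle_ineq4[of "Re (iexp (-(t * (sqrt (real n) * \<tau>))) * tilted_char n s t)" "exp (- (\<sigma>2 * t\<^sup>2 / 2))"]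
    by simp
qed

text \<open>Laplace's asymptotics for the inversion integral on the saddle line, uniformly in the saddle
  point. At \<open>x = sqrt n * \<tau>\<close> the saddle point equation removes the linear term of the exponent.
  The bounds near and away from the real axis combine to a multiple of \<open>1 / n\<close> by a fixed
  integrable function, plus an exponentially small multiple of an integral of order \<open>sqrt n\<close>.\<close>

lemma tilted_density_approx:
  assumes dens: "bounded_density N (norm_sum Xs n0) f" and n0: "n0 \<ge> 1"
  obtains r A where "r > 0" "r \<le> \<alpha> ^ 3 / 16" "A > 0"
    "\<And>s n. \<bar>s\<bar> \<le> r \<Longrightarrow> n \<ge> 2 * n0 \<Longrightarrow> integrable lborel (tilted_char n s)"
    "\<And>s \<tau> n. \<bar>s\<bar> \<le> r \<Longrightarrow> n \<ge> 2 * n0 \<Longrightarrow> K' (of_real s) = of_real \<tau> \<Longrightarrow>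
      \<bar>2 * pi * inverse_fourier_density (tilted_char n s) (sqrt (real n) * \<tau>) - sqrt (2 * pi / Re (K'' (of_real s)))\<bar> \<le> A / real n"
proof -
  obtain C where C: "C > 0"
    and T3: "\<And>s t. \<bar>s\<bar> \<le> \<alpha> / 4 \<Longrightarrow> \<bar>t\<bar> \<le> \<alpha> / 4 \<Longrightarrow>
      norm (K (of_real s + \<i> * of_real t) - K (of_real s) - \<i> * of_real t * deriv K (of_real s)
        + of_real (t\<^sup>2 / 2) * deriv (deriv K) (of_real s)) \<le> C * \<bar>t\<bar> ^ 3"
    and T4: "\<And>s t. \<bar>s\<bar> \<le> \<alpha> / 4 \<Longrightarrow> \<bar>t\<bar> \<le> \<alpha> / 4 \<Longrightarrow>
      norm (K (of_real s + \<i> * of_real t) + K (of_real s - \<i> * of_real t) - 2 * K (of_real s)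
        + of_real (t\<^sup>2) * deriv (deriv K) (of_real s)) \<le> C * t ^ 4"
    using vertical_taylor_bounds[OF K_holomorphic \<alpha>_pos] by blast
  \<comment> \<open>\<open>\<delta>\<close> separates the two ranges of frequencies; it depends on \<open>\<alpha>\<close> and the Taylor constant only, so that
    the strip of admissible \<open>s\<close> can be chosen afterwards.\<close>
  define \<delta> where "\<delta> = min (\<alpha> / 4) (sqrt (1 / (6 * C)))"
  have \<delta>: "\<delta> > 0" "\<delta> \<le> \<alpha> / 4" using C \<alpha>_pos by (auto simp: \<delta>_def)
  have C\<delta>: "C * \<delta>\<^sup>2 \<le> 1 / 6"
  proof -
    have "\<delta>\<^sup>2 \<le> (sqrt (1 / (6 * C)))\<^sup>2" using \<delta> by (intro power_mono) (auto simp: \<delta>_def)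
    then have "\<delta>\<^sup>2 \<le> 1 / (6 * C)" using C by simp
    then show ?thesis using C by (simp add: field_simps)
  qed
  obtain CP where CP: "CP > 0"
    and intP: "\<And>s c. \<bar>s\<bar> \<le> \<alpha> / 4 \<Longrightarrow> c > 0 \<Longrightarrow>
        integrable lborel (\<lambda>t. norm (moment 0 (of_real s + \<i> * of_real (t / c))) ^ (2 * n0))"
    and leP: "\<And>s c. \<bar>s\<bar> \<le> \<alpha> / 4 \<Longrightarrow> c > 0 \<Longrightarrow>
        (LBINT t. norm (moment 0 (of_real s + \<i> * of_real (t / c))) ^ (2 * n0)) \<le> CP * c"
    using laplace_power_integrable[OF dens n0] by blast
  have "integrable lborel (\<lambda>t. norm (moment 0 (\<i> * of_real t)) ^ (2 * n0))"
    using intP[of 0 1] \<alpha>_pos by simp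
  then obtain s0 \<rho> where s0: "0 < s0" and \<rho>: "0 < \<rho>" "\<rho> < 1"
    and away: "\<And>s t. \<bar>s\<bar> \<le> s0 \<Longrightarrow> \<delta> \<le> \<bar>t\<bar> \<Longrightarrow> norm (moment 0 (of_real s + \<i> * of_real t)) \<le> \<rho>"
    using laplace_away_from_real_axis[OF _ \<delta>(1)] by blast
  obtain D where D: "D > 0" "\<And>n. (real n)\<^sup>2 * \<rho> ^ n \<le> D"
    using square_mult_power_bounded[OF \<rho>] by blast
  define r where "r = min s0 (\<alpha> ^ 3 / 16)"
  have r: "r > 0" "r \<le> s0" "r \<le> \<alpha> ^ 3 / 16" using s0 \<alpha>_pos by (auto simp: r_def)
  have r4: "r \<le> \<alpha> / 4" using r \<alpha>_cubed_bounds(1) \<alpha>_pos by simp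
  \<comment> \<open>\<open>h t / n\<close> dominates the error near the real axis and the Gaussian tail.\<close>
  define h where "h t = exp (- (t\<^sup>2 / 12)) * (t\<^sup>2 / \<delta>\<^sup>2 + C * t ^ 4 / 2 + C\<^sup>2 * t ^ 6 / 2)" for t :: real
  have ih: "integrable lborel h"
  proof -
    have g: "integrable lborel (\<lambda>t::real. exp (- (t\<^sup>2 / 12)) * t ^ k)" for k
      using integrable_gaussian_power[of "1 / 6" k] by simp
    have "integrable lborel (\<lambda>t. 1 / \<delta>\<^sup>2 * (exp (- (t\<^sup>2 / 12)) * t ^ 2) + C / 2 * (exp (- (t\<^sup>2 / 12)) * t ^ 4)
        + C\<^sup>2 / 2 * (exp (- (t\<^sup>2 / 12)) * t ^ 6))"
      by (intro Bochner_Integration.integrable_add integrable_mult_right g)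
    then show ?thesis unfolding h_def by (simp add: algebra_simps)
  qed
  define A where "A = (LBINT t. h t) + D / \<rho> ^ (2 * n0) * CP"
  have h0: "h t \<ge> 0" for t using C by (simp add: h_def)
  have A: "A > 0"
    unfolding A_def using D CP \<rho> h0 by (intro add_nonneg_pos mult_pos_pos) auto
  have int: "integrable lborel (tilted_char n s)" if s: "\<bar>s\<bar> \<le> r" and n: "n \<ge> 2 * n0" for s n
    using s n n0 r4 \<alpha>_pos by (intro tilted_char_integrable[of s n0] intP) auto
  show ?thesis
  proof (rule that[of r A])
    fix s \<tau> :: real and n :: nat
    assume s: "\<bar>s\<bar> \<le> r" and n: "n \<ge> 2 * n0" and \<tau>: "K' (of_real s) = of_real \<tau>"
    define \<sigma>2 where "\<sigma>2 = Re (K'' (of_real s))"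
    have \<sigma>2: "\<sigma>2 \<ge> 1 / 3" unfolding \<sigma>2_def using s r by (intro Re_K''_bounds(1)) simp
    have n1: "n \<ge> 1" using n n0 by simp
    have s4: "\<bar>s\<bar> \<le> \<alpha> / 4" and sa: "\<bar>s\<bar> < \<alpha>" using s r4 \<alpha>_pos by auto
    define I where "I t = Re (iexp (-(t * (sqrt (real n) * \<tau>))) * tilted_char n s t)" for t
    define P where "P t = norm (moment 0 (of_real s + \<i> * of_real (t / sqrt (real n)))) ^ (2 * n0)" for t
    have iP: "integrable lborel P" and leP': "(LBINT t. P t) \<le> CP * sqrt (real n)"
      unfolding P_def using n1 by (intro intP leP s4; simp)+
    have iI: "integrable lborel I"
      unfolding I_def by (rule integrable_Re[OF fourier_integrand_integrable[OF int[OF s n]]])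
    have ig: "integrable lborel (\<lambda>t. exp (- (\<sigma>2 * t\<^sup>2 / 2)))" using \<sigma>2 by (intro integral_gaussian) simp
    have eqI: "2 * pi * inverse_fourier_density (tilted_char n s) (sqrt (real n) * \<tau>) = (LBINT t. I t)"
      unfolding inverse_fourier_density_def fourier_integral_def I_def
      using integral_Re[OF fourier_integrand_integrable[OF int[OF s n]], of "sqrt (real n) * \<tau>"] by simp
    have pw: "\<bar>I t - exp (- (\<sigma>2 * t\<^sup>2 / 2))\<bar> \<le> h t / real n + \<rho> ^ (n - 2 * n0) * P t" for t
    proof (cases "\<bar>t / sqrt (real n)\<bar> \<le> \<delta>")
      case True
      define v where "v = t / sqrt (real n)"
      have v: "\<bar>v\<bar> \<le> \<delta>" "\<bar>v\<bar> \<le> \<alpha> / 4" using True \<delta> unfolding v_def by linarith+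
      have "v\<^sup>2 \<le> \<delta>\<^sup>2" using v \<delta> by (simp add: abs_le_square_iff[symmetric])
      then have "C * v\<^sup>2 \<le> C * \<delta>\<^sup>2" using C by (intro mult_left_mono) auto
      then have Cv: "C * v\<^sup>2 \<le> 1 / 6" using C\<delta> by simp
      have sv: "norm (of_real s + \<i> * of_real v :: complex) < \<alpha>"
        using norm_triangle_ineq[of "of_real s" "\<i> * complex_of_real v"] s4 v \<alpha>_pos by (simp add: norm_mult)
      have d: "deriv K (of_real s) = K' (of_real s)" "deriv (deriv K) (of_real s) = K'' (of_real s)"
        using sa by (simp_all add: deriv_K deriv_deriv_K)
      have "\<bar>I t - exp (- (\<sigma>2 * t\<^sup>2 / 2))\<bar> \<le> exp (- (t\<^sup>2 / 12)) * (C\<^sup>2 * t ^ 6 / 2 + C * t ^ 4 / 2) / real n"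
        unfolding I_def \<sigma>2_def
        by (rule central_bound[OF C]) (use T3[OF s4 v(2)] T4[OF s4 v(2)] n1 sa sv \<tau> Cv \<sigma>2 in \<open>simp_all only: d v_def \<sigma>2_def\<close>)
      also have "\<dots> \<le> h t / real n"
        unfolding h_def by (intro divide_right_mono mult_left_mono) auto
      also have "\<dots> \<le> h t / real n + \<rho> ^ (n - 2 * n0) * P t" using \<rho> by (simp add: P_def)
      finally show ?thesis .
    next
      case False
      then have v: "\<delta> \<le> \<bar>t / sqrt (real n)\<bar>" by simp
      have "\<bar>I t - exp (- (\<sigma>2 * t\<^sup>2 / 2))\<bar> \<le> exp (- (t\<^sup>2 / 12)) * (t\<^sup>2 / \<delta>\<^sup>2) / real n + \<rho> ^ (n - 2 * n0) * P t"
        unfolding I_def \<sigma>2_def P_def using s r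
        by (intro tail_bound[OF \<delta>(1) v away[OF _ v] n1 n sa]) (use \<sigma>2 in \<open>simp_all add: \<sigma>2_def\<close>)
      also have "exp (- (t\<^sup>2 / 12)) * (t\<^sup>2 / \<delta>\<^sup>2) / real n \<le> h t / real n"
        unfolding h_def using C by (intro divide_right_mono mult_left_mono) auto
      finally show ?thesis by simp
    qed
    have "\<bar>(LBINT t. I t) - sqrt (2 * pi / \<sigma>2)\<bar> = \<bar>LBINT t. I t - exp (- (\<sigma>2 * t\<^sup>2 / 2))\<bar>"
      using iI ig \<sigma>2 by (simp add: integral_gaussian(2))
    also have "\<dots> \<le> (LBINT t. \<bar>I t - exp (- (\<sigma>2 * t\<^sup>2 / 2))\<bar>)" by (rule integral_abs_bound)
    also have "\<dots> \<le> (LBINT t. h t / real n + \<rho> ^ (n - 2 * n0) * P t)"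
      using iI ig ih iP pw by (intro integral_mono) auto
    also have "\<dots> = (LBINT t. h t) / real n + \<rho> ^ (n - 2 * n0) * (LBINT t. P t)"
      using ih iP by simp
    also have "\<dots> \<le> (LBINT t. h t) / real n + D / \<rho> ^ (2 * n0) * CP / real n"
    proof -
      have "sqrt (real n) \<le> real n" using n1 by (simp add: real_le_lsqrt power2_eq_square)
      then have "\<rho> ^ (n - 2 * n0) * (LBINT t. P t) \<le> \<rho> ^ (n - 2 * n0) * (CP * real n)"
        using leP' CP \<rho> by (intro mult_left_mono order_trans[OF leP'] mult_left_mono) auto
      also have "\<dots> = (real n)\<^sup>2 * \<rho> ^ n / \<rho> ^ (2 * n0) * CP / real n"
        using n n1 \<rho> by (simp add: power_diff power2_eq_square)
      also have "\<dots> \<le> D / \<rho> ^ (2 * n0) * CP / real n"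
        using D(2)[of n] \<rho> CP by (intro divide_right_mono mult_right_mono) auto
      finally show ?thesis by simp
    qed
    also have "\<dots> = A / real n" by (simp add: A_def add_divide_distrib)
    finally show "\<bar>2 * pi * inverse_fourier_density (tilted_char n s) (sqrt (real n) * \<tau>) - sqrt (2 * pi / Re (K'' (of_real s)))\<bar> \<le> A / real n"
      unfolding eqI \<sigma>2_def .
  qed (use r A int in auto)
qed

end

section \<open>The expansion of the density\<close>

context iid_sums
begin

text \<open>Undoing the tilt at the saddle point produces the factor \<open>exp (n * (K s - s * \<tau>))\<close>, and division
  by the normal density adds \<open>n * \<tau>\<^sup>2 / 2\<close> to the exponent: this is \<open>n * \<tau> ^ 3 * \<lambda> \<tau>\<close> by
  definition of \<open>\<lambda>\<close>. The Gaussian main term contributes \<open>1 / sqrt (K'' s)\<close>, which is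
  \<open>exp (- \<mu> \<tau>)\<close>. The error is of order \<open>1 / n\<close>; since \<open>n \<ge> 2\<close>, the logarithm is bounded below
  by \<open>ln 2\<close>.\<close>

lemma saddle_point_expansion:
  fixes n :: nat and s \<tau> x A :: real
  assumes n: "n \<ge> 2" and s: "\<bar>s\<bar> \<le> \<alpha> ^ 3 / 16"
    and sp: "saddle_point M X \<alpha> (of_real \<tau>) = of_real s"
    and x: "x = sqrt (real n) * \<tau>"
    and int0: "integrable lborel (tilted_char n 0)" and ints: "integrable lborel (tilted_char n s)"
    and approx: "\<bar>2 * pi * inverse_fourier_density (tilted_char n s) x - sqrt (2 * pi / Re (K'' (of_real s)))\<bar> \<le> A / real n"
  shows "\<exists>R. \<bar>R\<bar> \<le> A / (ln 2) ^ 3 * ((ln (real n)) ^ 3 / real n) \<and>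
    complex_of_real (cont_density N (norm_sum Xs n) x / std_normal_density x)
      = exp (of_nat n * (of_real \<tau>) ^ 3 * cramer_lambda M X \<alpha> (of_real \<tau>) - cramer_mu M X \<alpha> (of_real \<tau>))
        * (1 + complex_of_real R)"
proof -
  define J where "J = 2 * pi * inverse_fourier_density (tilted_char n s) x"
  define \<sigma>2 where "\<sigma>2 = Re (K'' (of_real s))"
  define k where "k = Re (K (of_real s))"
  define p where "p = cont_density N (norm_sum Xs n) x"
  have \<sigma>2: "\<sigma>2 \<ge> 1 / 3" "\<sigma>2 \<le> 5 / 3"
    unfolding \<sigma>2_def using Re_K''_bounds[of "of_real s"] s by auto
  have sa: "\<bar>s\<bar> < \<alpha>" using radius_less[of "of_real s"] s by simp
  have Ks: "K (of_real s) = of_real k" unfolding k_def by (rule K_of_real[OF sa])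
  have "moment 0 (of_real s) = of_real (exp k)"
    using exp_K[of "of_real s"] sa by (simp add: Ks exp_of_real)
  then have tw: "tilt_weight n s x = exp (real n * (s * \<tau>)) / exp k ^ n"
    using n by (simp add: tilt_weight_def x mult_ac)
  have p: "p = exp (real n * (k - s * \<tau>)) * (J / (2 * pi))"
  proof -
    have "tilt_weight n s x * p = J / (2 * pi)"
      unfolding p_def J_def using cont_density_tilt[OF _ sa int0 ints, of x] n by simp
    moreover have "exp (real n * (k - s * \<tau>)) * tilt_weight n s x = 1"
      unfolding tw by (simp add: right_diff_distrib exp_diff exp_of_nat_mult)
    ultimately show ?thesis by (metis mult.assoc mult_1)
  qed
  define E where "E = real n * (k - s * \<tau> + \<tau>\<^sup>2 / 2)"
  have q: "p / std_normal_density x = exp E * (J / sqrt (2 * pi))"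
  proof -
    have "x\<^sup>2 = real n * \<tau>\<^sup>2" by (simp add: x power_mult_distrib)
    then have "p / std_normal_density x = p * sqrt (2 * pi) * exp (real n * \<tau>\<^sup>2 / 2)"
      by (simp add: std_normal_density_def exp_minus field_simps)
    also have "\<dots> = exp (real n * (k - s * \<tau>) + real n * \<tau>\<^sup>2 / 2) * (J * (sqrt (2 * pi) / (2 * pi)))"
      by (simp add: p exp_add)
    also have "sqrt (2 * pi) / (2 * pi) = 1 / sqrt (2 * pi)"
      by (simp add: field_simps flip: power2_eq_square)
    finally show ?thesis by (simp add: E_def algebra_simps)
  qed
  have l: "of_nat n * (of_real \<tau>) ^ 3 * cramer_lambda M X \<alpha> (of_real \<tau>) = complex_of_real E"
  proof -
    have "(of_real \<tau>) ^ 3 * cramer_lambda M X \<alpha> (of_real \<tau>) = K (of_real s) - of_real \<tau> * of_real s + (of_real \<tau>)\<^sup>2 / 2"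
      by (rule exp_cramer_lambda[OF sp]) (use sa in simp)
    then show ?thesis unfolding mult.assoc by (simp add: Ks E_def mult_ac)
  qed
  have rhs: "exp (of_nat n * (of_real \<tau>) ^ 3 * cramer_lambda M X \<alpha> (of_real \<tau>) - cramer_mu M X \<alpha> (of_real \<tau>))
      = complex_of_real (exp E * (1 / sqrt \<sigma>2))"
  proof -
    have "exp (complex_of_real E - cramer_mu M X \<alpha> (of_real \<tau>)) = exp (complex_of_real E) * exp (- cramer_mu M X \<alpha> (of_real \<tau>))"
      by (simp flip: exp_add)
    then show ?thesis
      unfolding l exp_minus_cramer_mu[OF sp s] \<sigma>2_def exp_of_real of_real_mult .
  qed
  define R where "R = sqrt \<sigma>2 / sqrt (2 * pi) * (J - sqrt (2 * pi / \<sigma>2))"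
  have "1 + R = sqrt \<sigma>2 / sqrt (2 * pi) * J"
    using \<sigma>2 by (simp add: R_def right_diff_distrib real_sqrt_divide)
  then have eq: "p / std_normal_density x = exp E * (1 / sqrt \<sigma>2) * (1 + R)"
    unfolding q using \<sigma>2 by simp
  have AJ: "\<bar>J - sqrt (2 * pi / \<sigma>2)\<bar> \<le> A / real n"
    using approx by (simp add: J_def \<sigma>2_def)
  then have A: "A / real n \<ge> 0" using abs_ge_zero order_trans by blast
  have "\<bar>R\<bar> = sqrt (\<sigma>2 / (2 * pi)) * \<bar>J - sqrt (2 * pi / \<sigma>2)\<bar>"
    using \<sigma>2 by (simp add: R_def abs_mult real_sqrt_divide)
  also have "\<dots> \<le> 1 * (A / real n)"
  proof (rule mult_mono[OF _ AJ])
    have "\<sigma>2 \<le> 2 * pi" using \<sigma>2 pi_gt3 by simp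
    then show "sqrt (\<sigma>2 / (2 * pi)) \<le> 1" by simp
  qed auto
  also have "\<dots> \<le> A / real n * (ln (real n) / ln 2) ^ 3"
  proof -
    have "ln 2 \<le> ln (real n)" using n by simp
    then have "1 \<le> (ln (real n) / ln 2) ^ 3" by (intro one_le_power) simp
    then show ?thesis using mult_left_mono[OF _ A] by fastforce
  qed
  also have "\<dots> = A / (ln 2) ^ 3 * ((ln (real n)) ^ 3 / real n)" by (simp add: power_divide)
  finally have "\<bar>R\<bar> \<le> A / (ln 2) ^ 3 * ((ln (real n)) ^ 3 / real n)" .
  then show ?thesis
    using eq unfolding rhs p_def[symmetric] by (intro exI[of _ R]) simp
qed

end

theorem theorem1p2:
  fixes M :: "'a measure" and N :: "'b measure"
    and X :: "'a \<Rightarrow> real" and Xs :: "nat \<Rightarrow> 'b \<Rightarrow> real"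
    and b \<alpha> :: real and n0 :: nat
  assumes "prob_space M" and "prob_space N"
    and "X \<in> borel_measurable M"
    and "prob_space.expectation M X = 0" and "prob_space.variance M X = 1"
    and "b > 0" and "integrable M (\<lambda>\<omega>. exp (b * \<bar>X \<omega>\<bar>))"
    and "prob_space.indep_vars N (\<lambda>_. borel) Xs {1..}"
    and "\<And>k. k \<ge> 1 \<Longrightarrow> distr N borel (Xs k) = distr M borel X"
    and "n0 \<ge> 1" and "\<exists>f. bounded_density N (norm_sum Xs n0) f"
    and "exp_radius M X \<alpha>"
  shows "\<exists>\<tau>0>0. \<tau>0 \<le> \<alpha>^3 / 32 \<and>
    cramer_mu M X \<alpha> analytic_on cball 0 \<tau>0 \<and> cramer_mu M X \<alpha> 0 = 0 \<and>
    (\<exists>C::real. \<forall>n\<ge>2 * n0. \<forall>x::real. \<bar>x / sqrt (real n)\<bar> \<le> \<tau>0 \<longrightarrow>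
      (let \<tau> = complex_of_real (x / sqrt (real n)) in
        \<exists>R::real. \<bar>R\<bar> \<le> C * ((ln (real n))^3 / real n) \<and>
          complex_of_real (cont_density N (norm_sum Xs n) x / std_normal_density x) =
          exp (of_nat n * \<tau>^3 * cramer_lambda M X \<alpha> \<tau> - cramer_mu M X \<alpha> \<tau>)
            * (1 + complex_of_real R)))"
proof -
  interpret M: prob_space M by fact
  interpret N: prob_space N by fact
  interpret iid_sums M X \<alpha> N Xs
    by unfold_locales (use assms in auto)
  obtain f where f: "bounded_density N (norm_sum Xs n0) f" using assms(11) by blast
  obtain r A where r: "r > 0" "r \<le> \<alpha> ^ 3 / 16" "A > 0"
    and int: "\<And>s n. \<bar>s\<bar> \<le> r \<Longrightarrow> n \<ge> 2 * n0 \<Longrightarrow> integrable lborel (tilted_char n s)"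
    and approx: "\<And>s \<tau> n. \<bar>s\<bar> \<le> r \<Longrightarrow> n \<ge> 2 * n0 \<Longrightarrow> K' (of_real s) = of_real \<tau> \<Longrightarrow>
      \<bar>2 * pi * inverse_fourier_density (tilted_char n s) (sqrt (real n) * \<tau>) - sqrt (2 * pi / Re (K'' (of_real s)))\<bar> \<le> A / real n"
    using tilted_density_approx[OF f assms(10)] by metis
  obtain d where d: "d > 0" "saddle_point M X \<alpha> holomorphic_on ball 0 d"
    "\<And>\<tau>. norm \<tau> < d \<Longrightarrow> norm (saddle_point M X \<alpha> \<tau>) < r"
    "\<And>\<tau>. norm \<tau> < d \<Longrightarrow> K' (saddle_point M X \<alpha> \<tau>) = \<tau>"
    using saddle_point_local[OF r(1,2)] by metis
  \<comment> \<open>Half the radius of analyticity, so that the closed disc lies inside the open one.\<close>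
  define \<tau>0 where "\<tau>0 = min (d / 2) (\<alpha> ^ 3 / 32)"
  have \<tau>0: "\<tau>0 > 0" "\<tau>0 < d" "\<tau>0 \<le> \<alpha> ^ 3 / 32" using d \<alpha>_pos by (auto simp: \<tau>0_def)
  have small: "norm (saddle_point M X \<alpha> \<tau>) \<le> \<alpha> ^ 3 / 16" if "norm \<tau> < d" for \<tau>
    using d(3)[OF that] r(2) by simp
  have "cramer_mu M X \<alpha> analytic_on ball 0 d"
    using cramer_mu_holomorphic[OF d(2) small] by (simp add: analytic_on_open)
  then have an: "cramer_mu M X \<alpha> analytic_on cball 0 \<tau>0"
    by (rule analytic_on_subset) (use \<tau>0 in auto)
  have main: "\<exists>R::real. \<bar>R\<bar> \<le> A / (ln 2) ^ 3 * ((ln (real n))^3 / real n) \<and>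
          complex_of_real (cont_density N (norm_sum Xs n) x / std_normal_density x) =
          exp (of_nat n * (complex_of_real (x / sqrt (real n)))^3 * cramer_lambda M X \<alpha> (complex_of_real (x / sqrt (real n)))
            - cramer_mu M X \<alpha> (complex_of_real (x / sqrt (real n)))) * (1 + complex_of_real R)"
    if n: "n \<ge> 2 * n0" and x: "\<bar>x / sqrt (real n)\<bar> \<le> \<tau>0" for n x
  proof -
    define \<tau> where "\<tau> = x / sqrt (real n)"
    have n2: "n \<ge> 2" using n assms(10) by simp
    have \<tau>d: "norm (complex_of_real \<tau>) < d" using x \<tau>0 unfolding norm_of_real \<tau>_def by linarith
    obtain s where s: "saddle_point M X \<alpha> (of_real \<tau>) = of_real s"
      using saddle_point_real[OF small[OF \<tau>d] d(4)[OF \<tau>d]] .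
    have sr: "\<bar>s\<bar> \<le> r" using d(3)[OF \<tau>d] by (simp add: s)
    have K's: "K' (of_real s) = of_real \<tau>" using d(4)[OF \<tau>d] by (simp add: s)
    have x\<tau>: "x = sqrt (real n) * \<tau>" using n2 by (simp add: \<tau>_def)
    show ?thesis
      unfolding \<tau>_def[symmetric]
      by (rule saddle_point_expansion[OF n2 _ s x\<tau>])
         (use sr r n K's in \<open>auto intro!: int approx simp: x\<tau>\<close>)
  qed
  show ?thesis
    unfolding Let_def using \<tau>0 an cramer_mu_0 main by blast
qed

end
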